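(* Let $\mu$ be a centered probability measure on $\mathbb{R}^d$ with finite second moments. Then there exists a probability measure $\nu$ on $\mathbb{R}^d$ with $\mathrm{Cov}(\nu)\preceq\mathrm{Cov}(\mu)$ such that: if $\delta_{\mathrm{Tal}}(\mu)\geq d$, then $$\delta_{\mathrm{Tal}}(\mu)\geq\frac{\mathrm{D}(\mu||\nu*\gamma)}{6},$$ and if $\delta_{\mathrm{Tal}}(\mu)<d$, then $$\delta_{\mathrm{Tal}}(\mu)\geq\frac{1}{3\sqrt3}\,\frac{\mathrm{D}(\mu||\nu*\gamma)^{3/2}}{\sqrt d}.$$
   Context: $\gamma$ is the standard Gaussian measure on $\mathbb{R}^d$ and $\nu*\gamma$ denotes convolution. The relative entropy of probability measures is $\mathrm{D}(\mu||\rho)=\int\ln\left(\frac{d\mu}{d\rho}\right)d\mu$, with value $+\infty$ if $\mu$ is not absolutely continuous with respect to $\rho$. The quadratic Wasserstein distance is $\mathcal{W}_2(\mu,\gamma)=\left(\inf_\pi\int_{\mathbb{R}^{2d}}\|x-y\|_2^2\,d\pi(x,y)\right)^{1/2}$, the infimum being over couplings $\pi$ of $\mu$ and $\gamma$. The deficit in Talagrand's inequality is $\delta_{\mathrm{Tal}}(\mu)=2\mathrm{D}(\mu||\gamma)-\mathcal{W}_2^2(\mu,\gamma)$ (equal to $+\infty$ if $\mathrm{D}(\mu||\gamma)=\infty$). $\mathrm{Cov}$ denotes the covariance matrix (finite for both $\mu$ and $\nu$), and $\preceq$ is the positive semidefinite order. Centered means $\int x\,d\mu(x)=0$. *)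

theory Defs
  imports "HOL-Probability.Probability"
begin

definition std_gaussian :: "(real ^ 'n) measure" where
  "std_gaussian = density lborel (\<lambda>x. ennreal (\<Prod>i\<in>UNIV. std_normal_density (x $ i)))"

definition prob_measure_finite_second_moment :: "(real ^ 'n) measure \<Rightarrow> bool" where
  "prob_measure_finite_second_moment \<mu> \<longleftrightarrow>
     prob_space \<mu> \<and> sets \<mu> = sets borel \<and> integrable \<mu> (\<lambda>x. (norm x)\<^sup>2)"

definition barycenter :: "(real ^ 'n) measure \<Rightarrow> real ^ 'n" where
  "barycenter \<mu> = (\<integral>x. x \<partial>\<mu>)"

definition cov_matrix :: "(real ^ 'n) measure \<Rightarrow> real ^ 'n ^ 'n" where
  "cov_matrix \<mu> =
     (\<chi> i j. \<integral>x. (x $ i - barycenter \<mu> $ i) * (x $ j - barycenter \<mu> $ j) \<partial>\<mu>)"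

definition psd_matrix :: "real ^ 'n ^ 'n \<Rightarrow> bool" where
  "psd_matrix A \<longleftrightarrow> transpose A = A \<and> (\<forall>v. 0 \<le> v \<bullet> (A *v v))"

definition psd_le :: "real ^ 'n ^ 'n \<Rightarrow> real ^ 'n ^ 'n \<Rightarrow> bool" (infix \<open>\<preceq>\<close> 50) where
  "A \<preceq> B \<longleftrightarrow> psd_matrix (B - A)"

(* Only meant for x >= 0 and p > 0. *)
definition epowr :: "ereal \<Rightarrow> real \<Rightarrow> ereal" (infixr \<open>epowr\<close> 80) where
  "x epowr p = (if x = \<infinity> then \<infinity> else ereal (real_of_ereal x powr p))"

(* The integral of ln (d\<mu>/d\<rho>) is taken in the extended reals, as positive part minus
   negative part, because ln (d\<mu>/d\<rho>) need not be \<mu>-integrable (in that case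
   KL_divergence would return 0).  For probability measures the negative part has finite
   integral, so the subtraction never has the form \<infinity> - \<infinity>. *)
definition relative_entropy :: "'a measure \<Rightarrow> 'a measure \<Rightarrow> ereal" where
  "relative_entropy \<mu> \<rho> =
     (if absolutely_continuous \<rho> \<mu>
      then enn2ereal (\<integral>\<^sup>+x. ennreal (ln (enn2real (RN_deriv \<rho> \<mu> x))) \<partial>\<mu>)
         - enn2ereal (\<integral>\<^sup>+x. ennreal (- ln (enn2real (RN_deriv \<rho> \<mu> x))) \<partial>\<mu>)
      else \<infinity>)"

definition couplings :: "(real ^ 'n) measure \<Rightarrow> (real ^ 'n) measure
    \<Rightarrow> ((real ^ 'n) \<times> (real ^ 'n)) measure set" where
  "couplings \<mu> \<nu> =
     {\<pi>. prob_space \<pi> \<and> sets \<pi> = sets borel \<and> distr \<pi> borel fst = \<mu> \<and> distr \<pi> borel snd = \<nu>}"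

definition wasserstein2 :: "(real ^ 'n) measure \<Rightarrow> (real ^ 'n) measure \<Rightarrow> ereal" where
  "wasserstein2 \<mu> \<nu> =
     enn2ereal (INF \<pi>\<in>couplings \<mu> \<nu>. \<integral>\<^sup>+(x, y). ennreal ((norm (x - y))\<^sup>2) \<partial>\<pi>) epowr (1 / 2)"

definition talagrand_deficit :: "(real ^ 'n) measure \<Rightarrow> ereal" where
  "talagrand_deficit \<mu> =
     (if relative_entropy \<mu> std_gaussian = \<infinity> then \<infinity>
      else 2 * relative_entropy \<mu> std_gaussian - (wasserstein2 \<mu> std_gaussian)\<^sup>2)"

end

theory Submission
  imports Defs "HOL-Real_Asymp.Real_Asymp"
begin

text \<open>Let \<open>\<mu> = f \<gamma>\<close> and let \<open>W = a g + b h\<close> with \<open>a\<^sup>2 + b\<^sup>2 = 1\<close>. Under the measure with density \<open>f(W)\<close>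
  with respect to \<open>\<gamma> \<otimes> \<gamma>\<close> the vector \<open>W\<close> has law \<open>\<mu>\<close>. This replaces the Foellmer process by a single
  intermediate time \<open>a\<^sup>2\<close>. Transport the law of \<open>g\<close>, and the law of \<open>h\<close> given \<open>g\<close>, to \<open>\<gamma>\<close> by maps that
  satisfy Talagrand's inequality. Only the conditional mean \<open>\<eta>(g)\<close> of \<open>h\<close> enters the cross term of
  the resulting coupling, and the cost leaves a deficit of at least \<open>2 a\<^sup>2 D\<close>, where \<open>D\<close> is the mean entropy
  of \<open>h - \<eta>(g)\<close> given \<open>g\<close> relative to \<open>\<gamma>\<close>.

  Take for \<open>\<nu>\<close> the law of the conditional expectation of \<open>W\<close> given \<open>g\<close>. Given \<open>g\<close>, the variable \<open>W\<close> is its mean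
  plus \<open>b (h - \<eta>(g))\<close>, so that \<open>\<mu>\<close> differs from \<open>\<nu> * \<gamma>\<close> in entropy by at most \<open>2 D + d a\<^sup>4\<close>, the second term
  coming from the covariance \<open>b\<^sup>2 I\<close> in place of \<open>I\<close>. With \<open>a\<^sup>2 = 1/2\<close> if \<open>\<delta> \<ge> d\<close>, and
  \<open>a\<^sup>2 = (\<delta>/d) powr (1/3) / 2\<close> if \<open>0 < \<delta> < d\<close>, the two bounds give the theorem. If \<open>\<delta> = 0\<close> then \<open>D = 0\<close>, the
  conditional law of \<open>h\<close> is a translate of \<open>\<gamma>\<close>, hence so is \<open>\<mu>\<close>, and \<open>\<nu>\<close> is a point mass.\<close>

section \<open>The one-dimensional transport inequality\<close>

text \<open>The exponent 3/2 rests on the error \<open>d a^4\<close>. Comparing \<open>W\<close>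
  given g with a unit Gaussian loses \<open>- d ln b\<close>, of order \<open>d a^2\<close>;
  balanced against \<open>\<delta> / a^2\<close>, this alone would give exponent 2. The loss comes
  with a gain \<open>a^2 u / 2\<close>, where u is the mean squared norm of
  \<open>h - \<eta>(g)\<close>. A small u would spoil the cancellation, but it makes
  \<open>D\<close> large, as comparison with the Gaussian of covariance \<open>b^2 I\<close> shows.
  Eliminating u leaves \<open>d a^4\<close>, at the price of the factor 2 in \<open>2 D\<close>.

  As \<open>2 D \<le> \<delta> / a^2\<close>, the terms \<open>\<delta> / a^2\<close> and
  \<open>d a^4\<close> balance at \<open>a^2\<close> of order
  \<open>(\<delta> / d) powr (1/3)\<close>; the extra factor 1/2 keeps \<open>a^2 \<le> 1/2\<close>,
  which the estimate of \<open>ln b\<close> uses. At \<open>\<delta> = 0\<close> the choice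
  degenerates to \<open>a = 0\<close>, and the equality case of Gibbs' inequality takes the place of
  a limit.

  The law of h given g must be transported by a map measurable in g as well. Hence the transport
  inequality is built for parametrized families, from explicit quantile maps in dimension
  one.\<close>

lemma real_distribution_std_normal: "real_distribution std_normal_distribution"
  unfolding real_distribution_def real_distribution_axioms_def
  using prob_space_normal_density[of 1 0] by simp

interpretation std_normal: real_distribution std_normal_distribution
  by (rule real_distribution_std_normal)

text \<open>The cdf may be flat, so the level p may be attained on a whole interval. By continuity
  this level set is closed, and its supremum is the y wanted.\<close>

lemma cdf_at_most_level:
  assumes "real_distribution M" and cont: "\<And>x. isCont (cdf M) x" and p: "0 < p" "p < 1"
  obtains y where "cdf M y = p" "{x. cdf M x \<le> p} = {..y}"
proof -
  interpret real_distribution M by fact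
  have mono: "x \<le> y \<Longrightarrow> cdf M x \<le> cdf M y" for x y by (rule cdf_nondecreasing)
  have "eventually (\<lambda>x. cdf M x > p) at_top"
    using order_tendstoD(1)[OF cdf_lim_at_top_prob p(2)] .
  then obtain b where b: "cdf M b > p" by (auto simp: eventually_at_top_linorder)
  have "eventually (\<lambda>x. cdf M x < p) at_bot"
    using order_tendstoD(2)[OF cdf_lim_at_bot p(1)] .
  then obtain a where a: "cdf M a < p" by (auto simp: eventually_at_bot_linorder)
  let ?L = "{x. cdf M x = p}"
  have ab: "a \<le> b" using a b mono[of b a] by linarith
  have "\<exists>x. a \<le> x \<and> x \<le> b \<and> cdf M x = p"
    using a b ab cont by (intro IVT) auto
  then have ne: "?L \<noteq> {}" by auto
  have bdd: "bdd_above ?L"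
  proof (rule bdd_aboveI)
    fix x assume "x \<in> ?L"
    then show "x \<le> b" using b mono[of b x] by (cases "x \<le> b") auto
  qed
  have "closed ?L"
    using continuous_closed_preimage_constant[of UNIV "cdf M" p] cont
    by (auto simp: continuous_on_eq_continuous_at)
  from closed_contains_Sup[OF ne bdd this] have y: "cdf M (Sup ?L) = p" by simp
  have "{x. cdf M x \<le> p} = {..Sup ?L}"
  proof (intro set_eqI iffI)
    fix x assume x: "x \<in> {x. cdf M x \<le> p}"
    show "x \<in> {..Sup ?L}"
    proof (rule ccontr)
      assume "x \<notin> {..Sup ?L}"
      then have xs: "Sup ?L < x" by auto
      then have "cdf M x = p" using mono[of "Sup ?L" x] y x by auto
      then have "x \<le> Sup ?L" using bdd by (auto intro: cSup_upper)
      then show False using xs by simp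
    qed
  qed (use mono y in fastforce)
  with y show ?thesis by (rule that)
qed

lemma cdf_uniform:
  assumes "real_distribution M" "\<And>x. isCont (cdf M) x" "0 < p" "p < 1"
  shows "measure M {x. cdf M x \<le> p} = p"
  using cdf_at_most_level[OF assms] by (metis cdf_def2)

text \<open>Levels 0 and 1 have no Gaussian quantile. Each is reached with probability at most p for
  every small p, by comparison with \<open>cdf_uniform\<close>.\<close>

lemma AE_cdf_between:
  assumes M: "real_distribution M" and cont: "\<And>x. isCont (cdf M) x"
  shows "AE x in M. 0 < cdf M x \<and> cdf M x < 1"
proof -
  interpret real_distribution M by fact
  have [measurable]: "cdf M \<in> borel_measurable borel"
    using cont by (intro borel_measurable_continuous_onI) (simp add: continuous_on_eq_continuous_at)
  have 0: "prob {x. cdf M x \<le> 0} \<le> p" if "0 < p" "p < 1" for p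
  proof -
    have "prob {x. cdf M x \<le> 0} \<le> prob {x. cdf M x \<le> p}"
      using that by (intro finite_measure_mono) auto
    then show ?thesis using cdf_uniform[OF M cont that] by simp
  qed
  have "prob {x. cdf M x \<le> 0} \<le> 0"
  proof (rule field_le_epsilon)
    fix e :: real assume "0 < e"
    then show "prob {x. cdf M x \<le> 0} \<le> 0 + e"
      using 0[of "min e (1/2)"] by auto
  qed
  then have z: "prob {x. cdf M x \<le> 0} = 0" by (simp add: measure_le_0_iff)
  have 1: "prob {x. cdf M x < 1} \<ge> 1 - p" if "0 < p" "p < 1" for p
  proof -
    have "prob {x. cdf M x \<le> 1 - p} \<le> prob {x. cdf M x < 1}"
      using that by (intro finite_measure_mono) auto
    then show ?thesis using cdf_uniform[OF M cont, of "1 - p"] that by simp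
  qed
  have "1 \<le> prob {x. cdf M x < 1}"
  proof (rule field_le_epsilon)
    fix e :: real assume "0 < e"
    then have "1 - min e (1/2) \<le> prob {x. cdf M x < 1}" by (intro 1) auto
    moreover have "min e (1/2) \<le> e" by simp
    ultimately show "1 \<le> prob {x. cdf M x < 1} + e" by linarith
  qed
  then have "prob {x. cdf M x < 1} = 1" using prob_le_1 antisym by blast
  then have "AE x in M. cdf M x < 1" by (subst (asm) prob_eq_1) auto
  moreover have "AE x in M. \<not> cdf M x \<le> 0"
    using z by (subst (asm) prob_eq_0) auto
  ultimately show ?thesis by eventually_elim auto
qed

lemma isCont_cdf_density:
  assumes "prob_space (density lborel h)" and [measurable]: "h \<in> borel_measurable borel"
  shows "isCont (cdf (density lborel h)) x"
proof -
  interpret real_distribution "density lborel h"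
    using assms by (simp add: real_distribution_def real_distribution_axioms_def)
  have "emeasure (density lborel h) {x} = 0"
    by (simp add: emeasure_density nn_integral_null_set)
  then show ?thesis by (simp add: isCont_cdf measure_def)
qed

lemma isCont_cdf_std_normal: "isCont (cdf std_normal_distribution) x"
  using isCont_cdf_density[of std_normal_density x] std_normal.prob_space_axioms by simp

lemma std_normal_density_pos[simp]: "0 < std_normal_density x"
  by (rule normal_density_pos) simp

lemma std_normal_density_nonzero[simp]: "std_normal_density x \<noteq> 0"
  using std_normal_density_pos[of x] by linarith

lemma cdf_std_normal_strict_mono:
  assumes "x < y"
  shows "cdf std_normal_distribution x < cdf std_normal_distribution y"
proof -
  have "emeasure std_normal_distribution {x<..y} \<noteq> 0"
  proof
    assume "emeasure std_normal_distribution {x<..y} = 0"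
    then have "(\<integral>\<^sup>+z. ennreal (std_normal_density z) * indicator {x<..y} z \<partial>lborel) = 0"
      by (simp add: emeasure_density)
    then have "AE z in lborel. z \<notin> {x<..y}"
      by (subst (asm) nn_integral_0_iff_AE) (auto elim!: eventually_mono simp: indicator_def split: if_splits)
    then have "emeasure lborel {x<..y} = 0"
      by (subst (asm) AE_iff_measurable[of "{x<..y}"]) auto
    then show False using assms by simp
  qed
  with std_normal.cdf_diff_eq[OF assms] show ?thesis
    using measure_nonneg[of std_normal_distribution "{x<..y}"]
    by (simp add: std_normal.emeasure_eq_measure del: measure_nonneg)
qed

text \<open>The inverse of the Gaussian cdf. Composed with a continuous cdf, the default 0 outside
  the open unit interval is met only on a null set, by \<open>AE_cdf_between\<close>.\<close>

definition gauss_quantile :: "real \<Rightarrow> real" where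
  "gauss_quantile p = (if 0 < p \<and> p < 1 then SOME z. cdf std_normal_distribution z = p else 0)"

lemma cdf_gauss_quantile:
  assumes "0 < p" "p < 1"
  shows "cdf std_normal_distribution (gauss_quantile p) = p"
proof -
  obtain z where "cdf std_normal_distribution z = p"
    using cdf_at_most_level[OF real_distribution_std_normal isCont_cdf_std_normal assms] by metis
  then show ?thesis using assms unfolding gauss_quantile_def by (auto intro: someI)
qed

lemma gauss_quantile_le_iff:
  assumes "0 < p" "p < 1"
  shows "gauss_quantile p \<le> z \<longleftrightarrow> p \<le> cdf std_normal_distribution z"
proof -
  have "gauss_quantile p \<le> z \<longleftrightarrow> cdf std_normal_distribution (gauss_quantile p) \<le> cdf std_normal_distribution z"
    using cdf_std_normal_strict_mono by (metis linorder_not_less order_le_less)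
  then show ?thesis using cdf_gauss_quantile[OF assms] by simp
qed

lemma measurable_gauss_quantile[measurable]: "gauss_quantile \<in> borel_measurable borel"
proof (subst borel_measurable_iff_le, intro allI)
  fix a
  have "{w \<in> space borel. gauss_quantile w \<le> a} =
     ({0<..<1} \<inter> {..cdf std_normal_distribution a}) \<union> (if 0 \<le> a then - {0<..<1} else {})"
    using gauss_quantile_le_iff by (auto simp: gauss_quantile_def split: if_splits)
  then show "{w \<in> space borel. gauss_quantile w \<le> a} \<in> sets borel" by simp
qed

text \<open>The monotone rearrangement of \<open>M\<close> into the Gaussian: a uniform variable
  followed by the inverse Gaussian cdf. Continuity of \<open>cdf M\<close> is what makes the first
  variable uniform.\<close>

lemma distr_gauss_quantile_cdf:
  assumes M: "real_distribution M" and cont: "\<And>x. isCont (cdf M) x"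
  shows "distr M borel (\<lambda>x. gauss_quantile (cdf M x)) = std_normal_distribution"
proof -
  interpret real_distribution M by fact
  have [measurable]: "cdf M \<in> borel_measurable borel"
    using cont by (intro borel_measurable_continuous_onI) (simp add: continuous_on_eq_continuous_at)
  have [measurable]: "cdf M \<in> borel_measurable M" by simp
  have gm[measurable]: "(\<lambda>x. gauss_quantile (cdf M x)) \<in> borel_measurable M"
    by (rule measurable_compose[OF \<open>cdf M \<in> borel_measurable M\<close> measurable_gauss_quantile])
  show ?thesis
  proof (rule cdf_unique)
    show "real_distribution (distr M borel (\<lambda>x. gauss_quantile (cdf M x)))"
      using gm by (rule real_distribution_distr)
    show "cdf (distr M borel (\<lambda>x. gauss_quantile (cdf M x))) = cdf std_normal_distribution"
    proof
      fix z
      let ?p = "cdf std_normal_distribution z"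
      have p: "0 < ?p" "?p < 1"
        using cdf_std_normal_strict_mono[of "z - 1" z] std_normal.cdf_nonneg[of "z - 1"]
          cdf_std_normal_strict_mono[of z "z + 1"] std_normal.cdf_bounded_prob[of "z + 1"] by auto
      have "cdf (distr M borel (\<lambda>x. gauss_quantile (cdf M x))) z =
         prob {x. gauss_quantile (cdf M x) \<le> z}"
        by (subst cdf_def2, subst measure_distr[OF gm]) (auto simp: vimage_def)
      also have "\<dots> = prob {x. cdf M x \<le> ?p}"
      proof (rule finite_measure_eq_AE)
        show "AE x in M. x \<in> {x. gauss_quantile (cdf M x) \<le> z} \<longleftrightarrow> x \<in> {x. cdf M x \<le> ?p}"
          using AE_cdf_between[OF M cont] by eventually_elim (simp add: gauss_quantile_le_iff)
      qed auto
      also have "\<dots> = ?p" by (rule cdf_uniform[OF M cont p])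
      finally show "cdf (distr M borel (\<lambda>x. gauss_quantile (cdf M x))) z = ?p" .
    qed
  qed (rule real_distribution_std_normal)
qed

text \<open>The first identity integrates \<open>z phi(z) = - phi'(z)\<close> over a half-line. It
  turns truncated means of the transport map into values of the Gaussian density.\<close>

lemma std_normal_moments:
  "(\<integral>z. z * indicator {c<..} z \<partial>std_normal_distribution) = std_normal_density c"
  "integrable std_normal_distribution (\<lambda>z. z)"
  "integrable std_normal_distribution (\<lambda>z. z\<^sup>2)"
  "(\<integral>z. z \<partial>std_normal_distribution) = 0"
  "(\<integral>z. z\<^sup>2 \<partial>std_normal_distribution) = 1"
proof -
  show 1: "integrable std_normal_distribution (\<lambda>z. z)"
    using integrable_std_normal_moment[of 1] by (subst integrable_density) auto
  show "integrable std_normal_distribution (\<lambda>z. z\<^sup>2)"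
    using integrable_std_normal_moment[of 2] by (subst integrable_density) auto
  show "(\<integral>z. z \<partial>std_normal_distribution) = 0"
    using integral_std_normal_moment_odd[of 0] by (subst integral_density) auto
  show "(\<integral>z. z\<^sup>2 \<partial>std_normal_distribution) = 1"
    using integral_std_normal_moment_even[of 1] by (subst integral_density) auto
  have i: "integrable lborel (\<lambda>z. std_normal_density z * z)"
    using integrable_std_normal_moment[of 1] by simp
  have lim: "(std_normal_density \<longlongrightarrow> 0) at_top"
  proof -
    have "((\<lambda>x::real. exp (- x\<^sup>2 / 2)) \<longlongrightarrow> 0) at_top" by real_asymp
    from tendsto_mult_right_zero[OF this, of "1 / sqrt (2 * pi)"] show ?thesis
      unfolding std_normal_density_def .
  qed
  have d: "((\<lambda>x. - std_normal_density x) has_vector_derivative x * std_normal_density x) (at x)" for x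
  proof -
    have "((\<lambda>x. - (k * exp (- x\<^sup>2 / 2))) has_real_derivative x * (k * exp (- x\<^sup>2 / 2))) (at x)" for k :: real
      by (auto intro!: derivative_eq_intros)
    then show ?thesis
      unfolding has_real_derivative_iff_has_vector_derivative[symmetric] std_normal_density_def .
  qed
  have c: "isCont (\<lambda>x. x * std_normal_density x) x" for x
    unfolding std_normal_density_def by (auto intro!: continuous_intros)
  have si: "set_integrable lborel (einterval (ereal c) \<infinity>) (\<lambda>x. x * std_normal_density x)"
  proof (rule set_integrable_subset[OF _ _ subset_UNIV])
    show "set_integrable lborel UNIV (\<lambda>x. x * std_normal_density x)"
      using i by (simp add: set_integrable_def mult.commute)
  qed simp
  have "isCont (\<lambda>x. - std_normal_density x) c"
    unfolding std_normal_density_def by (auto intro!: continuous_intros)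
  then have l1: "((\<lambda>x. - std_normal_density x) \<longlongrightarrow> - std_normal_density c) (at_right c)"
    by (simp add: isCont_def filterlim_at_split)
  have l2: "((\<lambda>x. - std_normal_density x) \<longlongrightarrow> 0) at_top"
    using tendsto_minus[OF lim] by simp
  have "interval_lebesgue_integral lborel (ereal c) \<infinity> (\<lambda>x. x * std_normal_density x) = 0 - (- std_normal_density c)"
    using d c si
    by (intro interval_integral_FTC_integrable[where F = "\<lambda>x. - std_normal_density x"])
      (simp_all add: ereal_tendsto_simps l1 l2)
  then have "(LINT z|lborel. std_normal_density z * (z * indicator {c<..} z)) = std_normal_density c"
    by (simp add: interval_integral_to_infinity_eq set_lebesgue_integral_def mult_ac)
  then show "(\<integral>z. z * indicator {c<..} z \<partial>std_normal_distribution) = std_normal_density c"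
    by (subst integral_density) auto
qed

lemma AE_density_pos:
  assumes "g \<in> borel_measurable M"
  shows "AE x in density M (\<lambda>x. ennreal (g x)). 0 < g x"
  using assms by (subst AE_density) (auto simp: ennreal_neg ennreal_eq_0_iff not_le)

text \<open>With \<open>S\<close> the monotone rearrangement and \<open>q = phi (S y) / (g y * phi y)\<close> one has
  \<open>ln (g y) = y^2/2 - (S y)^2/2 - ln q\<close> pointwise and \<open>- ln q \<ge> 1 - q\<close>. The mean of \<open>q\<close> is at most
  the Lebesgue integral of \<open>phi (S y)\<close>, which is the mean of \<open>y * S y\<close> because
  \<open>phi (S y)\<close> is the mean of \<open>S\<close> on \<open>{y<..}\<close>. No regularity of \<open>g\<close> is needed.\<close>

lemma gaussian_transport_1d:
  fixes g :: "real \<Rightarrow> real"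
  defines "M \<equiv> density std_normal_distribution g"
  defines "S \<equiv> \<lambda>y. gauss_quantile (cdf M y)"
  assumes g[measurable]: "g \<in> borel_measurable borel" and nonneg: "\<And>y. 0 \<le> g y"
    and one: "(\<integral>\<^sup>+y. g y \<partial>std_normal_distribution) = 1"
    and ent: "integrable std_normal_distribution (\<lambda>y. g y * ln (g y))"
    and mom: "integrable std_normal_distribution (\<lambda>y. g y * y\<^sup>2)"
  shows "distr M borel S = std_normal_distribution"
    and "integrable M (\<lambda>y. (y - S y)\<^sup>2)"
    and "(\<integral>y. (y - S y)\<^sup>2 \<partial>M) \<le> 2 * (\<integral>y. g y * ln (g y) \<partial>std_normal_distribution)"
proof -
  let ?phi = "std_normal_density"
  let ?N = "std_normal_distribution"
  have M_lborel: "M = density lborel (\<lambda>y. ennreal (?phi y * g y))"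
    unfolding M_def by (subst density_density_eq) (auto simp: ennreal_mult nonneg)
  have "emeasure M (space M) = (\<integral>\<^sup>+y. g y \<partial>?N)"
    unfolding M_def by (subst emeasure_density) (auto intro!: nn_integral_cong)
  then have prob: "prob_space M" using one by (intro prob_spaceI) simp
  have rd: "real_distribution M"
    using prob by (simp add: real_distribution_def real_distribution_axioms_def M_def)
  interpret real_distribution M by fact
  have sets_M[measurable_cong]: "sets M = sets borel" by (simp add: M_def)
  have cont: "isCont (cdf M) x" for x
    unfolding M_lborel by (rule isCont_cdf_density) (use prob M_lborel in auto)
  have [measurable]: "cdf M \<in> borel_measurable borel"
    using cont by (intro borel_measurable_continuous_onI) (simp add: continuous_on_eq_continuous_at)
  have S_meas[measurable]: "S \<in> borel_measurable borel"
    unfolding S_def by (rule measurable_compose[OF _ measurable_gauss_quantile]) fact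
  show law: "distr M borel S = ?N"
    unfolding S_def by (rule distr_gauss_quantile_cdf[OF rd cont])
  have AE01: "AE y in M. 0 < cdf M y \<and> cdf M y < 1" by (rule AE_cdf_between[OF rd cont])
  have int_S: "integrable M S" "(\<integral>y. S y \<partial>M) = 0"
    using std_normal_moments(2,4) unfolding law[symmetric]
    by (simp_all add: integrable_distr_eq integral_distr)
  have int_S2: "integrable M (\<lambda>y. (S y)\<^sup>2)" "(\<integral>y. (S y)\<^sup>2 \<partial>M) = 1"
    using std_normal_moments(3,5) unfolding law[symmetric]
    by (simp_all add: integrable_distr_eq integral_distr)
  have int_Y2: "integrable M (\<lambda>y. y\<^sup>2)"
    unfolding M_def using mom by (subst integrable_density) (auto simp: nonneg)
  have int_ln: "integrable M (\<lambda>y. ln (g y))"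
    unfolding M_def using ent by (subst integrable_density) (auto simp: nonneg)
  have int_YS: "integrable M (\<lambda>y. S y * y)"
  proof (rule Bochner_Integration.integrable_bound)
    show "integrable M (\<lambda>y. (S y)\<^sup>2 + y\<^sup>2)" using int_S2 int_Y2 by simp
    show "AE y in M. norm (S y * y) \<le> norm ((S y)\<^sup>2 + y\<^sup>2)"
    proof (intro AE_I2)
      fix y
      have "0 \<le> (\<bar>S y\<bar> - \<bar>y\<bar>)\<^sup>2" by simp
      then have "2 * (\<bar>S y\<bar> * \<bar>y\<bar>) \<le> (S y)\<^sup>2 + y\<^sup>2"
        by (simp add: power2_eq_square algebra_simps)
      moreover have "0 \<le> \<bar>S y\<bar> * \<bar>y\<bar>" by simp
      ultimately have "\<bar>S y\<bar> * \<bar>y\<bar> \<le> (S y)\<^sup>2 + y\<^sup>2" by linarith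
      then show "norm (S y * y) \<le> norm ((S y)\<^sup>2 + y\<^sup>2)"
        by (simp add: abs_mult)
    qed
  qed measurable
  \<comment> \<open>The truncated mean of \<open>S\<close> is defined for every y, so that Fubini
    applies to it; it is identified with \<open>?phi (S y)\<close> where the level lies strictly
    between 0 and 1.\<close>
  define e where "e y = (\<integral>y'. S y' * indicator {y<..} y' \<partial>M)" for y
  have e_mid: "e y = ?phi (S y)" if y: "0 < cdf M y" "cdf M y < 1" for y
  proof -
    let ?A = "{y'. cdf M y' \<le> cdf M y}"
    have sub: "{..y} \<subseteq> ?A" by (auto intro: cdf_nondecreasing)
    \<comment> \<open>Points beyond y at the same level are mapped to \<open>S y\<close> as well,
      hence are missed by \<open>{S y<..}\<close>. They form a null set because \<open>cdf M\<close>
      is uniform.\<close>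
    have "prob (?A - {..y}) = prob ?A - prob {..y}"
      using sub by (intro finite_measure_Diff) auto
    also have "\<dots> = 0" using cdf_uniform[OF rd cont y] by (simp add: cdf_def2)
    finally have "AE y' in M. y' \<notin> ?A - {..y}" by (subst (asm) prob_eq_0) auto
    with AE01 have "AE y' in M. indicator {y<..} y' = (indicator {S y<..} (S y') :: real)"
    proof eventually_elim
      case (elim y')
      have "S y' \<le> S y \<longleftrightarrow> cdf M y' \<le> cdf M y"
        unfolding S_def using elim y by (subst gauss_quantile_le_iff) (auto simp: cdf_gauss_quantile)
      moreover have "y' \<le> y \<Longrightarrow> cdf M y' \<le> cdf M y" by (rule cdf_nondecreasing)
      ultimately show ?case using elim by (auto simp: indicator_def not_le[symmetric])
    qed
    then have "e y = (\<integral>y'. S y' * indicator {S y<..} (S y') \<partial>M)"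
      unfolding e_def by (intro integral_cong_AE) auto
    also have "\<dots> = (\<integral>z. z * indicator {S y<..} z \<partial>distr M borel S)"
      by (subst integral_distr) auto
    also have "\<dots> = ?phi (S y)" unfolding law by (rule std_normal_moments(1))
    finally show ?thesis .
  qed
  have e_nonneg: "0 \<le> e y" for y
  proof -
    consider "0 < cdf M y \<and> cdf M y < 1" | "cdf M y = 0" | "cdf M y = 1"
      using cdf_nonneg[of y] cdf_bounded_prob[of y] by fastforce
    then show ?thesis
    proof cases
      case 1 then show ?thesis using e_mid[of y] by (simp add: less_imp_le)
    next
      case 2
      then have "AE y' in M. y' \<notin> {..y}" by (subst prob_eq_0[symmetric]) (auto simp: cdf_def2)
      then have "e y = (\<integral>y'. S y' \<partial>M)"
        unfolding e_def by (intro integral_cong_AE) (auto elim!: eventually_mono simp: indicator_def)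
      then show ?thesis using int_S by simp
    next
      case 3
      then have "AE y' in M. y' \<in> {..y}" by (subst prob_eq_1[symmetric]) (auto simp: cdf_def2)
      then have "e y = (\<integral>y'. 0 \<partial>M)"
        unfolding e_def by (intro integral_cong_AE) (auto elim!: eventually_mono simp: indicator_def)
      then show ?thesis by simp
    qed
  qed
  interpret MP: pair_sigma_finite M lborel ..
  \<comment> \<open>A signed layer-cake formula: the difference of indicators integrates over y to
    the point y'. The second indicator makes \<open>h\<close> integrable, and it drops out of the
    integral over \<open>M\<close> because \<open>S\<close> has mean 0.\<close>
  define h where "h = (\<lambda>(y', y). S y' * (indicator {y<..} y' - indicator {..<0::real} y))"
  have hm[measurable]: "h \<in> borel_measurable (M \<Otimes>\<^sub>M lborel)"
  proof -
    have "h = (\<lambda>p. S (fst p) * ((if snd p < fst p then 1 else 0) - (if snd p < 0 then 1 else 0)))"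
      by (auto simp: h_def fun_eq_iff indicator_def)
    then show ?thesis by simp
  qed
  have h_slice: "has_bochner_integral lborel (\<lambda>y. h (y', y)) (S y' * y')"
      "has_bochner_integral lborel (\<lambda>y. norm (h (y', y))) \<bar>S y' * y'\<bar>" for y'
  proof -
    have *: "indicator {y<..} y' - indicator {..<0::real} y
        = (if 0 \<le> y' then indicator {0..<y'} y else - indicator {y'..<0} y :: real)" for y
      by (auto simp: indicator_def)
    have i: "has_bochner_integral lborel (indicator {a..<b}) (b - a :: real)" if "a \<le> b" for a b :: real
      using has_bochner_integral_real_indicator[of "{a..<b}" lborel] that by simp
    show "has_bochner_integral lborel (\<lambda>y. h (y', y)) (S y' * y')"
      unfolding h_def prod.case *
      using i[of 0 y'] has_bochner_integral_minus[OF i[of y' 0]]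
      by (intro has_bochner_integral_mult_right) (cases "0 \<le> y'"; simp)
    have "has_bochner_integral lborel (\<lambda>y. \<bar>S y'\<bar> * (if 0 \<le> y' then indicator {0..<y'} y else indicator {y'..<0} y :: real)) (\<bar>S y'\<bar> * \<bar>y'\<bar>)"
      using i[of 0 y'] i[of y' 0] by (intro has_bochner_integral_mult_right) (cases "0 \<le> y'"; simp)
    also have "(\<lambda>y. \<bar>S y'\<bar> * (if 0 \<le> y' then indicator {0..<y'} y else indicator {y'..<0} y :: real)) = (\<lambda>y. norm (h (y', y)))"
      unfolding h_def prod.case * by (auto simp: abs_mult)
    finally show "has_bochner_integral lborel (\<lambda>y. norm (h (y', y))) \<bar>S y' * y'\<bar>"
      by (simp add: abs_mult)
  qed
  have int_h: "integrable (M \<Otimes>\<^sub>M lborel) h"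
  proof (rule MP.Fubini_integrable[OF hm])
    show "integrable M (\<lambda>x. \<integral>y. norm (h (x, y)) \<partial>lborel)"
      using h_slice(2) int_YS by (simp add: has_bochner_integral_iff)
    show "AE x in M. integrable lborel (\<lambda>y. h (x, y))"
      using h_slice(1) by (simp add: has_bochner_integral_iff)
  qed
  have e_h: "(\<integral>y'. h (y', y) \<partial>M) = e y" for y
  proof -
    have "integrable M (\<lambda>y'. S y' * indicator {y<..} y')"
      using integrable_mult_indicator[OF _ int_S(1), of "{y<..}"] by (simp add: mult.commute)
    then show ?thesis using int_S unfolding h_def e_def by (simp add: right_diff_distrib)
  qed
  have int_e: "integrable lborel e" "(\<integral>y. e y \<partial>lborel) = (\<integral>y. S y * y \<partial>M)"
    using MP.integrable_snd[of "\<lambda>a b. h (a, b)"] MP.integral_fst[of "\<lambda>a b. h (a, b)"] MP.integral_snd[of "\<lambda>a b. h (a, b)"]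
      int_h h_slice(1) by (simp_all add: e_h has_bochner_integral_iff)
  let ?mid = "{y. 0 < cdf M y \<and> cdf M y < 1}"
  define q where "q y = indicator ?mid y * (?phi (S y) / (g y * ?phi y))" for y
  have q_meas[measurable]: "q \<in> borel_measurable borel" unfolding q_def by measurable
  have q_nonneg: "0 \<le> q y" for y unfolding q_def by (simp add: nonneg)
  \<comment> \<open>Only an inequality: where \<open>g\<close> vanishes the left side is 0, while
    \<open>e\<close> may be positive.\<close>
  have q_le: "(?phi y * g y) * q y \<le> e y" for y
    using e_mid[of y] e_nonneg[of y] by (auto simp: q_def indicator_def less_imp_le)
  have int_q': "integrable lborel (\<lambda>y. (?phi y * g y) * q y)"
    using q_le e_nonneg q_nonneg nonneg
    by (intro Bochner_Integration.integrable_bound[OF int_e(1)]) (auto simp: less_imp_le)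
  then have int_q: "integrable M q" unfolding M_lborel
    by (subst integrable_density) (auto simp: nonneg less_imp_le)
  have "(\<integral>y. q y \<partial>M) = (\<integral>y. (?phi y * g y) * q y \<partial>lborel)"
    unfolding M_lborel by (subst integral_density) (auto simp: nonneg less_imp_le)
  also have "\<dots> \<le> (\<integral>y. e y \<partial>lborel)"
    by (intro integral_mono int_q' int_e q_le)
  finally have q_bound: "(\<integral>y. q y \<partial>M) \<le> (\<integral>y. S y * y \<partial>M)" using int_e(2) by simp
  have ln_phi: "ln (?phi z) = ln (1 / sqrt (2 * pi)) - z\<^sup>2 / 2" for z
    unfolding std_normal_density_def by (subst ln_mult_pos) auto
  have "AE y in M. 0 < g y" unfolding M_def by (rule AE_density_pos) simp
  with AE01 have "AE y in M. y\<^sup>2 / 2 - (S y)\<^sup>2 / 2 + 1 - q y \<le> ln (g y)"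
  proof eventually_elim
    case (elim y)
    have q: "q y = ?phi (S y) / (g y * ?phi y)" using elim by (simp add: q_def)
    have "ln (q y) \<le> q y - 1" using elim by (intro ln_le_minus_one) (simp add: q)
    moreover have "ln (q y) = ln (?phi (S y)) - (ln (g y) + ln (?phi y))"
      unfolding q using elim by (simp add: ln_div ln_mult_pos)
    ultimately show ?case by (simp add: ln_phi)
  qed
  then have "(\<integral>y. y\<^sup>2 / 2 - (S y)\<^sup>2 / 2 + 1 - q y \<partial>M) \<le> (\<integral>y. ln (g y) \<partial>M)"
    using int_Y2 int_S2 int_q int_ln by (intro integral_mono_AE) auto
  then have "(\<integral>y. y\<^sup>2 \<partial>M) / 2 + 1 / 2 - (\<integral>y. S y * y \<partial>M) \<le> (\<integral>y. ln (g y) \<partial>M)"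
    using int_Y2 int_S2 int_q q_bound prob_space by simp
  moreover have "(\<integral>y. ln (g y) \<partial>M) = (\<integral>y. g y * ln (g y) \<partial>?N)"
    unfolding M_def by (subst integral_density) (auto simp: nonneg)
  moreover have sq: "(y - S y)\<^sup>2 = y\<^sup>2 + (S y)\<^sup>2 - 2 * (S y * y)" for y
    by (simp add: power2_eq_square algebra_simps)
  moreover show "integrable M (\<lambda>y. (y - S y)\<^sup>2)" unfolding sq using int_Y2 int_S2 int_YS by auto
  moreover have "(\<integral>y. (y - S y)\<^sup>2 \<partial>M) = (\<integral>y. y\<^sup>2 \<partial>M) + 1 - 2 * (\<integral>y. S y * y \<partial>M)"
    unfolding sq using int_Y2 int_S2 int_YS by simp
  ultimately show "(\<integral>y. (y - S y)\<^sup>2 \<partial>M) \<le> 2 * (\<integral>y. g y * ln (g y) \<partial>?N)"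
    by simp
qed

section \<open>Conditional densities and the entropy chain rule\<close>

text \<open>\<open>enn2real\<close> sends an infinite slice to 0; by \<open>AE_m\<close> such slices
  are negligible.\<close>

definition marginal_density :: "'b measure \<Rightarrow> ('a \<times> 'b \<Rightarrow> real) \<Rightarrow> 'a \<Rightarrow> real" where
  "marginal_density G f x = enn2real (\<integral>\<^sup>+y. f (x, y) \<partial>G)"

text \<open>The value \<open>1\<close> where the marginal density vanishes keeps every slice normalised.\<close>

definition cond_density :: "'b measure \<Rightarrow> ('a \<times> 'b \<Rightarrow> real) \<Rightarrow> 'a \<times> 'b \<Rightarrow> real" where
  "cond_density G f p =
     (if 0 < marginal_density G f (fst p) then f p / marginal_density G f (fst p) else 1)"

locale pair_density = M: prob_space M + G: prob_space G for M :: "'a measure" and G :: "'b measure" +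
  fixes f :: "'a \<times> 'b \<Rightarrow> real"
  assumes f_meas[measurable]: "f \<in> borel_measurable (M \<Otimes>\<^sub>M G)"
    and f_nonneg: "\<And>p. 0 \<le> f p"
    and f_one: "(\<integral>\<^sup>+p. f p \<partial>(M \<Otimes>\<^sub>M G)) = 1"
begin

abbreviation "m \<equiv> marginal_density G f"
abbreviation "k \<equiv> cond_density G f"
abbreviation "M' \<equiv> density M (\<lambda>x. ennreal (m x))"
abbreviation "MG \<equiv> M \<Otimes>\<^sub>M G"
abbreviation "M'G \<equiv> density M (\<lambda>x. ennreal (marginal_density G f x)) \<Otimes>\<^sub>M G"
abbreviation "P \<equiv> density MG (\<lambda>p. ennreal (f p))"

sublocale MG: pair_prob_space M G ..

lemma m_meas[measurable]: "m \<in> borel_measurable M"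
  unfolding marginal_density_def by measurable

lemma k_meas[measurable]: "k \<in> borel_measurable MG"
  unfolding cond_density_def by measurable

lemma m_nonneg: "0 \<le> m x" by (simp add: marginal_density_def)

lemma k_nonneg: "0 \<le> k p" by (simp add: cond_density_def f_nonneg)

lemma f_one': "(\<integral>\<^sup>+x. \<integral>\<^sup>+y. f (x, y) \<partial>G \<partial>M) = 1"
  using f_one by (subst (asm) G.nn_integral_fst[symmetric]) auto

lemma AE_m: "AE x in M. (\<integral>\<^sup>+y. f (x, y) \<partial>G) = ennreal (m x)"
proof -
  have "(\<integral>\<^sup>+x. \<integral>\<^sup>+y. f (x, y) \<partial>G \<partial>M) \<noteq> \<infinity>"
    using f_one' by simp
  then have "AE x in M. (\<integral>\<^sup>+y. f (x, y) \<partial>G) \<noteq> \<infinity>"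
    by (intro nn_integral_PInf_AE) auto
  then show ?thesis unfolding marginal_density_def
    by eventually_elim (simp add: less_top)
qed

lemma AE_k_one: "AE x in M. (\<integral>\<^sup>+y. k (x, y) \<partial>G) = 1"
  using AE_m AE_space
proof eventually_elim
  case (elim x)
  note [measurable] = measurable_compose[OF measurable_Pair1'[OF elim(2)] f_meas]
  show ?case
  proof (cases "0 < m x")
    case True
    then have "(\<integral>\<^sup>+y. k (x, y) \<partial>G) = (\<integral>\<^sup>+y. f (x, y) / ennreal (m x) \<partial>G)"
      by (intro nn_integral_cong) (simp add: cond_density_def divide_ennreal f_nonneg)
    also have "\<dots> = (\<integral>\<^sup>+y. f (x, y) \<partial>G) / m x" by (rule nn_integral_divide) measurable
    also have "\<dots> = 1" using elim True by (simp add: ennreal_divide_self)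
    finally show ?thesis .
  next
    case False
    then show ?thesis by (simp add: cond_density_def G.emeasure_space_1)
  qed
qed

text \<open>Where the marginal density is 0, almost all of the slice of \<open>f\<close> is 0 too,
  so the value 1 given to \<open>k\<close> there does no harm.\<close>

lemma factor: "AE p in MG. f p = m (fst p) * k p"
proof (rule MG.AE_pair_measure)
  show "AE x in M. AE y in G. f (x, y) = m (fst (x, y)) * k (x, y)"
    using AE_m AE_space
  proof eventually_elim
    case (elim x)
    note [measurable] = measurable_compose[OF measurable_Pair1'[OF elim(2)] f_meas]
    show ?case
    proof (cases "0 < m x")
      case False
      then have "m x = 0" using m_nonneg[of x] by simp
      then have "AE y in G. ennreal (f (x, y)) = 0"
        using elim by (subst nn_integral_0_iff_AE[symmetric]) auto
      then show ?thesis
      proof (rule eventually_mono)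
        fix y assume "ennreal (f (x, y)) = 0"
        then show "f (x, y) = m (fst (x, y)) * k (x, y)"
          using f_nonneg[of "(x, y)"] \<open>m x = 0\<close> by (simp add: ennreal_eq_0_iff)
      qed
    qed (simp add: cond_density_def)
  qed
qed measurable

lemma prob_M': "prob_space M'"
proof (rule prob_spaceI)
  have "emeasure M' (space M') = (\<integral>\<^sup>+x. m x \<partial>M)"
    by (subst emeasure_density) (auto intro!: nn_integral_cong)
  also have "\<dots> = (\<integral>\<^sup>+x. \<integral>\<^sup>+y. f (x, y) \<partial>G \<partial>M)"
    using AE_m by (intro nn_integral_cong_AE) auto
  also have "\<dots> = 1" by (rule f_one')
  finally show "emeasure M' (space M') = 1" .
qed

sublocale M': prob_space M' by (rule prob_M')
sublocale M'G: pair_prob_space M' G ..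

text \<open>Disintegration: the joint law has density \<open>k\<close> over the product of its first
  marginal with \<open>G\<close>, so statements about the conditional law become statements about
  densities on a product.\<close>

lemma P_eq: "density M'G (\<lambda>p. ennreal (k p)) = P"
proof -
  have "M'G = M' \<Otimes>\<^sub>M density G (\<lambda>_. 1)" by (simp add: density_1)
  also have "\<dots> = density MG (\<lambda>(x, y). ennreal (m x) * 1)"
    by (rule pair_measure_density) (auto simp: density_1 G.sigma_finite_measure_axioms)
  finally have "density M'G (\<lambda>p. ennreal (k p)) =
      density MG (\<lambda>p. ennreal (m (fst p)) * ennreal (k p))"
    by (simp add: density_density_eq case_prod_beta)
  also have "\<dots> = P"
    using factor by (intro density_cong) (auto elim!: eventually_mono simp: ennreal_mult[symmetric] m_nonneg k_nonneg)
  finally show ?thesis .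
qed

lemma prob_P: "prob_space P"
proof (rule prob_spaceI)
  have "emeasure P (space P) = (\<integral>\<^sup>+p. f p \<partial>MG)"
    by (subst emeasure_density) (auto intro!: nn_integral_cong)
  then show "emeasure P (space P) = 1" by (simp add: f_one)
qed

sublocale P: prob_space P by (rule prob_P)

lemma AE_k_one': "AE x in M'. (\<integral>\<^sup>+y. k (x, y) \<partial>G) = 1"
  using AE_k_one by (subst AE_density) auto

lemma distr_fst: "distr P M fst = M'"
proof (rule measure_eqI)
  fix A assume "A \<in> sets (distr P M fst)"
  then have A[measurable]: "A \<in> sets M" by simp
  have "emeasure (distr P M fst) A = (\<integral>\<^sup>+p. f p * indicator A (fst p) \<partial>MG)"
    by (subst emeasure_distr, simp, simp, subst emeasure_density)
      (auto intro!: nn_integral_cong simp: indicator_def space_pair_measure)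
  also have "\<dots> = (\<integral>\<^sup>+x. \<integral>\<^sup>+y. f (x, y) * indicator A x \<partial>G \<partial>M)"
    by (subst G.nn_integral_fst[symmetric]) auto
  also have "\<dots> = (\<integral>\<^sup>+x. (\<integral>\<^sup>+y. f (x, y) \<partial>G) * indicator A x \<partial>M)"
    by (intro nn_integral_cong, subst nn_integral_multc[symmetric])
      (auto simp: indicator_def intro!: nn_integral_cong measurable_compose[OF measurable_Pair1' f_meas])
  also have "\<dots> = (\<integral>\<^sup>+x. ennreal (m x) * indicator A x \<partial>M)"
    using AE_m by (intro nn_integral_cong_AE) (auto elim!: eventually_mono simp: indicator_def)
  finally show "emeasure (distr P M fst) A = emeasure M' A" by (simp add: emeasure_density)
qed simp

lemma AE_P_pos: "AE p in P. 0 < f p \<and> 0 < m (fst p) \<and> 0 < k p \<and> f p = m (fst p) * k p"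
proof -
  have "AE p in P. 0 < f p" by (rule AE_density_pos) simp
  moreover have "AE p in P. f p = m (fst p) * k p"
    using factor by (subst AE_density) auto
  ultimately show ?thesis
    by eventually_elim (smt (verit, best) k_nonneg m_nonneg mult_eq_0_iff)
qed

lemma integrable_P_iff:
  "g \<in> borel_measurable MG \<Longrightarrow> integrable P g \<longleftrightarrow> integrable MG (\<lambda>p. f p *\<^sub>R (g p :: 'c :: {banach, second_countable_topology}))"
  by (subst integrable_density) (auto simp: f_nonneg)

lemma integral_P_k:
  fixes g :: "'a \<times> 'b \<Rightarrow> 'c :: {banach, second_countable_topology}"
  assumes [measurable]: "integrable P g"
  shows "integrable M'G (\<lambda>p. k p *\<^sub>R g p)"
    and "(\<integral>p. g p \<partial>P) = (\<integral>x. (\<integral>y. k (x, y) *\<^sub>R g (x, y) \<partial>G) \<partial>M')"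
    and "AE x in M'. integrable G (\<lambda>y. k (x, y) *\<^sub>R g (x, y))"
proof -
  have gm[measurable]: "g \<in> borel_measurable MG" using borel_measurable_integrable[OF assms] by simp
  have *: "sets M'G = sets MG" by (intro sets_pair_measure_cong) auto
  have gm'[measurable]: "g \<in> borel_measurable M'G" "k \<in> borel_measurable M'G"
    using gm k_meas by (simp_all cong: measurable_cong_sets[OF * refl])
  show 1: "integrable M'G (\<lambda>p. k p *\<^sub>R g p)"
    using assms unfolding P_eq[symmetric] by (subst (asm) integrable_density) (auto simp: k_nonneg)
  show "AE x in M'. integrable G (\<lambda>y. k (x, y) *\<^sub>R g (x, y))"
    by (rule M'G.AE_integrable_fst'[OF 1])
  have "(\<integral>p. g p \<partial>P) = (\<integral>p. k p *\<^sub>R g p \<partial>M'G)"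
    unfolding P_eq[symmetric] by (subst integral_density) (auto simp: k_nonneg)
  also have "\<dots> = (\<integral>x. (\<integral>y. k (x, y) *\<^sub>R g (x, y) \<partial>G) \<partial>M')"
    by (rule M'G.integral_fst'[OF 1, symmetric])
  finally show "(\<integral>p. g p \<partial>P) = (\<integral>x. (\<integral>y. k (x, y) *\<^sub>R g (x, y) \<partial>G) \<partial>M')" .
qed

lemma integrable_P_fst:
  fixes g :: "'a \<Rightarrow> 'c :: {banach, second_countable_topology}"
  assumes [measurable]: "g \<in> borel_measurable M"
  shows "integrable P (\<lambda>p. g (fst p)) \<longleftrightarrow> integrable M' g"
    and "(\<integral>p. g (fst p) \<partial>P) = (\<integral>x. g x \<partial>M')"
  unfolding distr_fst[symmetric] by (simp_all add: integrable_distr_eq integral_distr)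

text \<open>The identity is the mean of \<open>ln f = ln m + ln k\<close>; the difficulty is that
  \<open>ln m\<close> must be integrable on its own. The ratios \<open>m / f\<close> and
  \<open>1 / m\<close> have mean at most 1 under \<open>P\<close>, and
  \<open>ln t \<le> t - 1\<close> applied to them bounds \<open>ln m\<close> from above and from
  below.\<close>

lemma entropy_chain_rule:
  assumes ent: "integrable MG (\<lambda>p. f p * ln (f p))"
  shows "integrable M (\<lambda>x. m x * ln (m x))"
    and "integrable M'G (\<lambda>p. k p * ln (k p))"
    and "integrable P (\<lambda>p. ln (k p))"
    and "(\<integral>p. k p * ln (k p) \<partial>M'G) = (\<integral>p. ln (k p) \<partial>P)"
    and "(\<integral>p. f p * ln (f p) \<partial>MG) =
      (\<integral>x. m x * ln (m x) \<partial>M) + (\<integral>p. ln (k p) \<partial>P)"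
proof -
  have lnf: "integrable P (\<lambda>p. ln (f p))" using ent by (subst integrable_P_iff) auto
  have a: "integrable P (\<lambda>p. m (fst p) / f p)"
  proof (rule integrableI_nonneg)
    have "(\<integral>\<^sup>+p. ennreal (m (fst p) / f p) \<partial>P) =
        (\<integral>\<^sup>+p. ennreal (f p) * ennreal (m (fst p) / f p) \<partial>MG)"
      by (subst nn_integral_density) auto
    also have "\<dots> \<le> (\<integral>\<^sup>+p. ennreal (m (fst p)) \<partial>MG)"
      by (intro nn_integral_mono) (simp add: ennreal_mult[symmetric] f_nonneg m_nonneg)
    also have "\<dots> = (\<integral>\<^sup>+x. ennreal (m x) \<partial>M)"
      by (subst G.nn_integral_fst[symmetric]) (auto simp: G.emeasure_space_1)
    also have "\<dots> = emeasure M' (space M')"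
      by (subst emeasure_density) (auto intro!: nn_integral_cong)
    also have "\<dots> < \<infinity>" using M'.emeasure_space_1 by (metis ennreal_one_less_top infinity_ennreal_def)
    finally show "(\<integral>\<^sup>+p. ennreal (m (fst p) / f p) \<partial>P) < \<infinity>" .
  qed (auto simp: f_nonneg m_nonneg)
  have b: "integrable P (\<lambda>p. 1 / m (fst p))"
  proof (rule integrableI_nonneg)
    have "(\<integral>\<^sup>+p. ennreal (1 / m (fst p)) \<partial>P) =
        (\<integral>\<^sup>+p. ennreal (f p) * ennreal (1 / m (fst p)) \<partial>MG)"
      by (subst nn_integral_density) auto
    also have "\<dots> \<le> (\<integral>\<^sup>+p. ennreal (k p) \<partial>MG)"
    proof (intro nn_integral_mono)
      fix p show "ennreal (f p) * ennreal (1 / m (fst p)) \<le> ennreal (k p)"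
        using f_nonneg[of p] m_nonneg[of "fst p"]
        by (cases "0 < m (fst p)") (auto simp: ennreal_mult[symmetric] cond_density_def)
    qed
    also have "\<dots> = (\<integral>\<^sup>+x. \<integral>\<^sup>+y. ennreal (k (x, y)) \<partial>G \<partial>M)"
      by (subst G.nn_integral_fst[symmetric]) auto
    also have "\<dots> = (\<integral>\<^sup>+x. 1 \<partial>M)" using AE_k_one by (rule nn_integral_cong_AE)
    also have "\<dots> < \<infinity>" by (simp add: M.emeasure_space_1)
    finally show "(\<integral>\<^sup>+p. ennreal (1 / m (fst p)) \<partial>P) < \<infinity>" .
  qed (auto simp: m_nonneg)
  have lnm: "integrable P (\<lambda>p. ln (m (fst p)))"
  proof (rule Bochner_Integration.integrable_bound)
    show "integrable P (\<lambda>p. \<bar>ln (f p)\<bar> + m (fst p) / f p + 1 / m (fst p))"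
      using a b lnf by auto
    show "AE p in P. norm (ln (m (fst p))) \<le> norm (\<bar>ln (f p)\<bar> + m (fst p) / f p + 1 / m (fst p))"
      using AE_P_pos
    proof eventually_elim
      case (elim p)
      have "ln (m (fst p) / f p) \<le> m (fst p) / f p - 1"
        using elim by (intro ln_le_minus_one) auto
      moreover have "ln (1 / m (fst p)) \<le> 1 / m (fst p) - 1"
        using elim by (intro ln_le_minus_one) auto
      moreover have "ln (m (fst p) / f p) = ln (m (fst p)) - ln (f p)"
        using elim by (blast intro: ln_divide_pos)
      moreover have "ln (1 / m (fst p)) = - ln (m (fst p))"
        using elim by (simp add: ln_div)
      moreover have "0 \<le> m (fst p) / f p" "0 \<le> 1 / m (fst p)" using elim by auto
      ultimately have "\<bar>ln (m (fst p))\<bar> \<le> \<bar>ln (f p)\<bar> + m (fst p) / f p + 1 / m (fst p)" by linarith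
      then show ?case by (metis abs_ge_self order_trans real_norm_def)
    qed
  qed measurable
  have "integrable P (\<lambda>p. ln (f p) - ln (m (fst p)))" using lnf lnm by auto
  moreover have eq: "AE p in P. ln (f p) - ln (m (fst p)) = ln (k p)"
    using AE_P_pos by eventually_elim (metis add_diff_cancel_left' ln_mult_pos)
  ultimately show lnk: "integrable P (\<lambda>p. ln (k p))"
    by (subst (asm) integrable_cong_AE) auto
  have *: "sets M'G = sets MG" by (intro sets_pair_measure_cong) auto
  have k'[measurable]: "k \<in> borel_measurable M'G"
    using k_meas by (simp cong: measurable_cong_sets[OF * refl])
  show "integrable M'G (\<lambda>p. k p * ln (k p))"
    using lnk unfolding P_eq[symmetric] by (subst (asm) integrable_density) (auto simp: k_nonneg)
  show "(\<integral>p. k p * ln (k p) \<partial>M'G) = (\<integral>p. ln (k p) \<partial>P)"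
    unfolding P_eq[symmetric] by (subst integral_density) (auto simp: k_nonneg)
  have lnm': "integrable M' (\<lambda>x. ln (m x))"
    using lnm integrable_P_fst(1)[of "\<lambda>x. ln (m x)"] by simp
  then show "integrable M (\<lambda>x. m x * ln (m x))"
    by (subst (asm) integrable_density) (auto simp: m_nonneg)
  have "(\<integral>p. f p * ln (f p) \<partial>MG) = (\<integral>p. ln (f p) \<partial>P)"
    by (subst integral_density) (auto simp: f_nonneg)
  also have "\<dots> = (\<integral>p. ln (m (fst p)) + ln (k p) \<partial>P)"
    using eq by (intro integral_cong_AE) auto
  also have "\<dots> = (\<integral>p. ln (m (fst p)) \<partial>P) + (\<integral>p. ln (k p) \<partial>P)"
    using lnm lnk by (rule Bochner_Integration.integral_add)
  also have "(\<integral>p. ln (m (fst p)) \<partial>P) = (\<integral>x. ln (m x) \<partial>M')"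
    using integrable_P_fst(2)[of "\<lambda>x. ln (m x)"] by simp
  also have "\<dots> = (\<integral>x. m x * ln (m x) \<partial>M)"
    by (subst integral_density) (auto simp: m_nonneg)
  finally show "(\<integral>p. f p * ln (f p) \<partial>MG) =
      (\<integral>x. m x * ln (m x) \<partial>M) + (\<integral>p. ln (k p) \<partial>P)" .
qed

end

section \<open>Transport inequalities for families of densities\<close>

text \<open>The image of \<open>S\<close> has law \<open>G\<close> independently of the parameter \<open>x\<close>. This is what makes the
  property iterable: a pair \<open>(x, S (x, y))\<close> can be followed by a further transport whose parameter
  is \<open>(x, y)\<close>.\<close>

definition talagrand_family ::
    "'a measure \<Rightarrow> 'b measure \<Rightarrow> ('b \<Rightarrow> real) \<Rightarrow> ('b \<Rightarrow> 'b \<Rightarrow> real) \<Rightarrow> bool" where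
  "talagrand_family Q G sq c \<longleftrightarrow>
     (\<forall>f. f \<in> borel_measurable (Q \<Otimes>\<^sub>M G) \<longrightarrow> (\<forall>p. 0 \<le> f p) \<longrightarrow>
        (AE x in Q. (\<integral>\<^sup>+y. ennreal (f (x, y)) \<partial>G) = 1) \<longrightarrow>
        integrable (Q \<Otimes>\<^sub>M G) (\<lambda>p. f p * ln (f p)) \<longrightarrow>
        integrable (Q \<Otimes>\<^sub>M G) (\<lambda>p. f p * sq (snd p)) \<longrightarrow>
        (\<exists>S \<in> Q \<Otimes>\<^sub>M G \<rightarrow>\<^sub>M G.
           distr (density (Q \<Otimes>\<^sub>M G) f) (Q \<Otimes>\<^sub>M G) (\<lambda>p. (fst p, S p)) = Q \<Otimes>\<^sub>M G \<and>
           integrable (density (Q \<Otimes>\<^sub>M G) f) (\<lambda>p. c (snd p) (S p)) \<and>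
           (\<integral>p. c (snd p) (S p) \<partial>density (Q \<Otimes>\<^sub>M G) f)
             \<le> 2 * (\<integral>p. f p * ln (f p) \<partial>(Q \<Otimes>\<^sub>M G))))"

text \<open>The slicewise rearrangements fit together measurably because the conditional cdf is a
  parameter integral and \<open>gauss_quantile\<close> is Borel. The slicewise inequalities are then
  integrated over \<open>Q\<close>.\<close>

lemma talagrand_family_real:
  assumes "prob_space Q"
  shows "talagrand_family Q std_normal_distribution (\<lambda>y. y\<^sup>2) (\<lambda>y z. (y - z)\<^sup>2)"
  unfolding talagrand_family_def
proof (intro allI impI)
  let ?N = std_normal_distribution
  let ?QN = "Q \<Otimes>\<^sub>M std_normal_distribution"
  fix f :: "'a \<times> real \<Rightarrow> real"
  assume fm[measurable]: "f \<in> borel_measurable ?QN" and nonneg: "\<forall>p. 0 \<le> f p"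
    and one: "AE x in Q. (\<integral>\<^sup>+y. ennreal (f (x, y)) \<partial>?N) = 1"
    and ent: "integrable ?QN (\<lambda>p. f p * ln (f p))"
    and mom: "integrable ?QN (\<lambda>p. f p * (snd p)\<^sup>2)"
  let ?D = "density ?QN f" and ?H = "\<lambda>x. \<integral>y. f (x, y) * ln (f (x, y)) \<partial>?N"
  interpret Q: prob_space Q by fact
  interpret QN: pair_prob_space Q ?N ..
  have nn[simp]: "0 \<le> f p" for p using nonneg by (rule spec)
  \<comment> \<open>The conditional cdf, written as an integral of a jointly measurable function, so
    that measurability in both variables is immediate.\<close>
  define F where "F p = enn2real (\<integral>\<^sup>+u. ennreal (f (fst p, u) * (if u \<le> snd p then 1 else 0)) \<partial>?N)" for p
  define S where "S p = gauss_quantile (F p)" for p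
  have [measurable]: "F \<in> borel_measurable ?QN"
    unfolding F_def by measurable
  have Sb[measurable]: "S \<in> borel_measurable ?QN" unfolding S_def by measurable
  then have S: "S \<in> ?QN \<rightarrow>\<^sub>M ?N" by (simp cong: measurable_cong_sets)
  have slice: "distr (density ?N (\<lambda>y. f (x, y))) borel (\<lambda>y. S (x, y)) = ?N"
      "(\<integral>\<^sup>+y. ennreal (f (x, y) * (y - S (x, y))\<^sup>2) \<partial>?N) \<le> ennreal (2 * ?H x)"
      "0 \<le> 2 * ?H x"
    if x: "x \<in> space Q" "(\<integral>\<^sup>+y. ennreal (f (x, y)) \<partial>?N) = 1"
      "integrable ?N (\<lambda>y. f (x, y) * ln (f (x, y)))" "integrable ?N (\<lambda>y. f (x, y) * y\<^sup>2)" for x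
  proof -
    have m: "(\<lambda>y. f (x, y)) \<in> borel_measurable borel"
      using measurable_compose[OF measurable_Pair1'[OF x(1)] fm] by simp
    have S_eq: "S (x, y) = gauss_quantile (cdf (density ?N (\<lambda>y. f (x, y))) y)" for y
      unfolding S_def F_def cdf_def measure_def using m
      by (auto simp: emeasure_density indicator_def intro!: arg_cong[where f = "\<lambda>z. gauss_quantile (enn2real z)"] nn_integral_cong)
    note * = gaussian_transport_1d[OF m nn x(2-4), folded S_eq]
    show "distr (density ?N (\<lambda>y. f (x, y))) borel (\<lambda>y. S (x, y)) = ?N" by (rule *(1))
    have [measurable]: "(\<lambda>y. S (x, y)) \<in> borel_measurable borel"
      using measurable_compose[OF measurable_Pair1'[OF x(1)] S] by simp
    have "(\<integral>\<^sup>+y. ennreal (f (x, y) * (y - S (x, y))\<^sup>2) \<partial>?N) =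
        (\<integral>\<^sup>+y. ennreal ((y - S (x, y))\<^sup>2) \<partial>density ?N (\<lambda>y. f (x, y)))"
      using m by (subst nn_integral_density) (auto simp: ennreal_mult)
    also have "\<dots> = ennreal (\<integral>y. (y - S (x, y))\<^sup>2 \<partial>density ?N (\<lambda>y. f (x, y)))"
      by (rule nn_integral_eq_integral[OF *(2)]) simp
    also have "\<dots> \<le> ennreal (2 * ?H x)"
      by (rule ennreal_leI[OF *(3)])
    finally show "(\<integral>\<^sup>+y. ennreal (f (x, y) * (y - S (x, y))\<^sup>2) \<partial>?N) \<le> ennreal (2 * ?H x)" .
    show "0 \<le> 2 * ?H x"
      by (rule order_trans[OF _ *(3)]) simp
  qed
  have good: "AE x in Q. x \<in> space Q \<and> (\<integral>\<^sup>+y. ennreal (f (x, y)) \<partial>?N) = 1 \<and>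
      integrable ?N (\<lambda>y. f (x, y) * ln (f (x, y))) \<and> integrable ?N (\<lambda>y. f (x, y) * y\<^sup>2)"
    using AE_space one QN.AE_integrable_fst'[OF ent] QN.AE_integrable_fst'[OF mom]
    by eventually_elim auto
  show "\<exists>S\<in>?QN \<rightarrow>\<^sub>M ?N.
      distr ?D ?QN (\<lambda>p. (fst p, S p)) = ?QN \<and>
      integrable ?D (\<lambda>p. (snd p - S p)\<^sup>2) \<and>
      (\<integral>p. (snd p - S p)\<^sup>2 \<partial>?D) \<le> 2 * (\<integral>p. f p * ln (f p) \<partial>?QN)"
  proof (intro bexI conjI)
    show "distr ?D ?QN (\<lambda>p. (fst p, S p)) = ?QN"
    proof (rule pair_measure_eqI[symmetric])
      show "sigma_finite_measure Q" "sigma_finite_measure ?N" by unfold_locales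
      fix A B assume A[measurable]: "A \<in> sets Q" and B[measurable]: "B \<in> sets ?N"
      have fS: "(\<lambda>p. (fst p, S p)) \<in> ?D \<rightarrow>\<^sub>M ?QN"
        using S by (auto intro!: measurable_Pair cong: measurable_cong_sets)
      have AB: "A \<times> B \<in> sets ?QN" using A B by (rule pair_measureI)
      have "(\<lambda>p. (fst p, S p)) -` (A \<times> B) \<inter> space ?QN \<in> sets ?QN"
        using measurable_sets[OF fS AB] by simp
      then have "emeasure (distr ?D ?QN (\<lambda>p. (fst p, S p))) (A \<times> B) =
          (\<integral>\<^sup>+p. ennreal (f p) * (indicator A (fst p) * indicator B (S p)) \<partial>?QN)"
        unfolding emeasure_distr[OF fS AB]
        by (subst space_density, subst emeasure_density)
          (auto intro!: nn_integral_cong simp: indicator_def space_pair_measure)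
      also have "\<dots> = (\<integral>\<^sup>+x. \<integral>\<^sup>+y. ennreal (f (x, y)) * (indicator A x * indicator B (S (x, y))) \<partial>?N \<partial>Q)"
        by (subst std_normal.nn_integral_fst[symmetric]) auto
      also have "\<dots> = (\<integral>\<^sup>+x. emeasure ?N B * indicator A x \<partial>Q)"
      proof (rule nn_integral_cong_AE)
        show "AE x in Q. (\<integral>\<^sup>+y. ennreal (f (x, y)) * (indicator A x * indicator B (S (x, y))) \<partial>?N) = emeasure ?N B * indicator A x"
          using good
        proof eventually_elim
          case (elim x)
          have m: "(\<lambda>y. f (x, y)) \<in> borel_measurable borel" and [measurable]: "(\<lambda>y. S (x, y)) \<in> borel_measurable borel"
            using measurable_compose[OF measurable_Pair1' fm] measurable_compose[OF measurable_Pair1' S] elim by auto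
          have "(\<integral>\<^sup>+y. ennreal (f (x, y)) * indicator B (S (x, y)) \<partial>?N) =
              emeasure (density ?N (\<lambda>y. f (x, y))) ((\<lambda>y. S (x, y)) -` B)"
            using m B by (subst emeasure_density) (auto intro!: nn_integral_cong measurable_sets_borel simp: indicator_def)
          also have "\<dots> = emeasure (distr (density ?N (\<lambda>y. f (x, y))) borel (\<lambda>y. S (x, y))) B"
            using B by (subst emeasure_distr) auto
          also have "\<dots> = emeasure ?N B" using slice(1) elim by simp
          finally show ?case by (auto simp: indicator_def)
        qed
      qed
      also have "\<dots> = emeasure Q A * emeasure ?N B" by (subst nn_integral_cmult) (auto simp: mult.commute)
      finally show "emeasure Q A * emeasure ?N B = emeasure (distr ?D ?QN (\<lambda>p. (fst p, S p))) (A \<times> B)" ..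
    qed simp
    have AE1: "AE x in Q. (\<integral>\<^sup>+y. ennreal (f (x, y) * (y - S (x, y))\<^sup>2) \<partial>?N)
        \<le> ennreal (2 * ?H x)"
      using good by eventually_elim (blast intro: slice)
    have AE2: "AE x in Q. 0 \<le> 2 * ?H x"
      using good by eventually_elim (blast intro: slice)
    have int: "integrable Q (\<lambda>x. 2 * ?H x)"
      using QN.integrable_fst'[OF ent] by auto
    have "(\<integral>\<^sup>+p. ennreal ((snd p - S p)\<^sup>2) \<partial>?D) =
        (\<integral>\<^sup>+p. ennreal (f p * (snd p - S p)\<^sup>2) \<partial>?QN)"
      by (subst nn_integral_density) (auto simp: ennreal_mult)
    also have "\<dots> = (\<integral>\<^sup>+x. \<integral>\<^sup>+y. ennreal (f (x, y) * (y - S (x, y))\<^sup>2) \<partial>?N \<partial>Q)"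
      by (subst std_normal.nn_integral_fst[symmetric]) auto
    also have "\<dots> \<le> (\<integral>\<^sup>+x. ennreal (2 * ?H x) \<partial>Q)"
      by (rule nn_integral_mono_AE[OF AE1])
    also have "\<dots> = ennreal (\<integral>x. 2 * ?H x \<partial>Q)"
      by (rule nn_integral_eq_integral[OF int AE2])
    also have "(\<integral>x. 2 * ?H x \<partial>Q) = 2 * (\<integral>p. f p * ln (f p) \<partial>?QN)"
      using QN.integral_fst'[OF ent] by simp
    finally have le: "(\<integral>\<^sup>+p. ennreal ((snd p - S p)\<^sup>2) \<partial>?D)
        \<le> ennreal (2 * (\<integral>p. f p * ln (f p) \<partial>?QN))" .
    show 1: "integrable ?D (\<lambda>p. (snd p - S p)\<^sup>2)"
      using le by (intro integrableI_nonneg) (auto simp: le_less_trans[OF _ ennreal_less_top])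
    have "0 \<le> (\<integral>x. 2 * ?H x \<partial>Q)"
      by (rule integral_nonneg_AE[OF AE2])
    then have "0 \<le> 2 * (\<integral>p. f p * ln (f p) \<partial>?QN)"
      using QN.integral_fst'[OF ent] by simp
    then show "(\<integral>p. (snd p - S p)\<^sup>2 \<partial>?D) \<le> 2 * (\<integral>p. f p * ln (f p) \<partial>?QN)"
      using le by (subst (asm) nn_integral_eq_integral[OF 1]) auto
  qed (rule S)
qed

lemma distr_pair_assoc:
  assumes "sigma_finite_measure A" "sigma_finite_measure B" "sigma_finite_measure C"
  shows "distr ((A \<Otimes>\<^sub>M B) \<Otimes>\<^sub>M C) (A \<Otimes>\<^sub>M (B \<Otimes>\<^sub>M C)) (\<lambda>p. (fst (fst p), (snd (fst p), snd p))) = A \<Otimes>\<^sub>M (B \<Otimes>\<^sub>M C)"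
proof (rule measure_eqI)
  interpret A: sigma_finite_measure A by fact
  interpret B: sigma_finite_measure B by fact
  interpret C: sigma_finite_measure C by fact
  interpret BC: pair_sigma_finite B C ..
  let ?D = "distr ((A \<Otimes>\<^sub>M B) \<Otimes>\<^sub>M C) (A \<Otimes>\<^sub>M (B \<Otimes>\<^sub>M C)) (\<lambda>p. (fst (fst p), (snd (fst p), snd p)))"
  fix X assume "X \<in> sets ?D"
  then have X[measurable]: "X \<in> sets (A \<Otimes>\<^sub>M (B \<Otimes>\<^sub>M C))" by simp
  have "emeasure ?D X
      = (\<integral>\<^sup>+p. indicator X (fst (fst p), (snd (fst p), snd p)) \<partial>((A \<Otimes>\<^sub>M B) \<Otimes>\<^sub>M C))"
    by (subst nn_integral_indicator[symmetric], simp, subst nn_integral_distr) auto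
  also have "\<dots> = (\<integral>\<^sup>+q. \<integral>\<^sup>+c. indicator X (fst q, (snd q, c)) \<partial>C \<partial>(A \<Otimes>\<^sub>M B))"
    by (subst C.nn_integral_fst[symmetric]) auto
  also have "\<dots> = (\<integral>\<^sup>+a. \<integral>\<^sup>+b. \<integral>\<^sup>+c. indicator X (a, (b, c)) \<partial>C \<partial>B \<partial>A)"
    by (subst B.nn_integral_fst[symmetric]) auto
  also have "\<dots> = (\<integral>\<^sup>+a. \<integral>\<^sup>+q. indicator X (a, q) \<partial>(B \<Otimes>\<^sub>M C) \<partial>A)"
    by (intro nn_integral_cong, subst C.nn_integral_fst[symmetric]) auto
  also have "\<dots> = emeasure (A \<Otimes>\<^sub>M (B \<Otimes>\<^sub>M C)) X"
    by (subst BC.nn_integral_fst) auto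
  finally show "emeasure ?D X
      = emeasure (A \<Otimes>\<^sub>M (B \<Otimes>\<^sub>M C)) X" .
qed simp

lemma talagrand_familyE:
  assumes T: "talagrand_family Q G sq c"
    and f: "f \<in> borel_measurable (Q \<Otimes>\<^sub>M G)" "\<And>p. 0 \<le> f p"
      "AE x in Q. (\<integral>\<^sup>+y. ennreal (f (x, y)) \<partial>G) = 1"
      "integrable (Q \<Otimes>\<^sub>M G) (\<lambda>p. f p * ln (f p))"
      "integrable (Q \<Otimes>\<^sub>M G) (\<lambda>p. f p * sq (snd p))"
  obtains S where "S \<in> Q \<Otimes>\<^sub>M G \<rightarrow>\<^sub>M G"
    "distr (density (Q \<Otimes>\<^sub>M G) f) (Q \<Otimes>\<^sub>M G) (\<lambda>p. (fst p, S p)) = Q \<Otimes>\<^sub>M G"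
    "integrable (density (Q \<Otimes>\<^sub>M G) f) (\<lambda>p. c (snd p) (S p))"
    "(\<integral>p. c (snd p) (S p) \<partial>density (Q \<Otimes>\<^sub>M G) f) \<le> 2 * (\<integral>p. f p * ln (f p) \<partial>(Q \<Otimes>\<^sub>M G))"
  using T[unfolded talagrand_family_def, rule_format, OF f] that by blast

text \<open>Tensorization by a triangular map in the manner of Knothe: the first coordinate is moved
  with parameter x, the second with the pair of x and the first coordinate as parameter, under the
  marginal law of that pair. This is why \<open>T2\<close> ranges over all parameter measures. The
  chain rule adds the two entropies.\<close>

lemma talagrand_family_pair:
  fixes Q :: "'a measure" and G1 :: "'b measure" and G2 :: "'c measure"
  assumes Q: "prob_space Q" and G1: "prob_space G1" and G2: "prob_space G2"
    and [measurable]: "sq1 \<in> borel_measurable G1" "sq2 \<in> borel_measurable G2"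
      "(\<lambda>p. c1 (fst p) (snd p)) \<in> borel_measurable (G1 \<Otimes>\<^sub>M G1)"
      "(\<lambda>p. c2 (fst p) (snd p)) \<in> borel_measurable (G2 \<Otimes>\<^sub>M G2)"
    and sq_nonneg: "\<And>y. 0 \<le> sq1 y" "\<And>y. 0 \<le> sq2 y"
    and T1: "talagrand_family Q G1 sq1 c1"
    and T2: "\<And>Q' :: ('a \<times> 'b) measure. prob_space Q' \<Longrightarrow> talagrand_family Q' G2 sq2 c2"
  shows "talagrand_family Q (G1 \<Otimes>\<^sub>M G2) (\<lambda>p. sq1 (fst p) + sq2 (snd p))
    (\<lambda>p q. c1 (fst p) (fst q) + c2 (snd p) (snd q))"
  unfolding talagrand_family_def
proof (intro allI impI)
  let ?G = "G1 \<Otimes>\<^sub>M G2"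
  let ?Q1 = "Q \<Otimes>\<^sub>M G1" and ?QG = "Q \<Otimes>\<^sub>M (G1 \<Otimes>\<^sub>M G2)" and ?T = "(Q \<Otimes>\<^sub>M G1) \<Otimes>\<^sub>M G2"
  fix f :: "'a \<times> 'b \<times> 'c \<Rightarrow> real"
  assume fm[measurable]: "f \<in> borel_measurable ?QG" and nonneg: "\<forall>p. 0 \<le> f p"
    and one: "AE x in Q. (\<integral>\<^sup>+y. ennreal (f (x, y)) \<partial>?G) = 1"
    and ent: "integrable ?QG (\<lambda>p. f p * ln (f p))"
    and mom: "integrable ?QG (\<lambda>p. f p * (sq1 (fst (snd p)) + sq2 (snd (snd p))))"
  interpret Q: prob_space Q by fact
  interpret G1: prob_space G1 by fact
  interpret G2: prob_space G2 by fact
  interpret G: pair_prob_space G1 G2 ..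
  interpret QG: pair_prob_space Q ?G ..
  interpret QG1: pair_prob_space Q G1 ..
  interpret QG12: pair_prob_space "?Q1" G2 ..
  have nn[simp]: "0 \<le> f p" for p using nonneg by (rule spec)
  define \<alpha> :: "('a \<times> 'b) \<times> 'c \<Rightarrow> 'a \<times> 'b \<times> 'c"
    where "\<alpha> = (\<lambda>p. (fst (fst p), (snd (fst p), snd p)))"
  have \<alpha>m[measurable]: "\<alpha> \<in> ?T \<rightarrow>\<^sub>M ?QG" unfolding \<alpha>_def by measurable
  have assoc: "distr ?T ?QG \<alpha> = ?QG"
    unfolding \<alpha>_def by (rule distr_pair_assoc) unfold_locales
  define f' where "f' = (\<lambda>p. f (\<alpha> p))"
  have f'm[measurable]: "f' \<in> borel_measurable ?T" unfolding f'_def by measurable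
  have f'1: "(\<integral>\<^sup>+p. f' p \<partial>?T) = 1"
  proof -
    have "(\<integral>\<^sup>+p. f' p \<partial>?T) = (\<integral>\<^sup>+p. f p \<partial>?QG)"
      unfolding f'_def by (subst assoc[symmetric], subst nn_integral_distr) auto
    also have "\<dots> = (\<integral>\<^sup>+x. \<integral>\<^sup>+y. ennreal (f (x, y)) \<partial>?G \<partial>Q)"
      by (subst G.nn_integral_fst[symmetric]) auto
    also have "\<dots> = (\<integral>\<^sup>+x. 1 \<partial>Q)" using one by (rule nn_integral_cong_AE)
    finally show ?thesis by (simp add: Q.emeasure_space_1)
  qed
  have "0 \<le> f' p" for p by (simp add: f'_def)
  then interpret C: pair_density "?Q1" G2 f'
    by (intro pair_density.intro pair_density_axioms.intro f'm f'1
        QG1.prob_space_axioms G2)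
  let ?P = "density ?T f'" and ?D = "density ?QG f"
  let ?Q' = "density ?Q1 C.m"
  let ?Q2 = "density ?Q1 C.m \<Otimes>\<^sub>M G2"
  have P_D: "distr ?P ?QG \<alpha> = ?D"
    using density_distr[of f "?QG" \<alpha> "?T"] by (simp add: assoc f'_def)
  have ent': "integrable ?T (\<lambda>p. f' p * ln (f' p))"
    "(\<integral>p. f' p * ln (f' p) \<partial>?T) = (\<integral>p. f p * ln (f p) \<partial>?QG)"
    using ent integrable_distr_eq[OF \<alpha>m, of "\<lambda>p. f p * ln (f p)"]
      integral_distr[OF \<alpha>m, of "\<lambda>p. f p * ln (f p)"]
    by (simp_all add: assoc f'_def)
  note chain = C.entropy_chain_rule[OF ent'(1)]
  have mom_D: "integrable ?D (\<lambda>p. sq1 (fst (snd p)) + sq2 (snd (snd p)))"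
    using mom by (subst integrable_density) auto
  have mom_P: "integrable ?P (\<lambda>p. sq1 (snd (fst p)) + sq2 (snd p))"
    using mom_D unfolding P_D[symmetric] by (subst (asm) integrable_distr_eq) (auto simp: \<alpha>_def)
  have mom1: "integrable ?P (\<lambda>p. sq1 (snd (fst p)))" and mom2: "integrable ?P (\<lambda>p. sq2 (snd p))"
    by (rule Bochner_Integration.integrable_bound[OF mom_P]; use sq_nonneg in \<open>auto simp: add_nonneg_nonneg\<close>)+
  have "AE x in Q. (\<integral>\<^sup>+y. ennreal (C.m (x, y)) \<partial>G1) = 1"
    using one QG1.AE_pair[OF C.AE_m] AE_space
  proof eventually_elim
    case (elim x)
    have "(\<integral>\<^sup>+y. ennreal (C.m (x, y)) \<partial>G1) = (\<integral>\<^sup>+y. \<integral>\<^sup>+z. ennreal (f (x, (y, z))) \<partial>G2 \<partial>G1)"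
      using elim(2) by (intro nn_integral_cong_AE) (auto elim!: eventually_mono simp: f'_def \<alpha>_def)
    also have "\<dots> = (\<integral>\<^sup>+y. ennreal (f (x, y)) \<partial>?G)"
      using measurable_compose[OF measurable_Pair1'[OF elim(3)] fm]
      by (subst G2.nn_integral_fst[symmetric]) auto
    finally show ?case using elim by simp
  qed
  moreover have "integrable ?Q1 (\<lambda>p. C.m p * sq1 (snd p))"
  proof -
    have "integrable ?Q' (\<lambda>p. sq1 (snd p))"
      using mom1 by (subst C.integrable_P_fst(1)[symmetric]) auto
    then show ?thesis by (subst (asm) integrable_density) (auto simp: C.m_nonneg)
  qed
  ultimately obtain S1 where S1[measurable]: "S1 \<in> ?Q1 \<rightarrow>\<^sub>M G1"
    and law1: "distr ?Q' ?Q1 (\<lambda>p. (fst p, S1 p)) = ?Q1"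
    and int1: "integrable ?Q' (\<lambda>p. c1 (snd p) (S1 p))"
    and le1: "(\<integral>p. c1 (snd p) (S1 p) \<partial>?Q') \<le> 2 * (\<integral>p. C.m p * ln (C.m p) \<partial>?Q1)"
    using talagrand_familyE[OF T1 C.m_meas C.m_nonneg _ chain(1)] by blast
  have sets_Q': "sets ?Q2 = sets ?T" by (intro sets_pair_measure_cong) auto
  have k'[measurable]: "C.k \<in> borel_measurable ?Q2"
    using C.k_meas by (simp cong: measurable_cong_sets[OF sets_Q' refl])
  have ik: "integrable ?Q2 (\<lambda>p. C.k p * sq2 (snd p))"
    using mom2 by (subst (asm) C.P_eq[symmetric], subst (asm) integrable_density) (auto simp: C.k_nonneg)
  obtain S2 where S2': "S2 \<in> ?Q2 \<rightarrow>\<^sub>M G2"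
    and law2: "distr ?P ?Q2 (\<lambda>p. (fst p, S2 p)) = ?Q2"
    and int2: "integrable ?P (\<lambda>p. c2 (snd p) (S2 p))"
    and le2: "(\<integral>p. c2 (snd p) (S2 p) \<partial>?P) \<le> 2 * (\<integral>p. C.k p * ln (C.k p) \<partial>?Q2)"
    using talagrand_familyE[OF T2[OF C.prob_M'] k' C.k_nonneg C.AE_k_one' chain(2) ik, unfolded C.P_eq]
    by blast
  have S2[measurable]: "S2 \<in> ?T \<rightarrow>\<^sub>M G2"
    using S2' by (simp cong: measurable_cong_sets[OF sets_Q' refl])
  let ?c = "\<lambda>S p. c1 (fst (snd p)) (fst (S p)) + c2 (snd (snd p)) (snd (S p))"
  define S where "S p = (S1 (fst p, fst (snd p)), S2 ((fst p, fst (snd p)), snd (snd p)))" for p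
  have Sm[measurable]: "S \<in> ?QG \<rightarrow>\<^sub>M ?G" unfolding S_def by measurable
  have S\<alpha>: "S (\<alpha> p) = (S1 (fst p), S2 p)" for p by (simp add: S_def \<alpha>_def)
  show "\<exists>S\<in>?QG \<rightarrow>\<^sub>M ?G.
      distr ?D ?QG (\<lambda>p. (fst p, S p)) = ?QG \<and>
      integrable ?D (?c S) \<and>
      (\<integral>p. ?c S p \<partial>?D)
        \<le> 2 * (\<integral>p. f p * ln (f p) \<partial>?QG)"
  proof (intro bexI conjI)
    have "distr ?D ?QG (\<lambda>p. (fst p, S p)) =
        distr ?P ?QG (\<lambda>p. (fst (fst p), (S1 (fst p), S2 p)))"
      unfolding P_D[symmetric] by (subst distr_distr) (auto simp: comp_def S_def \<alpha>_def intro!: distr_cong)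
    \<comment> \<open>The second coordinate is straightened first. Under \<open>?Q2\<close> it is
      independent of the rest, so moving the first coordinate by \<open>S1\<close> afterwards keeps
      the product form.\<close>
    also have "\<dots> = distr (distr ?P ?Q2 (\<lambda>p. (fst p, S2 p))) ?QG (\<lambda>p. (fst (fst p), (S1 (fst p), snd p)))"
      by (subst distr_distr) (auto simp: comp_def cong: measurable_cong_sets[OF sets_Q' refl])
    also have "\<dots> = distr ?Q2 ?QG (\<lambda>p. (fst (fst p), (S1 (fst p), snd p)))"
      unfolding law2 ..
    also have "\<dots> = distr (distr ?Q2 ?T (\<lambda>(x, y). ((fst x, S1 x), y))) ?QG \<alpha>"
      by (subst distr_distr) (auto simp: comp_def \<alpha>_def case_prod_beta cong: measurable_cong_sets[OF sets_Q' refl])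
    also have "distr ?Q2 ?T (\<lambda>(x, y). ((fst x, S1 x), y)) =
        distr ?Q' ?Q1 (\<lambda>p. (fst p, S1 p)) \<Otimes>\<^sub>M distr G2 G2 (\<lambda>y. y)"
      by (subst pair_measure_distr) (auto simp: distr_id2 G2.sigma_finite_measure_axioms)
    also have "\<dots> = ?T" unfolding law1 by (simp add: distr_id2)
    finally show "distr ?D ?QG (\<lambda>p. (fst p, S p)) = ?QG"
      unfolding assoc .
    have c1m[measurable]: "(\<lambda>p. c1 (snd p) (S1 p)) \<in> borel_measurable ?Q1"
      using measurable_compose[of "\<lambda>p. (snd p, S1 p)" _ "G1 \<Otimes>\<^sub>M G1" "\<lambda>p. c1 (fst p) (snd p)"] by simp
    have [measurable]: "(\<lambda>p. c1 (fst (snd p)) (fst (S p))) \<in> borel_measurable ?QG"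
      using measurable_compose[of "\<lambda>p. (fst (snd p), fst (S p))" _ "G1 \<Otimes>\<^sub>M G1" "\<lambda>p. c1 (fst p) (snd p)"] by simp
    have [measurable]: "(\<lambda>p. c2 (snd (snd p)) (snd (S p))) \<in> borel_measurable ?QG"
      using measurable_compose[of "\<lambda>p. (snd (snd p), snd (S p))" _ "G2 \<Otimes>\<^sub>M G2" "\<lambda>p. c2 (fst p) (snd p)"] by simp
    have i1: "integrable ?P (\<lambda>p. c1 (snd (fst p)) (S1 (fst p)))"
      "(\<integral>p. c1 (snd (fst p)) (S1 (fst p)) \<partial>?P) = (\<integral>p. c1 (snd p) (S1 p) \<partial>?Q')"
      using C.integrable_P_fst[OF c1m] int1 by auto
    show "integrable ?D (?c S)"
      unfolding P_D[symmetric] using i1(1) int2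
      by (subst integrable_distr_eq) (auto simp: S\<alpha>, simp add: \<alpha>_def)
    have "(\<integral>p. ?c S p \<partial>?D) =
        (\<integral>p. c1 (snd (fst p)) (S1 (fst p)) + c2 (snd p) (S2 p) \<partial>?P)"
      unfolding P_D[symmetric] by (subst integral_distr) (auto simp: S\<alpha>, simp add: \<alpha>_def)
    also have "\<dots> = (\<integral>p. c1 (snd p) (S1 p) \<partial>?Q') + (\<integral>p. c2 (snd p) (S2 p) \<partial>?P)"
      using i1 int2 by simp
    also have "\<dots> \<le> 2 * (\<integral>p. f p * ln (f p) \<partial>?QG)"
      using le1 le2 chain(4,5) ent'(2) by linarith
    finally show "(\<integral>p. ?c S p \<partial>?D)
        \<le> 2 * (\<integral>p. f p * ln (f p) \<partial>?QG)" .
  qed (rule Sm)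
qed

text \<open>Transfer along a measurable map with a left inverse that preserves the law, the second
  moment and the cost. It passes from pairs to functions on an index set, and from those to
  vectors.\<close>

lemma talagrand_family_distr:
  assumes Q: "prob_space Q" and G: "prob_space G"
    and \<phi>[measurable]: "\<phi> \<in> G \<rightarrow>\<^sub>M G'" and \<psi>[measurable]: "\<psi> \<in> G' \<rightarrow>\<^sub>M G"
    and inv: "\<And>y. y \<in> space G \<Longrightarrow> \<psi> (\<phi> y) = y"
    and G': "distr G G' \<phi> = G'"
    and [measurable]: "sq' \<in> borel_measurable G'"
    and c'[measurable]: "(\<lambda>p. c' (fst p) (snd p)) \<in> borel_measurable (G' \<Otimes>\<^sub>M G')"
    and sq': "\<And>y. y \<in> space G \<Longrightarrow> sq' (\<phi> y) = sq y"
    and c'_eq: "\<And>y z. y \<in> space G \<Longrightarrow> z \<in> space G \<Longrightarrow> c' (\<phi> y) (\<phi> z) = c y z"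
    and T: "talagrand_family Q G sq c"
  shows "talagrand_family Q G' sq' c'"
  unfolding talagrand_family_def
proof (intro allI impI)
  let ?QG = "Q \<Otimes>\<^sub>M G" and ?QG' = "Q \<Otimes>\<^sub>M G'"
  fix f :: "'a \<times> 'c \<Rightarrow> real"
  assume fm[measurable]: "f \<in> borel_measurable ?QG'" and nonneg: "\<forall>p. 0 \<le> f p"
    and one: "AE x in Q. (\<integral>\<^sup>+y. ennreal (f (x, y)) \<partial>G') = 1"
    and ent: "integrable ?QG' (\<lambda>p. f p * ln (f p))"
    and mom: "integrable ?QG' (\<lambda>p. f p * sq' (snd p))"
  interpret Q: prob_space Q by fact
  interpret G: prob_space G by fact
  have "prob_space (distr G G' \<phi>)" by (rule G.prob_space_distr) simp
  then interpret G': prob_space G' by (simp add: G')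
  define \<Phi> :: "'a \<times> 'b \<Rightarrow> 'a \<times> 'c" where "\<Phi> p = (fst p, \<phi> (snd p))" for p
  have \<Phi>[measurable]: "\<Phi> \<in> ?QG \<rightarrow>\<^sub>M ?QG'" unfolding \<Phi>_def by measurable
  have QG': "distr ?QG ?QG' \<Phi> = ?QG'"
  proof -
    have "distr Q Q (\<lambda>x. x) \<Otimes>\<^sub>M distr G G' \<phi> = distr ?QG ?QG' (\<lambda>(x, y). (x, \<phi> y))"
      by (rule pair_measure_distr) (auto simp: G' G'.sigma_finite_measure_axioms)
    moreover have "(\<lambda>(x, y). (x, \<phi> y)) = \<Phi>" by (auto simp: \<Phi>_def fun_eq_iff)
    ultimately show ?thesis by (simp add: G' distr_id2)
  qed
  define g where "g p = f (\<Phi> p)" for p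
  let ?P = "density ?QG g" and ?D = "density ?QG' f"
  have gm: "g \<in> borel_measurable ?QG" unfolding g_def by measurable
  have g_nonneg: "0 \<le> g p" for p unfolding g_def by (rule spec[OF nonneg])
  have D: "distr ?P ?QG' \<Phi> = ?D"
    using density_distr[of f "?QG'" \<Phi> "?QG"] by (simp add: QG' g_def)
  have g1: "AE x in Q. (\<integral>\<^sup>+y. ennreal (g (x, y)) \<partial>G) = 1"
    using one AE_space
  proof eventually_elim
    case (elim x)
    have "(\<integral>\<^sup>+y. ennreal (f (x, y)) \<partial>distr G G' \<phi>) = (\<integral>\<^sup>+y. ennreal (g (x, y)) \<partial>G)"
      using measurable_compose[OF measurable_Pair1'[OF elim(2)] fm]
      by (subst nn_integral_distr) (auto simp: g_def \<Phi>_def)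
    then show ?case using elim by (simp add: G')
  qed
  have ent': "integrable ?QG (\<lambda>p. g p * ln (g p))"
    "(\<integral>p. g p * ln (g p) \<partial>?QG) = (\<integral>p. f p * ln (f p) \<partial>?QG')"
    using ent integrable_distr_eq[OF \<Phi>, of "\<lambda>p. f p * ln (f p)"] integral_distr[OF \<Phi>, of "\<lambda>p. f p * ln (f p)"]
    by (simp_all add: QG' g_def)
  have "integrable ?QG (\<lambda>p. g p * sq' (snd (\<Phi> p)))"
    using mom integrable_distr_eq[OF \<Phi>, of "\<lambda>p. f p * sq' (snd p)"] by (simp add: QG' g_def)
  then have mom': "integrable ?QG (\<lambda>p. g p * sq (snd p))"
    by (rule Bochner_Integration.integrable_cong[OF refl, THEN iffD1, rotated])
      (auto simp: \<Phi>_def sq' space_pair_measure)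
  obtain S where S[measurable]: "S \<in> ?QG \<rightarrow>\<^sub>M G"
    and law: "distr ?P ?QG (\<lambda>p. (fst p, S p)) = ?QG"
    and int: "integrable ?P (\<lambda>p. c (snd p) (S p))"
    and le: "(\<integral>p. c (snd p) (S p) \<partial>?P) \<le> 2 * (\<integral>p. g p * ln (g p) \<partial>?QG)"
    using talagrand_familyE[OF T gm g_nonneg g1 ent'(1) mom'] by blast
  define S' where "S' p = \<phi> (S (fst p, \<psi> (snd p)))" for p
  have S'm[measurable]: "S' \<in> ?QG' \<rightarrow>\<^sub>M G'" unfolding S'_def by measurable
  have S'\<Phi>: "S' (\<Phi> p) = \<phi> (S p)" if "p \<in> space ?QG" for p
    using that by (auto simp: S'_def \<Phi>_def inv space_pair_measure)
  have cost: "c' (snd (\<Phi> p)) (S' (\<Phi> p)) = c (snd p) (S p)" if "p \<in> space ?QG" for p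
    unfolding S'\<Phi>[OF that] using that measurable_space[OF S that]
    by (auto simp: \<Phi>_def space_pair_measure intro!: c'_eq)
  have [measurable]: "(\<lambda>p. c' (snd p) (S' p)) \<in> borel_measurable ?QG'"
    using measurable_compose[of "\<lambda>p. (snd p, S' p)" _ "G' \<Otimes>\<^sub>M G'" "\<lambda>p. c' (fst p) (snd p)"] by simp
  show "\<exists>S\<in>?QG' \<rightarrow>\<^sub>M G'.
      distr ?D ?QG' (\<lambda>p. (fst p, S p)) = ?QG' \<and>
      integrable ?D (\<lambda>p. c' (snd p) (S p)) \<and>
      (\<integral>p. c' (snd p) (S p) \<partial>?D) \<le> 2 * (\<integral>p. f p * ln (f p) \<partial>?QG')"
  proof (intro bexI conjI)
    have "distr ?D ?QG' (\<lambda>p. (fst p, S' p)) =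
        distr ?P ?QG' (\<lambda>p. (fst (\<Phi> p), S' (\<Phi> p)))"
      unfolding D[symmetric] by (subst distr_distr) (auto simp: comp_def)
    also have "\<dots> = distr ?P ?QG' (\<lambda>p. \<Phi> (fst p, S p))"
      by (intro distr_cong refl) (simp add: S'\<Phi>, simp add: \<Phi>_def)
    also have "\<dots> = distr (distr ?P ?QG (\<lambda>p. (fst p, S p))) ?QG' \<Phi>"
      by (subst distr_distr) (auto simp: comp_def)
    finally show "distr ?D ?QG' (\<lambda>p. (fst p, S' p)) = ?QG'"
      unfolding law QG' .
    have "integrable ?P (\<lambda>p. c' (snd (\<Phi> p)) (S' (\<Phi> p)))"
      using int by (rule Bochner_Integration.integrable_cong[OF refl, THEN iffD1, rotated]) (simp add: cost)
    then show "integrable ?D (\<lambda>p. c' (snd p) (S' p))"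
      unfolding D[symmetric] by (subst integrable_distr_eq) auto
    have "(\<integral>p. c' (snd p) (S' p) \<partial>?D) =
        (\<integral>p. c' (snd (\<Phi> p)) (S' (\<Phi> p)) \<partial>?P)"
      unfolding D[symmetric] by (subst integral_distr) auto
    also have "\<dots> = (\<integral>p. c (snd p) (S p) \<partial>?P)"
      by (rule Bochner_Integration.integral_cong[OF refl]) (simp add: cost)
    finally show "(\<integral>p. c' (snd p) (S' p) \<partial>?D) \<le> 2 * (\<integral>p. f p * ln (f p) \<partial>?QG')"
      using le ent'(2) by simp
  qed (rule S'm)
qed

section \<open>Tensorization over finitely many coordinates\<close>

interpretation std_normals: product_sigma_finite "\<lambda>_. std_normal_distribution"
  by standard

lemma talagrand_family_PiM:
  fixes J :: "'i set"
  assumes "finite J" "J \<noteq> {}" and Q: "prob_space Q"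
  shows "talagrand_family Q (PiM J (\<lambda>_. std_normal_distribution))
    (\<lambda>y. \<Sum>i\<in>J. (y i)\<^sup>2) (\<lambda>y z. \<Sum>i\<in>J. (y i - z i)\<^sup>2)"
  using assms(1,2)
proof (induction rule: finite_ne_induct)
  case (singleton i)
  let ?N = "std_normal_distribution" let ?P1 = "Pi\<^sub>M {i} (\<lambda>_. ?N)"
  show ?case
  proof (rule talagrand_family_distr[OF Q _ _ _ _ _ _ _ _ _ talagrand_family_real[OF Q],
        where \<phi> = "\<lambda>x. \<lambda>j\<in>{i}. x" and \<psi> = "\<lambda>y. y i"])
    show "distr std_normal_distribution ?P1 (\<lambda>x. \<lambda>j\<in>{i}. x) =
        ?P1"
      using std_normals.distr_component[of i] by simp
  qed (auto intro!: std_normal.prob_space_axioms measurable_restrict)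
next
  case (insert i J)
  let ?N = "std_normal_distribution" let ?PJ = "Pi\<^sub>M J (\<lambda>_. ?N)" let ?P = "Pi\<^sub>M (insert i J) (\<lambda>_. ?N)"
  have PJ: "prob_space ?PJ" by (rule prob_space_PiM) (rule std_normal.prob_space_axioms)
  interpret PJ: prob_space ?PJ by fact
  interpret sw: pair_prob_space ?N ?PJ ..
  \<comment> \<open>The new coordinate is the second factor: that factor must satisfy the inequality
    over an enlarged parameter space, which the one-dimensional lemma provides for every parameter
    measure, whereas the induction hypothesis is tied to the given \<open>Q\<close>.\<close>
  have pair: "talagrand_family Q (?PJ \<Otimes>\<^sub>M ?N) (\<lambda>p. (\<Sum>i\<in>J. (fst p i)\<^sup>2) + (snd p)\<^sup>2)
      (\<lambda>p q. (\<Sum>i\<in>J. (fst p i - fst q i)\<^sup>2) + (snd p - snd q)\<^sup>2)"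
  proof (rule talagrand_family_pair[OF Q PJ std_normal.prob_space_axioms _ _ _ _ _ _ insert.IH talagrand_family_real])
    show "(\<lambda>p. \<Sum>i\<in>J. (fst p i - snd p i)\<^sup>2) \<in> borel_measurable (?PJ \<Otimes>\<^sub>M ?PJ)"
    proof (intro borel_measurable_sum)
      fix j assume "j \<in> J"
      then have [measurable]: "(\<lambda>y. y j) \<in> borel_measurable ?PJ"
        using measurable_component_singleton[of j J "\<lambda>_. ?N"] by simp
      show "(\<lambda>p. (fst p j - snd p j)\<^sup>2) \<in> borel_measurable (?PJ \<Otimes>\<^sub>M ?PJ)" by measurable
    qed
    show "(\<lambda>y. \<Sum>i\<in>J. (y i)\<^sup>2) \<in> borel_measurable ?PJ"
    proof (intro borel_measurable_sum)
      fix j assume "j \<in> J"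
      then have [measurable]: "(\<lambda>y. y j) \<in> borel_measurable ?PJ"
        using measurable_component_singleton[of j J "\<lambda>_. ?N"] by simp
      show "(\<lambda>p. (p j)\<^sup>2) \<in> borel_measurable ?PJ" by measurable
    qed
  qed (auto simp: sum_nonneg)
  let ?\<phi> = "\<lambda>p. (fst p)(i := snd p)" and ?\<psi> = "\<lambda>z. (restrict z J, z i)"
  have \<phi>: "?\<phi> \<in> ?PJ \<Otimes>\<^sub>M ?N \<rightarrow>\<^sub>M ?P"
    using measurable_add_dim[of i J "\<lambda>_. ?N"] by (simp add: case_prod_beta')
  have comp: "(\<lambda>y. y j) \<in> borel_measurable ?P" if "j \<in> insert i J" for j
    using measurable_component_singleton[of j "insert i J" "\<lambda>_. ?N"] that by simp
  show ?case
  proof (rule talagrand_family_distr[OF Q _ \<phi> _ _ _ _ _ _ _ pair, where \<psi> = ?\<psi>])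
    show "prob_space (?PJ \<Otimes>\<^sub>M ?N)"
      by (intro prob_space_pair PJ std_normal.prob_space_axioms)
    show "?\<psi> \<in> ?P \<rightarrow>\<^sub>M ?PJ \<Otimes>\<^sub>M ?N"
      by (intro measurable_Pair measurable_restrict_subset measurable_component_singleton) auto
    show "?\<psi> (?\<phi> y) = y" if "y \<in> space (?PJ \<Otimes>\<^sub>M ?N)" for y
      using that insert.hyps by (cases y) (auto simp: space_pair_measure space_PiM fun_eq_iff PiE_def extensional_def)
    have "distr (?PJ \<Otimes>\<^sub>M ?N) ?P ?\<phi> = distr (distr (?PJ \<Otimes>\<^sub>M ?N) (?N \<Otimes>\<^sub>M ?PJ) (\<lambda>(x, y). (y, x))) ?P (\<lambda>(x, X). X(i := x))"
      using \<phi> measurable_compose[OF measurable_pair_swap' \<phi>]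
      by (subst distr_distr) (auto simp: comp_def case_prod_beta')
    also have "distr (?PJ \<Otimes>\<^sub>M ?N) (?N \<Otimes>\<^sub>M ?PJ) (\<lambda>(x, y). (y, x)) = ?N \<Otimes>\<^sub>M ?PJ"
      by (rule sw.distr_pair_swap[symmetric])
    also have "distr (?N \<Otimes>\<^sub>M ?PJ) ?P (\<lambda>(x, X). X(i := x)) = ?P"
      by (rule distr_pair_PiM_eq_PiM) (rule std_normal.prob_space_axioms)+
    finally show "distr (?PJ \<Otimes>\<^sub>M ?N) ?P ?\<phi> = ?P" .
    show "(\<lambda>y. \<Sum>i\<in>insert i J. (y i)\<^sup>2) \<in> borel_measurable ?P"
      using comp by (intro borel_measurable_sum borel_measurable_power) auto
    show "(\<lambda>p. \<Sum>i\<in>insert i J. (fst p i - snd p i)\<^sup>2) \<in> borel_measurable (?P \<Otimes>\<^sub>M ?P)"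
      using comp by (intro borel_measurable_sum borel_measurable_power borel_measurable_diff)
        (auto intro: measurable_compose[OF measurable_fst] measurable_compose[OF measurable_snd])
    show "(\<Sum>j\<in>insert i J. (?\<phi> y j)\<^sup>2) = (\<Sum>i\<in>J. (fst y i)\<^sup>2) + (snd y)\<^sup>2" for y :: "('i \<Rightarrow> real) \<times> real"
    proof -
      have "(\<Sum>j\<in>J. (?\<phi> y j)\<^sup>2) = (\<Sum>j\<in>J. (fst y j)\<^sup>2)"
        by (rule sum.cong) (use insert.hyps in auto)
      then show ?thesis using insert.hyps by simp
    qed
    show "(\<Sum>j\<in>insert i J. (?\<phi> y j - ?\<phi> z j)\<^sup>2) = (\<Sum>i\<in>J. (fst y i - fst z i)\<^sup>2) + (snd y - snd z)\<^sup>2"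
      for y z :: "('i \<Rightarrow> real) \<times> real"
    proof -
      have "(\<Sum>j\<in>J. (?\<phi> y j - ?\<phi> z j)\<^sup>2) = (\<Sum>j\<in>J. (fst y j - fst z j)\<^sup>2)"
        by (rule sum.cong) (use insert.hyps in auto)
      then show ?thesis using insert.hyps by simp
    qed
  qed
qed

section \<open>Lebesgue and Gaussian measure on vectors as product measures\<close>

lemma measurable_vec_lambda_PiM:
  assumes "\<And>i. sets (M i) = sets borel"
  shows "(\<lambda>\<omega>. \<chi> i::'n::finite. (\<omega> i :: real)) \<in> PiM UNIV M \<rightarrow>\<^sub>M borel"
proof (subst borel_measurable_euclidean_space, intro ballI)
  fix b :: "real ^ 'n" assume "b \<in> Basis"
  then obtain i where b: "b = axis i 1" by (auto simp: Basis_vec_def)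
  have "(\<lambda>\<omega>. \<omega> i) \<in> borel_measurable (PiM UNIV M)"
    using measurable_component_singleton[of i UNIV M] assms[of i] by (simp cong: measurable_cong_sets)
  then show "(\<lambda>\<omega>. (\<chi> i. \<omega> i) \<bullet> b) \<in> borel_measurable (PiM UNIV M)"
    by (simp add: b inner_axis)
qed

lemma lborel_vec_eq_PiM:
  "distr (PiM UNIV (\<lambda>_. lborel)) borel (\<lambda>\<omega>. \<chi> i. \<omega> i) = (lborel :: (real ^ 'n) measure)"
proof (rule lborel_eqI[symmetric])
  let ?P = "PiM UNIV (\<lambda>_::'n. lborel :: real measure)" and ?\<phi> = "\<lambda>\<omega>. \<chi> i::'n. (\<omega> i :: real)"
  interpret product_sigma_finite "\<lambda>_. lborel :: real measure" ..
  fix l u :: "real ^ 'n" assume le: "\<And>b. b \<in> Basis \<Longrightarrow> l \<bullet> b \<le> u \<bullet> b"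
  have lu: "l $ i \<le> u $ i" for i
    using le[of "axis i 1"] by (auto simp: inner_axis Basis_vec_def)
  have pre: "?\<phi> -` box l u \<inter> space ?P = Pi\<^sub>E UNIV (\<lambda>i. {l $ i <..< u $ i})"
    by (auto simp: mem_box_cart space_PiM PiE_iff)
  have "emeasure (distr ?P borel ?\<phi>) (box l u)
      = emeasure ?P (Pi\<^sub>E UNIV (\<lambda>i. {l $ i <..< u $ i}))"
    by (subst emeasure_distr) (auto simp: pre intro!: measurable_vec_lambda_PiM)
  also have "\<dots> = (\<Prod>i\<in>UNIV. emeasure lborel {l $ i <..< u $ i})"
    by (rule emeasure_PiM) auto
  also have "\<dots> = (\<Prod>i\<in>UNIV. ennreal (u $ i - l $ i))" using lu by simp
  also have "\<dots> = ennreal (\<Prod>i\<in>UNIV. u $ i - l $ i)" using lu by (intro prod_ennreal) auto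
  also have "(\<Prod>i\<in>UNIV. u $ i - l $ i) = (\<Prod>b\<in>Basis. (u - l) \<bullet> b)"
  proof -
    have B: "Basis = (\<lambda>i. axis i (1::real)) ` (UNIV :: 'n set)" by (auto simp: Basis_vec_def)
    have "inj (\<lambda>i. axis i (1::real) :: real ^ 'n)" by (auto simp: inj_def axis_eq_axis)
    then show ?thesis unfolding B by (subst prod.reindex) (auto simp: inner_axis)
  qed
  finally show "emeasure (distr ?P borel ?\<phi>) (box l u)
      = (\<Prod>b\<in>Basis. (u - l) \<bullet> b)" by simp
qed simp

lemma sets_std_gaussian[measurable_cong, simp]: "sets std_gaussian = sets borel"
  and space_std_gaussian[simp]: "space std_gaussian = UNIV"
  by (simp_all add: std_gaussian_def)

text \<open>It suffices to compare on rectangles, where the integrand factorizes over the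
  coordinates of Lebesgue measure.\<close>

lemma distr_std_gaussian_PiM:
  "distr std_gaussian (PiM UNIV (\<lambda>_. std_normal_distribution)) (\<lambda>x::real ^ 'n. \<lambda>i. x $ i)
    = PiM UNIV (\<lambda>_. std_normal_distribution)"
proof (rule std_normals.PiM_eqI)
  let ?N = "std_normal_distribution" and ?P = "PiM UNIV (\<lambda>_::'n. std_normal_distribution)"
  let ?D = "distr (std_gaussian :: (real ^ 'n) measure) ?P (\<lambda>x i. x $ i)"
  interpret product_sigma_finite "\<lambda>_. lborel :: real measure" ..
  fix A :: "'n \<Rightarrow> real set" assume A: "\<And>i. i \<in> UNIV \<Longrightarrow> A i \<in> sets ?N"
  then have Ab[measurable]: "A i \<in> sets borel" for i by simp
  have m: "(\<lambda>x::real ^ 'n. \<lambda>i. x $ i) \<in> borel \<rightarrow>\<^sub>M ?P"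
    by (rule measurable_PiM_single') (auto simp: space_PiM PiE_def)
  have pre: "(\<lambda>x::real ^ 'n. \<lambda>i. x $ i) -` Pi\<^sub>E UNIV A = {x. \<forall>i. x $ i \<in> A i}"
    by auto
  have pm: "{x::real ^ 'n. \<forall>i. x $ i \<in> A i} \<in> sets borel"
  proof -
    have "{x::real ^ 'n. \<forall>i. x $ i \<in> A i} = (\<Inter>i. (\<lambda>x. x $ i) -` A i)" by auto
    also have "\<dots> \<in> sets borel"
      by (intro sets.finite_INT measurable_sets_borel[OF _ Ab]) auto
    finally show ?thesis .
  qed
  have "emeasure ?D (Pi\<^sub>E UNIV A)
      = emeasure std_gaussian {x::real ^ 'n. \<forall>i. x $ i \<in> A i}"
    using A m by (subst emeasure_distr) (auto simp: pre intro!: sets_PiM_I_finite cong: measurable_cong_sets)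
  also have "\<dots> = (\<integral>\<^sup>+x. (\<Prod>i\<in>UNIV. ennreal (std_normal_density (x $ i)) * indicator (A i) (x $ i)) \<partial>(lborel :: (real ^ 'n) measure))"
    unfolding std_gaussian_def using pm
    by (subst emeasure_density)
      (auto intro!: nn_integral_cong simp: prod_ennreal[symmetric] prod.distrib indicator_def
        split: if_splits)
  also have "\<dots> = (\<integral>\<^sup>+\<omega>. (\<Prod>i\<in>UNIV. ennreal (std_normal_density (\<omega> i)) * indicator (A i) (\<omega> i)) \<partial>PiM UNIV (\<lambda>_. lborel))"
    by (subst lborel_vec_eq_PiM[symmetric], subst nn_integral_distr) (auto intro!: measurable_vec_lambda_PiM)
  also have "\<dots> = (\<Prod>i\<in>UNIV. \<integral>\<^sup>+z. ennreal (std_normal_density z) * indicator (A i) z \<partial>lborel)"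
    by (rule product_nn_integral_prod) auto
  also have "\<dots> = (\<Prod>i\<in>UNIV. emeasure ?N (A i))"
    by (simp add: emeasure_density)
  finally show "emeasure ?D (Pi\<^sub>E UNIV A)
      = (\<Prod>i\<in>UNIV. emeasure ?N (A i))" .
qed auto

lemma std_gaussian_eq_distr_PiM:
  "distr (PiM UNIV (\<lambda>_. std_normal_distribution)) std_gaussian (\<lambda>\<omega>. \<chi> i. \<omega> i) = (std_gaussian :: (real ^ 'n) measure)"
proof -
  have m: "(\<lambda>x::real ^ 'n. \<lambda>i. x $ i) \<in> borel \<rightarrow>\<^sub>M PiM UNIV (\<lambda>_. std_normal_distribution)"
    by (rule measurable_PiM_single') (auto simp: space_PiM PiE_def)
  have "(\<lambda>\<omega>. \<chi> i::'n. \<omega> i) \<in> PiM UNIV (\<lambda>_. std_normal_distribution) \<rightarrow>\<^sub>M borel"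
    by (rule measurable_vec_lambda_PiM) simp
  then show ?thesis using m
    by (subst distr_std_gaussian_PiM[symmetric], subst distr_distr)
      (auto simp: comp_def distr_id2 cong: measurable_cong_sets)
qed

lemma prob_space_std_gaussian: "prob_space (std_gaussian :: (real ^ 'n) measure)"
  by (subst std_gaussian_eq_distr_PiM[symmetric], rule prob_space.prob_space_distr)
    (auto intro!: prob_space_PiM std_normal.prob_space_axioms measurable_vec_lambda_PiM
      cong: measurable_cong_sets)

lemma power2_norm_vec: "(norm (x :: real ^ 'n))\<^sup>2 = (\<Sum>i\<in>UNIV. (x $ i)\<^sup>2)"
  by (simp add: norm_vec_def L2_set_def sum_nonneg)

lemma talagrand_family_std_gaussian:
  assumes Q: "prob_space Q"
  shows "talagrand_family Q (std_gaussian :: (real ^ 'n) measure)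
    (\<lambda>x. (norm x)\<^sup>2) (\<lambda>x z. (norm (x - z))\<^sup>2)"
proof (rule talagrand_family_distr[OF Q _ _ _ _ _ _ _ _ _ talagrand_family_PiM[of "UNIV :: 'n set", OF _ _ Q],
      where \<phi> = "\<lambda>\<omega>. \<chi> i. \<omega> i" and \<psi> = "\<lambda>x i. x $ i"])
  show "prob_space (PiM UNIV (\<lambda>_::'n. std_normal_distribution))"
    by (intro prob_space_PiM std_normal.prob_space_axioms)
  show "(\<lambda>\<omega>. \<chi> i. \<omega> i) \<in> PiM UNIV (\<lambda>_::'n. std_normal_distribution) \<rightarrow>\<^sub>M std_gaussian"
    using measurable_vec_lambda_PiM[of "\<lambda>_::'n. std_normal_distribution"] by (simp cong: measurable_cong_sets)
  show "(\<lambda>x i. x $ i) \<in> (std_gaussian :: (real ^ 'n) measure) \<rightarrow>\<^sub>M PiM UNIV (\<lambda>_. std_normal_distribution)"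
    by (rule measurable_PiM_single') (auto simp: space_PiM PiE_def cong: measurable_cong_sets)
  show "distr (PiM UNIV (\<lambda>_. std_normal_distribution)) std_gaussian (\<lambda>\<omega>. \<chi> i. \<omega> i) = (std_gaussian :: (real ^ 'n) measure)"
    by (rule std_gaussian_eq_distr_PiM)
  have nth[measurable]: "(\<lambda>x::real ^ 'n. x $ i) \<in> borel_measurable std_gaussian" for i by simp
  show "(\<lambda>p. (norm (fst p - snd p))\<^sup>2) \<in> borel_measurable ((std_gaussian :: (real ^ 'n) measure) \<Otimes>\<^sub>M std_gaussian)"
    unfolding power2_norm_vec vector_minus_component by measurable
qed (auto simp: power2_norm_vec)

section \<open>Gaussian densities\<close>

text \<open>The density in \<open>std_gaussian\<close> with its product collapsed to a function of
  the norm, which makes shifts and rotations algebraic.\<close>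

definition gauss_dens :: "real ^ 'n \<Rightarrow> real" where
  "gauss_dens x = (1 / sqrt (2 * pi)) ^ CARD('n) * exp (- (norm x)\<^sup>2 / 2)"

lemma gauss_dens_pos[simp]: "0 < gauss_dens x"
  by (simp add: gauss_dens_def)

lemma gauss_dens_nonneg[simp]: "0 \<le> gauss_dens x"
  by (simp add: less_imp_le)

lemma gauss_dens_nonzero[simp]: "gauss_dens x \<noteq> 0"
  using gauss_dens_pos[of x] by linarith

lemma measurable_gauss_dens[measurable]: "gauss_dens \<in> borel_measurable borel"
  unfolding gauss_dens_def by measurable

lemma std_gaussian_eq_density: "std_gaussian = density lborel (\<lambda>x :: real ^ 'n. gauss_dens x)"
proof -
  have "(\<Prod>i\<in>UNIV. std_normal_density (x $ i)) = gauss_dens x" for x :: "real ^ 'n"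
    by (simp add: std_normal_density_def gauss_dens_def power2_norm_vec prod_dividef exp_sum[symmetric]
        sum_negf sum_divide_distrib power_divide)
  then show ?thesis by (simp add: std_gaussian_def)
qed

lemma nn_integral_std_gaussian:
  "h \<in> borel_measurable borel \<Longrightarrow>
    (\<integral>\<^sup>+x. h x \<partial>(std_gaussian :: (real ^ 'n) measure)) = (\<integral>\<^sup>+x. ennreal (gauss_dens x) * h x \<partial>lborel)"
  unfolding std_gaussian_eq_density by (subst nn_integral_density) auto

lemma nn_integral_lborel_affine:
  fixes h :: "'a :: euclidean_space \<Rightarrow> ennreal"
  assumes [measurable]: "h \<in> borel_measurable borel" and c: "0 < c"
  shows "(\<integral>\<^sup>+x. h x \<partial>lborel) = ennreal (c ^ DIM('a)) * (\<integral>\<^sup>+x. h (t + c *\<^sub>R x) \<partial>lborel)"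
  using c by (subst lborel_affine[of c t]) (auto simp: nn_integral_density nn_integral_distr nn_integral_cmult)

interpretation std_gaussian: prob_space "std_gaussian :: (real ^ 'n) measure"
  by (rule prob_space_std_gaussian)

text \<open>The exponential is the Cameron-Martin density of the translate by n. It returns as the
  integrand of \<open>\<kappa>\<close> and in the equality case.\<close>

lemma gauss_dens_shift:
  "gauss_dens (z - n) = gauss_dens z * exp (n \<bullet> z - (norm n)\<^sup>2 / 2)"
proof -
  have "- (norm (z - n))\<^sup>2 / 2 = - (norm z)\<^sup>2 / 2 + (n \<bullet> z - (norm n)\<^sup>2 / 2)"
    unfolding power2_norm_eq_inner by (simp add: inner_simps inner_commute field_simps)
  then show ?thesis unfolding gauss_dens_def by (simp add: exp_add[symmetric])
qed

lemma nn_integral_gauss_tilt: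
  "(\<integral>\<^sup>+z. ennreal (exp (\<theta> \<bullet> z - (norm \<theta>)\<^sup>2 / 2)) \<partial>(std_gaussian :: (real ^ 'n) measure)) = 1"
proof -
  have "(\<integral>\<^sup>+z. ennreal (exp (\<theta> \<bullet> z - (norm \<theta>)\<^sup>2 / 2)) \<partial>std_gaussian) =
      (\<integral>\<^sup>+z. ennreal (gauss_dens z) * ennreal (exp (\<theta> \<bullet> z - (norm \<theta>)\<^sup>2 / 2)) \<partial>lborel)"
    by (rule nn_integral_std_gaussian) simp
  also have "\<dots> = (\<integral>\<^sup>+z. ennreal (gauss_dens (z - \<theta>)) \<partial>lborel)"
    unfolding gauss_dens_shift by (simp add: ennreal_mult)
  also have "\<dots> = (\<integral>\<^sup>+z. ennreal (gauss_dens z) \<partial>(lborel :: (real ^ 'n) measure))"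
    by (subst nn_integral_lborel_affine[of _ 1 \<theta>]) auto
  also have "\<dots> = emeasure std_gaussian (space (std_gaussian :: (real ^ 'n) measure))"
    unfolding std_gaussian_eq_density by (subst emeasure_density) (auto intro!: nn_integral_cong)
  also have "\<dots> = 1" by (rule std_gaussian.emeasure_space_1)
  finally show ?thesis .
qed

lemma gauss_dens_rotate:
  fixes u w :: "real ^ 'n"
  assumes "a\<^sup>2 + b\<^sup>2 = 1"
  shows "gauss_dens (a *\<^sub>R u + b *\<^sub>R w) * gauss_dens (b *\<^sub>R u - a *\<^sub>R w) = gauss_dens u * gauss_dens w"
proof -
  have "(norm (a *\<^sub>R u + b *\<^sub>R w))\<^sup>2 + (norm (b *\<^sub>R u - a *\<^sub>R w))\<^sup>2 = (a\<^sup>2 + b\<^sup>2) * ((norm u)\<^sup>2 + (norm w)\<^sup>2)"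
    unfolding power2_norm_eq_inner unfolding power2_eq_square by (simp add: inner_simps inner_commute algebra_simps)
  then have "- (norm (a *\<^sub>R u + b *\<^sub>R w))\<^sup>2 / 2 + - (norm (b *\<^sub>R u - a *\<^sub>R w))\<^sup>2 / 2 = - (norm u)\<^sup>2 / 2 + - (norm w)\<^sup>2 / 2"
    using assms by simp
  then have "exp (- (norm (a *\<^sub>R u + b *\<^sub>R w))\<^sup>2 / 2) * exp (- (norm (b *\<^sub>R u - a *\<^sub>R w))\<^sup>2 / 2)
      = exp (- (norm u)\<^sup>2 / 2) * exp (- (norm w)\<^sup>2 / 2)"
    by (metis exp_add)
  then show ?thesis unfolding gauss_dens_def by (simp add: mult_ac)
qed

text \<open>Orthogonal when \<open>a^2 + b^2 = 1\<close>: a reflection, which is its own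
  inverse.\<close>

definition gauss_rotate :: "real \<Rightarrow> real \<Rightarrow> (real ^ 'n) \<times> (real ^ 'n) \<Rightarrow> (real ^ 'n) \<times> (real ^ 'n)" where
  "gauss_rotate a b p = (a *\<^sub>R fst p + b *\<^sub>R snd p, b *\<^sub>R fst p - a *\<^sub>R snd p)"

lemma measurable_gauss_rotate[measurable]:
  "gauss_rotate a b \<in> std_gaussian \<Otimes>\<^sub>M std_gaussian \<rightarrow>\<^sub>M std_gaussian \<Otimes>\<^sub>M std_gaussian"
proof -
  have [measurable_cong]: "sets (std_gaussian \<Otimes>\<^sub>M std_gaussian) = sets ((borel :: (real ^ 'n) measure) \<Otimes>\<^sub>M (borel :: (real ^ 'n) measure))"
    by (intro sets_pair_measure_cong) auto
  show ?thesis unfolding gauss_rotate_def by measurable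
qed

lemma nn_integral_std_gaussian_pair:
  fixes h :: "(real ^ 'n) \<times> (real ^ 'n) \<Rightarrow> ennreal"
  assumes [measurable]: "h \<in> borel_measurable (borel \<Otimes>\<^sub>M borel)"
  shows "(\<integral>\<^sup>+p. h p \<partial>(std_gaussian \<Otimes>\<^sub>M std_gaussian)) =
    (\<integral>\<^sup>+x. \<integral>\<^sup>+y. ennreal (gauss_dens x * gauss_dens y) * h (x, y) \<partial>lborel \<partial>lborel)"
proof -
  have "h \<in> borel_measurable (std_gaussian \<Otimes>\<^sub>M std_gaussian)"
    using assms by (simp cong: measurable_cong_sets sets_pair_measure_cong)
  then have "(\<integral>\<^sup>+p. h p \<partial>(std_gaussian \<Otimes>\<^sub>M std_gaussian)) = (\<integral>\<^sup>+x. \<integral>\<^sup>+y. h (x, y) \<partial>std_gaussian \<partial>std_gaussian)"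
    by (rule std_gaussian.nn_integral_fst[symmetric])
  also have "\<dots> = (\<integral>\<^sup>+x. ennreal (gauss_dens x) * (\<integral>\<^sup>+y. ennreal (gauss_dens y) * h (x, y) \<partial>lborel) \<partial>lborel)"
    by (subst nn_integral_std_gaussian) (auto simp: nn_integral_std_gaussian)
  also have "\<dots> = (\<integral>\<^sup>+x. \<integral>\<^sup>+y. ennreal (gauss_dens x * gauss_dens y) * h (x, y) \<partial>lborel \<partial>lborel)"
    by (subst nn_integral_cmult[symmetric]) (auto simp: ennreal_mult mult.assoc)
  finally show ?thesis .
qed

text \<open>Two affine substitutions in one vector variable: \<open>u = a x + b v\<close> replaces v
  for fixed x, then \<open>x = a u + b w\<close> introduces w for fixed u. Their Jacobian factors
  \<open>1 / b^d\<close> and \<open>b^d\<close> cancel, and the Gaussian weight is invariant by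
  \<open>gauss_dens_rotate\<close>.\<close>

lemma distr_gauss_rotate:
  assumes ab: "0 < b" "a\<^sup>2 + b\<^sup>2 = 1"
  shows "distr (std_gaussian \<Otimes>\<^sub>M std_gaussian) (std_gaussian \<Otimes>\<^sub>M std_gaussian) (gauss_rotate a b)
    = (std_gaussian \<Otimes>\<^sub>M std_gaussian :: ((real ^ 'n) \<times> (real ^ 'n)) measure)"
proof (rule measure_eqI)
  let ?G2 = "std_gaussian \<Otimes>\<^sub>M std_gaussian :: ((real ^ 'n) \<times> (real ^ 'n)) measure"
  have sets2: "sets ?G2 = sets ((borel :: (real ^ 'n) measure) \<Otimes>\<^sub>M (borel :: (real ^ 'n) measure))"
    by (intro sets_pair_measure_cong) auto
  fix X assume "X \<in> sets (distr ?G2 ?G2 (gauss_rotate a b))"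
  then have X: "X \<in> sets ?G2" by simp
  then have [measurable]: "X \<in> sets ((borel :: (real ^ 'n) measure) \<Otimes>\<^sub>M (borel :: (real ^ 'n) measure))"
    using sets2 by simp
  define h :: "(real ^ 'n) \<times> (real ^ 'n) \<Rightarrow> ennreal" where "h = indicator X"
  have [measurable]: "h \<in> borel_measurable (borel \<Otimes>\<^sub>M borel)" unfolding h_def by measurable
  have [measurable]: "gauss_rotate a b \<in> borel \<Otimes>\<^sub>M borel \<rightarrow>\<^sub>M borel \<Otimes>\<^sub>M (borel :: (real ^ 'n) measure)"
    unfolding gauss_rotate_def by measurable
  let ?d = "DIM(real ^ 'n)"
  let ?K = "\<lambda>x u :: real ^ 'n. ennreal (gauss_dens x * gauss_dens (- (a / b) *\<^sub>R x + (1 / b) *\<^sub>R u)) * h (u, (1 / b) *\<^sub>R x - (a / b) *\<^sub>R u)"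
  have b2: "b * b = 1 - a * a" using ab by (simp add: power2_eq_square)
  have co: "b + a * a / b = 1 / b" using ab b2 by (simp add: field_simps)
  have "emeasure (distr ?G2 ?G2 (gauss_rotate a b)) X = (\<integral>\<^sup>+p. h (gauss_rotate a b p) \<partial>?G2)"
    using X by (subst nn_integral_indicator[symmetric], simp, subst nn_integral_distr) (auto simp: h_def)
  also have "\<dots> = (\<integral>\<^sup>+x. \<integral>\<^sup>+v. ennreal (gauss_dens x * gauss_dens v) * h (gauss_rotate a b (x, v)) \<partial>lborel \<partial>lborel)"
    by (rule nn_integral_std_gaussian_pair) measurable
  also have "\<dots> = (\<integral>\<^sup>+x. ennreal ((1 / b) ^ ?d) * (\<integral>\<^sup>+u. ?K x u \<partial>lborel) \<partial>lborel)"
  proof (intro nn_integral_cong)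
    fix x :: "real ^ 'n"
    have arg: "gauss_rotate a b (x, (1 / b) *\<^sub>R u - (a / b) *\<^sub>R x) = (u, (1 / b) *\<^sub>R x - (a / b) *\<^sub>R u)" for u :: "real ^ 'n"
      using ab co by (simp add: gauss_rotate_def scaleR_right_distrib scaleR_right_diff_distrib scaleR_add_left[symmetric]
         algebra_simps)
    show "(\<integral>\<^sup>+v. ennreal (gauss_dens x * gauss_dens v) * h (gauss_rotate a b (x, v)) \<partial>lborel) =
        ennreal ((1 / b) ^ ?d) * (\<integral>\<^sup>+u. ?K x u \<partial>lborel)"
      using ab by (subst nn_integral_lborel_affine[of _ "1 / b" "- (a / b) *\<^sub>R x"]) (auto simp: arg)
  qed
  also have "\<dots> = (\<integral>\<^sup>+x. \<integral>\<^sup>+u. ennreal ((1 / b) ^ ?d) * ?K x u \<partial>lborel \<partial>lborel)"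
    by (subst nn_integral_cmult) auto
  also have "\<dots> = (\<integral>\<^sup>+u. \<integral>\<^sup>+x. ennreal ((1 / b) ^ ?d) * ?K x u \<partial>lborel \<partial>lborel)"
    by (rule lborel_pair.Fubini'[symmetric]) measurable
  also have "\<dots> = (\<integral>\<^sup>+u. \<integral>\<^sup>+w. ennreal (gauss_dens u * gauss_dens w) * h (u, w) \<partial>lborel \<partial>lborel)"
  proof (rule nn_integral_cong)
    fix u :: "real ^ 'n"
    have K: "?K (a *\<^sub>R u + b *\<^sub>R w) u = ennreal (gauss_dens u * gauss_dens w) * h (u, w)" for w :: "real ^ 'n"
    proof -
      have 1: "- (a / b) *\<^sub>R (a *\<^sub>R u + b *\<^sub>R w) + (1 / b) *\<^sub>R u = b *\<^sub>R u - a *\<^sub>R w"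
      proof -
        have "1 / b - a * a / b = b" using ab b2 by (simp add: field_simps)
        then have "b *\<^sub>R u = (1 / b) *\<^sub>R u - (a * a / b) *\<^sub>R u" by (metis scaleR_left_diff_distrib)
        then show ?thesis using ab by (simp add: scaleR_right_distrib)
      qed
      have 2: "(1 / b) *\<^sub>R (a *\<^sub>R u + b *\<^sub>R w) - (a / b) *\<^sub>R u = w" using ab by (simp add: scaleR_right_distrib)
      show ?thesis unfolding 1 2 gauss_dens_rotate[OF ab(2)] ..
    qed
    have "(\<integral>\<^sup>+x. ennreal ((1 / b) ^ ?d) * ?K x u \<partial>lborel) =
        ennreal (b ^ ?d) * (\<integral>\<^sup>+w. ennreal ((1 / b) ^ ?d) * ?K (a *\<^sub>R u + b *\<^sub>R w) u \<partial>lborel)"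
      using ab by (subst nn_integral_lborel_affine[of _ b "a *\<^sub>R u"]) auto
    also have "\<dots> = (\<integral>\<^sup>+w. ennreal (b ^ ?d) * (ennreal ((1 / b) ^ ?d) * ?K (a *\<^sub>R u + b *\<^sub>R w) u) \<partial>lborel)"
      by (subst nn_integral_cmult) auto
    also have "\<dots> = (\<integral>\<^sup>+w. ennreal (gauss_dens u * gauss_dens w) * h (u, w) \<partial>lborel)"
      unfolding K mult.assoc[symmetric] using ab
      by (simp add: ennreal_mult[symmetric] power_mult_distrib[symmetric])
    finally show "(\<integral>\<^sup>+x. ennreal ((1 / b) ^ ?d) * ?K x u \<partial>lborel) =
        (\<integral>\<^sup>+w. ennreal (gauss_dens u * gauss_dens w) * h (u, w) \<partial>lborel)" .
  qed
  also have "\<dots> = (\<integral>\<^sup>+p. h p \<partial>?G2)"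
    by (rule nn_integral_std_gaussian_pair[symmetric]) measurable
  also have "\<dots> = emeasure ?G2 X" using X by (simp add: h_def)
  finally show "emeasure (distr ?G2 ?G2 (gauss_rotate a b)) X = emeasure ?G2 X" .
qed simp

text \<open>The density is a mixture over n of Cameron-Martin factors. Completing the square bounds
  each exponent by half the squared norm of z, so the mixture is finite and has the stated bound
  whatever the moments of \<nu>.\<close>

lemma std_gaussian_convolution:
  fixes \<nu> :: "(real ^ 'n) measure"
  assumes "prob_space \<nu>" and sets\<nu>[measurable_cong]: "sets \<nu> = sets borel"
  defines "\<kappa> \<equiv> \<lambda>z. \<integral>n. exp (n \<bullet> z - (norm n)\<^sup>2 / 2) \<partial>\<nu>"
  shows "\<nu> \<star> std_gaussian = density std_gaussian \<kappa>"
    and "\<kappa> \<in> borel_measurable borel"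
    and "integrable \<nu> (\<lambda>n. exp (n \<bullet> z - (norm n)\<^sup>2 / 2))"
    and "0 < \<kappa> z"
    and "\<kappa> z \<le> exp ((norm z)\<^sup>2 / 2)"
    and "(\<integral>\<^sup>+n. ennreal (gauss_dens (z - n)) \<partial>\<nu>) = ennreal (gauss_dens z * \<kappa> z)"
proof -
  interpret \<nu>: prob_space \<nu> by fact
  have le: "exp (n \<bullet> z - (norm n)\<^sup>2 / 2) \<le> exp ((norm z)\<^sup>2 / 2)" for n z :: "real ^ 'n"
  proof -
    have "0 \<le> (norm (z - n))\<^sup>2" by simp
    also have "\<dots> = (norm z)\<^sup>2 + (norm n)\<^sup>2 - 2 * (n \<bullet> z)"
      by (simp add: power2_norm_eq_inner algebra_simps inner_commute)
    finally show ?thesis by simp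
  qed
  have int: "integrable \<nu> (\<lambda>n. exp (n \<bullet> z - (norm n)\<^sup>2 / 2))" for z
    using le by (intro \<nu>.integrable_const_bound[where B = "exp ((norm z)\<^sup>2 / 2)"]) auto
  then show "integrable \<nu> (\<lambda>n. exp (n \<bullet> z - (norm n)\<^sup>2 / 2))" .
  have pos: "0 < \<kappa> z" for z
    unfolding \<kappa>_def using \<nu>.emeasure_space_1
    by (intro \<nu>.expectation_greater int) auto
  then show "0 < \<kappa> z" .
  show "\<kappa> z \<le> exp ((norm z)\<^sup>2 / 2)"
    unfolding \<kappa>_def by (rule \<nu>.integral_le_const[OF int]) (use le in auto)
  show km[measurable]: "\<kappa> \<in> borel_measurable borel"
    unfolding \<kappa>_def by (rule \<nu>.borel_measurable_lebesgue_integral) measurable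
  have mix: "(\<integral>\<^sup>+n. ennreal (gauss_dens (z - n)) \<partial>\<nu>) = ennreal (gauss_dens z * \<kappa> z)" for z
  proof -
    have "(\<integral>\<^sup>+n. ennreal (gauss_dens (z - n)) \<partial>\<nu>) = (\<integral>\<^sup>+n. ennreal (gauss_dens z) * ennreal (exp (n \<bullet> z - (norm n)\<^sup>2 / 2)) \<partial>\<nu>)"
      unfolding gauss_dens_shift by (simp add: ennreal_mult)
    also have "\<dots> = ennreal (gauss_dens z) * ennreal (\<kappa> z)"
      unfolding \<kappa>_def by (subst nn_integral_cmult) (auto simp: nn_integral_eq_integral[OF int])
    finally show ?thesis using pos by (simp add: ennreal_mult less_imp_le)
  qed
  then show "(\<integral>\<^sup>+n. ennreal (gauss_dens (z - n)) \<partial>\<nu>) = ennreal (gauss_dens z * \<kappa> z)" .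
  interpret NG: pair_sigma_finite \<nu> lborel ..
  show "\<nu> \<star> std_gaussian = density std_gaussian \<kappa>"
  proof (rule measure_eqI)
    show "sets (\<nu> \<star> std_gaussian) = sets (density std_gaussian \<kappa>)" by simp
    fix A assume "A \<in> sets (\<nu> \<star> std_gaussian)"
    then have A[measurable]: "A \<in> sets borel" by simp
    have "emeasure (\<nu> \<star> std_gaussian) A = (\<integral>\<^sup>+n. \<integral>\<^sup>+y. indicator A (n + y) \<partial>std_gaussian \<partial>\<nu>)"
      by (rule convolution_emeasure') (auto simp: \<nu>.finite_measure_axioms std_gaussian.finite_measure_axioms sets\<nu>)
    also have "\<dots> = (\<integral>\<^sup>+n. \<integral>\<^sup>+z. ennreal (gauss_dens (z - n)) * indicator A z \<partial>lborel \<partial>\<nu>)"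
    proof (intro nn_integral_cong)
      fix n :: "real ^ 'n"
      have "(\<integral>\<^sup>+y. indicator A (n + y) \<partial>std_gaussian) = (\<integral>\<^sup>+y. ennreal (gauss_dens y) * indicator A (n + y) \<partial>lborel)"
        by (rule nn_integral_std_gaussian) measurable
      also have "\<dots> = (\<integral>\<^sup>+z. ennreal (gauss_dens (z - n)) * indicator A z \<partial>lborel)"
        by (subst nn_integral_lborel_affine[of _ 1 n]) (auto simp: add.commute)
      finally show "(\<integral>\<^sup>+y. indicator A (n + y) \<partial>std_gaussian) = (\<integral>\<^sup>+z. ennreal (gauss_dens (z - n)) * indicator A z \<partial>lborel)" .
    qed
    also have "\<dots> = (\<integral>\<^sup>+z. \<integral>\<^sup>+n. ennreal (gauss_dens (z - n)) * indicator A z \<partial>\<nu> \<partial>lborel)"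
      by (rule NG.Fubini'[symmetric]) measurable
    also have "\<dots> = (\<integral>\<^sup>+z. ennreal (gauss_dens z) * (ennreal (\<kappa> z) * indicator A z) \<partial>lborel)"
      using pos by (intro nn_integral_cong, subst nn_integral_multc)
        (auto simp: mix ennreal_mult less_imp_le mult.assoc)
    also have "\<dots> = (\<integral>\<^sup>+z. ennreal (\<kappa> z) * indicator A z \<partial>std_gaussian)"
      by (rule nn_integral_std_gaussian[symmetric]) measurable
    also have "\<dots> = emeasure (density std_gaussian \<kappa>) A"
      by (subst emeasure_density) auto
    finally show "emeasure (\<nu> \<star> std_gaussian) A = emeasure (density std_gaussian \<kappa>) A" .
  qed
qed

lemma std_gaussian_moments:
  shows "integrable (std_gaussian :: (real ^ 'n) measure) (\<lambda>x. (norm x)\<^sup>2)"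
    and "integrable (std_gaussian :: (real ^ 'n) measure) (\<lambda>x. x)"
    and "(\<integral>x. x \<partial>(std_gaussian :: (real ^ 'n) measure)) = 0"
proof -
  have coord: "distr std_gaussian std_normal_distribution (\<lambda>x :: real ^ 'n. x $ i) = std_normal_distribution" for i
  proof -
    have 1: "(\<lambda>x::real ^ 'n. \<lambda>i. x $ i) \<in> std_gaussian \<rightarrow>\<^sub>M PiM UNIV (\<lambda>_. std_normal_distribution)"
      by (rule measurable_PiM_single') (auto simp: space_PiM PiE_def cong: measurable_cong_sets)
    have 2: "(\<lambda>\<omega>. \<omega> i) \<in> PiM UNIV (\<lambda>_::'n. std_normal_distribution) \<rightarrow>\<^sub>M std_normal_distribution"
      by (rule measurable_component_singleton) simp
    have "distr (PiM UNIV (\<lambda>_::'n. std_normal_distribution)) std_normal_distribution (\<lambda>\<omega>. \<omega> i) = std_normal_distribution"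
      by (rule distr_PiM_component) (auto intro: std_normal.prob_space_axioms)
    then show ?thesis
      using distr_distr[OF 2 1] by (simp add: distr_std_gaussian_PiM comp_def)
  qed
  have m: "(\<lambda>x :: real ^ 'n. x $ i) \<in> std_gaussian \<rightarrow>\<^sub>M std_normal_distribution" for i
    by (simp cong: measurable_cong_sets)
  have sq: "integrable (std_gaussian :: (real ^ 'n) measure) (\<lambda>x. (x $ i)\<^sup>2)" for i
    using std_normal_moments(3) by (subst (asm) coord[of i, symmetric], subst (asm) integrable_distr_eq[OF m]) auto
  have mean: "(\<integral>x. x $ i \<partial>(std_gaussian :: (real ^ 'n) measure)) = 0" for i
    using std_normal_moments(4) by (subst (asm) coord[of i, symmetric], subst (asm) integral_distr[OF m]) auto
  show n2: "integrable (std_gaussian :: (real ^ 'n) measure) (\<lambda>x. (norm x)\<^sup>2)"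
    unfolding power2_norm_vec using sq by auto
  show n1: "integrable (std_gaussian :: (real ^ 'n) measure) (\<lambda>x. x)"
  proof (rule Bochner_Integration.integrable_bound)
    show "integrable (std_gaussian :: (real ^ 'n) measure) (\<lambda>x. 1 + (norm x)\<^sup>2)" using n2 by simp
    have "norm x \<le> 1 + (norm x)\<^sup>2" for x :: "real ^ 'n"
      by (metis add.commute less_add_one linear norm_ge_zero one_le_power order_trans less_imp_le power2_nonneg_ge_1_iff self_le_power zero_less_numeral add_increasing zero_le_power2)
    then show "AE x in std_gaussian. norm (x :: real ^ 'n) \<le> norm (1 + (norm x)\<^sup>2)" by simp
  qed simp
  show "(\<integral>x. x \<partial>(std_gaussian :: (real ^ 'n) measure)) = 0"
  proof (rule vec_eq_iff[THEN iffD2], intro allI)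
    fix i
    have "(\<integral>x. x \<partial>(std_gaussian :: (real ^ 'n) measure)) $ i = (\<integral>x. x $ i \<partial>(std_gaussian :: (real ^ 'n) measure))"
      using integral_bounded_linear[OF bounded_linear_vec_nth n1, of i] by simp
    then show "(\<integral>x. x \<partial>(std_gaussian :: (real ^ 'n) measure)) $ i = 0 $ i" using mean by simp
  qed
qed

section \<open>Gibbs' inequality and relative entropy\<close>

text \<open>The mean of \<open>w / k\<close> under \<open>P\<close> is at most the mass of
  \<open>w\<close>, so \<open>ln t \<le> t - 1\<close> with \<open>t = w / k\<close> integrates to
  the claim. In the equality case the nonnegative gap \<open>t - 1 - ln t\<close> has integral 0,
  and it vanishes only at \<open>t = 1\<close>.\<close>

lemma gibbs_inequality:
  fixes M :: "'a measure" and k w :: "'a \<Rightarrow> real"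
  defines "P \<equiv> density M k"
  assumes km[measurable]: "k \<in> borel_measurable M" and [measurable]: "w \<in> borel_measurable M"
    and P: "prob_space P" and nonneg: "\<And>x. 0 \<le> k x" "\<And>x. 0 \<le> w x"
    and w1: "(\<integral>\<^sup>+x. ennreal (w x) \<partial>M) \<le> 1"
    and wpos: "AE x in P. 0 < w x"
    and int: "integrable P (\<lambda>x. ln (k x))" "integrable P (\<lambda>x. ln (w x))"
  shows "(\<integral>x. ln (w x) \<partial>P) \<le> (\<integral>x. ln (k x) \<partial>P)"
    and "(\<integral>x. ln (k x) \<partial>P) \<le> (\<integral>x. ln (w x) \<partial>P) \<Longrightarrow> AE x in P. w x = k x"
proof -
  interpret P: prob_space P by fact
  define t where "t x = w x / k x" for x
  have kpos: "AE x in P. 0 < k x" unfolding P_def by (rule AE_density_pos) fact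
  have [measurable]: "t \<in> borel_measurable M" "t \<in> borel_measurable P" unfolding t_def P_def by measurable
  have t0: "0 \<le> t x" for x by (simp add: t_def nonneg)
  have "(\<integral>\<^sup>+x. ennreal (t x) \<partial>P) = (\<integral>\<^sup>+x. ennreal (k x) * ennreal (t x) \<partial>M)"
    unfolding P_def by (subst nn_integral_density) auto
  also have "\<dots> \<le> (\<integral>\<^sup>+x. ennreal (w x) \<partial>M)"
  proof (rule nn_integral_mono)
    fix x show "ennreal (k x) * ennreal (t x) \<le> ennreal (w x)"
      using nonneg by (cases "k x = 0") (auto simp: t_def ennreal_mult[symmetric])
  qed
  finally have t1: "(\<integral>\<^sup>+x. ennreal (t x) \<partial>P) \<le> 1" using w1 by (rule order_trans)
  have it: "integrable P t"
    using t1 t0 by (intro integrableI_nonneg) (auto intro: le_less_trans)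
  have t_le: "(\<integral>x. t x \<partial>P) \<le> 1"
    using t1 t0 by (simp add: nn_integral_eq_integral[OF it])
  have ln_t: "AE x in P. 0 < t x \<and> ln (w x) - ln (k x) = ln (t x)"
    using kpos wpos by eventually_elim (auto simp: t_def intro: ln_divide_pos[symmetric])
  then have le: "AE x in P. ln (w x) - ln (k x) \<le> t x - 1"
    by eventually_elim (auto intro: ln_le_minus_one)
  have "(\<integral>x. ln (w x) - ln (k x) \<partial>P) \<le> (\<integral>x. t x - 1 \<partial>P)"
    using int it le by (intro integral_mono_AE) auto
  then show "(\<integral>x. ln (w x) \<partial>P) \<le> (\<integral>x. ln (k x) \<partial>P)"
    using int it t_le P.prob_space by simp
  assume eq: "(\<integral>x. ln (k x) \<partial>P) \<le> (\<integral>x. ln (w x) \<partial>P)"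
  let ?g = "\<lambda>x. (t x - 1) - (ln (w x) - ln (k x))"
  have ig: "integrable P ?g" using int it by auto
  have "(\<integral>x. ?g x \<partial>P) \<le> 0" using int it eq t_le P.prob_space by simp
  moreover have g0: "AE x in P. 0 \<le> ?g x" using le by eventually_elim simp
  ultimately have "(\<integral>x. ?g x \<partial>P) = 0" using integral_nonneg_AE[OF g0] by linarith
  then have "AE x in P. ?g x = 0" using integral_nonneg_eq_0_iff_AE[OF ig g0] by simp
  then show "AE x in P. w x = k x"
    using ln_t kpos
  proof eventually_elim
    case (elim x)
    then have "t x = 1" by (intro ln_eq_minus_one) auto
    then show ?case using elim by (simp add: t_def)
  qed
qed

text \<open>Integrability of \<open>ln h\<close> makes both parts in the definition finite, so their
  difference is an ordinary integral.\<close>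

lemma relative_entropy_density:
  fixes h :: "'a \<Rightarrow> real"
  assumes R: "prob_space R" and hm[measurable]: "h \<in> borel_measurable R" and h0: "\<And>x. 0 \<le> h x"
    and int: "integrable (density R h) (\<lambda>x. ln (h x))"
  shows "relative_entropy (density R h) R = ereal (\<integral>x. ln (h x) \<partial>density R h)"
proof -
  interpret R: prob_space R by fact
  let ?M = "density R h"
  have ac: "absolutely_continuous R ?M"
    by (rule absolutely_continuousI_density) simp
  have "AE x in R. ennreal (h x) = RN_deriv R ?M x"
    by (rule R.RN_deriv_unique) auto
  then have rn: "AE x in ?M. ennreal (h x) = RN_deriv R ?M x"
    by (subst AE_density) auto
  then have rn: "AE x in ?M. enn2real (RN_deriv R ?M x) = h x"
    by eventually_elim (metis enn2real_ennreal h0)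
  have 1: "(\<integral>\<^sup>+x. ennreal (ln (enn2real (RN_deriv R ?M x))) \<partial>?M) = (\<integral>\<^sup>+x. ennreal (ln (h x)) \<partial>?M)"
    using rn by (intro nn_integral_cong_AE, eventually_elim) simp
  have 2: "(\<integral>\<^sup>+x. ennreal (- ln (enn2real (RN_deriv R ?M x))) \<partial>?M) = (\<integral>\<^sup>+x. ennreal (- ln (h x)) \<partial>?M)"
    using rn by (intro nn_integral_cong_AE, eventually_elim) simp
  have fin: "(\<integral>\<^sup>+x. ennreal (ln (h x)) \<partial>?M) \<noteq> \<infinity>" "(\<integral>\<^sup>+x. ennreal (- ln (h x)) \<partial>?M) \<noteq> \<infinity>"
    using int by (auto simp: real_integrable_def)
  then obtain p q where pq: "(\<integral>\<^sup>+x. ennreal (ln (h x)) \<partial>?M) = ennreal p" "0 \<le> p"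
      "(\<integral>\<^sup>+x. ennreal (- ln (h x)) \<partial>?M) = ennreal q" "0 \<le> q"
    by (cases "\<integral>\<^sup>+x. ennreal (ln (h x)) \<partial>?M"; cases "\<integral>\<^sup>+x. ennreal (- ln (h x)) \<partial>?M") auto
  show ?thesis
    unfolding relative_entropy_def 1 2 real_lebesgue_integral_def[OF int] pq(1,3)
    using ac pq(2,4) by (simp add: enn2ereal_ennreal)
qed

text \<open>The negative part is always finite, since \<open>h * (- ln h) \<le> 1\<close> pointwise.
  Finite entropy therefore forces the positive part to be finite, and \<open>ln h\<close> is
  integrable.\<close>

lemma relative_entropy_finiteE:
  fixes \<mu> R :: "'a measure"
  assumes R: "prob_space R" and \<mu>: "prob_space \<mu>" and sets: "sets \<mu> = sets R"
    and fin: "relative_entropy \<mu> R \<noteq> \<infinity>"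
  obtains h :: "'a \<Rightarrow> real" where "h \<in> borel_measurable R" "\<And>x. 0 \<le> h x" "\<mu> = density R h"
    "integrable \<mu> (\<lambda>x. ln (h x))" "relative_entropy \<mu> R = ereal (\<integral>x. ln (h x) \<partial>\<mu>)"
proof -
  interpret R: prob_space R by fact
  interpret \<mu>: prob_space \<mu> by fact
  have ac: "absolutely_continuous R \<mu>" using fin unfolding relative_entropy_def by (auto split: if_splits)
  define h where "h x = enn2real (RN_deriv R \<mu> x)" for x
  have hm[measurable]: "h \<in> borel_measurable R" unfolding h_def by measurable
  have h0: "0 \<le> h x" for x by (simp add: h_def)
  have "AE x in R. RN_deriv R \<mu> x \<noteq> \<infinity>"
    by (rule R.RN_deriv_finite) (use ac sets \<mu>.sigma_finite_measure_axioms in auto)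
  then have "AE x in R. ennreal (h x) = RN_deriv R \<mu> x"
    by eventually_elim (simp add: h_def less_top)
  then have "density R h = density R (RN_deriv R \<mu>)" by (intro density_cong) auto
  also have "\<dots> = \<mu>" by (rule R.density_RN_deriv[OF ac sets])
  finally have \<mu>_eq: "\<mu> = density R h" by simp
  have neg: "(\<integral>\<^sup>+x. ennreal (- ln (h x)) \<partial>\<mu>) \<le> 1"
  proof -
    have "(\<integral>\<^sup>+x. ennreal (- ln (h x)) \<partial>\<mu>) = (\<integral>\<^sup>+x. ennreal (h x) * ennreal (- ln (h x)) \<partial>R)"
      unfolding \<mu>_eq by (subst nn_integral_density) auto
    also have "\<dots> \<le> (\<integral>\<^sup>+x. 1 \<partial>R)"
    proof (rule nn_integral_mono)
      fix x show "ennreal (h x) * ennreal (- ln (h x)) \<le> 1"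
      proof (cases "h x = 0")
        case False
        then have p: "0 < h x" using h0[of x] by simp
        have "ln (1 / h x) \<le> 1 / h x - 1" using p by (intro ln_le_minus_one) simp
        then have "- ln (h x) \<le> 1 / h x" using p by (simp add: ln_div)
        then have "h x * - ln (h x) \<le> 1" using p by (simp add: field_simps)
        then show ?thesis using h0[of x] by (simp add: ennreal_mult'[symmetric] ennreal_le_1)
      qed simp
    qed
    finally show ?thesis by (simp add: R.emeasure_space_1)
  qed
  have "(\<integral>\<^sup>+x. ennreal (ln (h x)) \<partial>\<mu>) \<noteq> \<infinity>"
  proof
    assume top: "(\<integral>\<^sup>+x. ennreal (ln (h x)) \<partial>\<mu>) = \<infinity>"
    have "(\<integral>\<^sup>+x. ennreal (- ln (h x)) \<partial>\<mu>) \<noteq> \<infinity>"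
      using neg by (metis ennreal_one_less_top infinity_ennreal_def leD)
    then have "relative_entropy \<mu> R = \<infinity>"
      using ac top unfolding relative_entropy_def h_def
      by (cases "\<integral>\<^sup>+x. ennreal (- ln (enn2real (RN_deriv R \<mu> x))) \<partial>\<mu>") auto
    then show False using fin by simp
  qed
  moreover have "(\<integral>\<^sup>+x. ennreal (- ln (h x)) \<partial>\<mu>) \<noteq> \<infinity>"
    using neg by (metis ennreal_one_less_top infinity_ennreal_def leD)
  moreover have "(\<lambda>x. ln (h x)) \<in> borel_measurable \<mu>" unfolding \<mu>_eq by measurable
  ultimately have int: "integrable \<mu> (\<lambda>x. ln (h x))" by (simp add: real_integrable_def)
  have "relative_entropy \<mu> R = ereal (\<integral>x. ln (h x) \<partial>\<mu>)"
    using relative_entropy_density[OF R hm h0] int unfolding \<mu>_eq[symmetric] by simp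
  with that[OF hm h0 \<mu>_eq int] show ?thesis by blast
qed

text \<open>One coupling of finite cost makes the infimum a real number, after which the square
  undoes the root in the definition.\<close>

lemma wasserstein2_le:
  assumes \<pi>: "\<pi> \<in> couplings \<mu> \<nu>" and c: "0 \<le> c"
    and le: "(\<integral>\<^sup>+(x, y). ennreal ((norm (x - y))\<^sup>2) \<partial>\<pi>) \<le> ennreal c"
  obtains r where "(wasserstein2 \<mu> \<nu>)\<^sup>2 = ereal r" "0 \<le> r" "r \<le> c"
proof -
  let ?I = "INF \<pi>\<in>couplings \<mu> \<nu>. \<integral>\<^sup>+(x, y). ennreal ((norm (x - y))\<^sup>2) \<partial>\<pi>"
  have I: "?I \<le> ennreal c" using INF_lower[OF \<pi>] le by (rule order_trans)
  then obtain r where r: "?I = ennreal r" "0 \<le> r"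
    by (cases ?I) (auto simp: top_unique)
  have "r \<le> c" using I r c by simp
  moreover have "(wasserstein2 \<mu> \<nu>)\<^sup>2 = ereal r"
    unfolding wasserstein2_def r(1) epowr_def using r(2)
    by (simp add: powr_half_sqrt)
  ultimately show ?thesis using that r by blast
qed

section \<open>Splitting a Gaussian vector\<close>

text \<open>The family version over a one-point parameter space.\<close>

lemma talagrand_transport_std_gaussian:
  fixes f :: "real ^ 'n \<Rightarrow> real"
  assumes fm[measurable]: "f \<in> borel_measurable borel" and nonneg: "\<And>x. 0 \<le> f x"
    and one: "(\<integral>\<^sup>+x. ennreal (f x) \<partial>std_gaussian) = 1"
    and ent: "integrable std_gaussian (\<lambda>x. f x * ln (f x))"
    and mom: "integrable std_gaussian (\<lambda>x. f x * (norm x)\<^sup>2)"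
  obtains S where "S \<in> borel \<rightarrow>\<^sub>M borel"
    "distr (density std_gaussian f) std_gaussian S = std_gaussian"
    "integrable (density std_gaussian f) (\<lambda>x. (norm (x - S x))\<^sup>2)"
    "(\<integral>x. (norm (x - S x))\<^sup>2 \<partial>density std_gaussian f) \<le> 2 * (\<integral>x. f x * ln (f x) \<partial>std_gaussian)"
proof -
  let ?Q = "return (count_space UNIV) () :: unit measure" and ?G = "std_gaussian :: (real ^ 'n) measure"
  let ?QG = "?Q \<Otimes>\<^sub>M ?G"
  interpret Q: prob_space ?Q by (rule prob_space_return) simp
  define \<psi> :: "real ^ 'n \<Rightarrow> unit \<times> (real ^ 'n)" where "\<psi> y = ((), y)" for y
  have \<psi>[measurable]: "\<psi> \<in> ?G \<rightarrow>\<^sub>M ?QG" unfolding \<psi>_def by measurable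
  have QG: "distr ?G ?QG \<psi> = ?QG"
  proof (rule pair_measure_eqI[symmetric])
    show "sigma_finite_measure ?Q" "sigma_finite_measure ?G" by unfold_locales
    fix A B assume A: "A \<in> sets ?Q" and B: "B \<in> sets ?G"
    have "\<psi> -` (A \<times> B) = (if () \<in> A then B else {})" by (auto simp: \<psi>_def)
    then have "emeasure (distr ?G ?QG \<psi>) (A \<times> B) = emeasure ?G (if () \<in> A then B else {})"
      using A B by (subst emeasure_distr) auto
    then show "emeasure ?Q A * emeasure ?G B = emeasure (distr ?G ?QG \<psi>) (A \<times> B)"
      using A by (auto simp: emeasure_return)
  qed simp
  let ?f = "\<lambda>p :: unit \<times> (real ^ 'n). f (snd p)"
  let ?\<mu> = "density ?G f" and ?P = "density ?QG (\<lambda>p. f (snd p))"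
  have fm': "?f \<in> borel_measurable ?QG" by measurable
  have D: "distr ?\<mu> ?QG \<psi> = ?P"
    using density_distr[of ?f "?QG" \<psi> ?G] fm' by (simp add: QG \<psi>_def)
  have \<psi>': "\<psi> \<in> ?\<mu> \<rightarrow>\<^sub>M ?QG" by measurable
  have ent': "integrable ?QG (\<lambda>p. ?f p * ln (?f p))"
    "(\<integral>p. ?f p * ln (?f p) \<partial>?QG) = (\<integral>x. f x * ln (f x) \<partial>?G)"
    using ent integrable_distr_eq[OF \<psi>, of "\<lambda>p. ?f p * ln (?f p)"] integral_distr[OF \<psi>, of "\<lambda>p. ?f p * ln (?f p)"] fm'
    by (simp_all add: QG \<psi>_def)
  have mom': "integrable ?QG (\<lambda>p. ?f p * (norm (snd p))\<^sup>2)"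
    using mom integrable_distr_eq[OF \<psi>, of "\<lambda>p. ?f p * (norm (snd p))\<^sup>2"] fm'
    by (simp add: QG \<psi>_def)
  obtain S where S[measurable]: "S \<in> ?QG \<rightarrow>\<^sub>M ?G"
    and law: "distr ?P ?QG (\<lambda>p. (fst p, S p)) = ?QG"
    and int: "integrable ?P (\<lambda>p. (norm (snd p - S p))\<^sup>2)"
    and le: "(\<integral>p. (norm (snd p - S p))\<^sup>2 \<partial>?P) \<le> 2 * (\<integral>p. ?f p * ln (?f p) \<partial>?QG)"
    using talagrand_familyE[OF talagrand_family_std_gaussian[OF Q.prob_space_axioms] fm' _ _ ent'(1) mom'] nonneg one
    by auto
  have [measurable]: "S \<in> borel_measurable ?QG" using S by (simp cong: measurable_cong_sets)
  have Sm: "(\<lambda>y. S (\<psi> y)) \<in> borel_measurable ?G" by measurable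
  have "distr ?\<mu> ?G (\<lambda>y. S (\<psi> y)) = distr (distr (distr ?\<mu> ?QG \<psi>) ?QG (\<lambda>p. (fst p, S p))) ?G snd"
    by (subst distr_distr, simp, simp)+ (simp add: comp_def)
  also have "\<dots> = distr (distr ?G ?QG \<psi>) ?G snd" unfolding D law QG ..
  also have "\<dots> = ?G" by (subst distr_distr) (auto simp: comp_def \<psi>_def distr_id2)
  finally have 1: "distr ?\<mu> ?G (\<lambda>y. S (\<psi> y)) = ?G" .
  have 2: "integrable ?\<mu> (\<lambda>x. (norm (x - S (\<psi> x)))\<^sup>2)"
    "(\<integral>p. (norm (snd p - S p))\<^sup>2 \<partial>?P) = (\<integral>x. (norm (x - S (\<psi> x)))\<^sup>2 \<partial>?\<mu>)"
    using int integrable_distr_eq[OF \<psi>', of "\<lambda>p. (norm (snd p - S p))\<^sup>2"] integral_distr[OF \<psi>', of "\<lambda>p. (norm (snd p - S p))\<^sup>2"]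
    by (simp_all add: D) (simp_all add: \<psi>_def)
  show ?thesis
    by (rule that[of "\<lambda>y. S (\<psi> y)"]) (use Sm 1 2 le ent'(2) in \<open>auto cong: measurable_cong_sets\<close>)
qed

lemma integrable_inner:
  fixes g h :: "'a \<Rightarrow> real ^ 'n"
  assumes [measurable]: "g \<in> borel_measurable M" "h \<in> borel_measurable M"
    and "integrable M (\<lambda>x. (norm (g x))\<^sup>2)" "integrable M (\<lambda>x. (norm (h x))\<^sup>2)"
  shows "integrable M (\<lambda>x. g x \<bullet> h x)"
proof (rule Bochner_Integration.integrable_bound)
  show "integrable M (\<lambda>x. (norm (g x))\<^sup>2 + (norm (h x))\<^sup>2)" using assms by auto
  show "AE x in M. norm (g x \<bullet> h x) \<le> norm ((norm (g x))\<^sup>2 + (norm (h x))\<^sup>2)"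
  proof (rule AE_I2)
    fix x
    have "\<bar>g x \<bullet> h x\<bar> \<le> norm (g x) * norm (h x)" by (rule Cauchy_Schwarz_ineq2)
    moreover have "0 \<le> (norm (g x) - norm (h x))\<^sup>2" by simp
    then have "2 * (norm (g x) * norm (h x)) \<le> (norm (g x))\<^sup>2 + (norm (h x))\<^sup>2"
      by (simp add: power2_eq_square algebra_simps)
    moreover have "0 \<le> norm (g x) * norm (h x)" by simp
    ultimately have "\<bar>g x \<bullet> h x\<bar> \<le> (norm (g x))\<^sup>2 + (norm (h x))\<^sup>2" by linarith
    then show "norm (g x \<bullet> h x) \<le> norm ((norm (g x))\<^sup>2 + (norm (h x))\<^sup>2)" by simp
  qed
qed measurable

lemma integrable_of_square:
  fixes g :: "'a \<Rightarrow> real ^ 'n"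
  assumes "prob_space M" and [measurable]: "g \<in> borel_measurable M" and int: "integrable M (\<lambda>x. (norm (g x))\<^sup>2)"
  shows "integrable M g"
proof (rule Bochner_Integration.integrable_bound)
  interpret prob_space M by fact
  show "integrable M (\<lambda>x. 1 + (norm (g x))\<^sup>2)" using int by auto
  show "AE x in M. norm (g x) \<le> norm (1 + (norm (g x))\<^sup>2)"
  proof (rule AE_I2)
    fix x
    have "0 \<le> (norm (g x) - 1)\<^sup>2" by simp
    then have "2 * norm (g x) \<le> 1 + (norm (g x))\<^sup>2" by (simp add: power2_eq_square algebra_simps)
    moreover have "0 \<le> norm (g x)" by simp
    ultimately have "norm (g x) \<le> 1 + (norm (g x))\<^sup>2" by linarith
    then show "norm (g x) \<le> norm (1 + (norm (g x))\<^sup>2)" by simp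
  qed
qed measurable

text \<open>Below, the coordinates \<open>fst\<close> and \<open>snd\<close> under \<open>P\<close>
  are the vectors g and h of the overview, weighted by \<open>f (W p)\<close>. Accordingly
  \<open>M'\<close> is the law of g and \<open>k\<close> the conditional density of h given g,
  relative to \<gamma>.\<close>

locale gaussian_split =
  fixes f :: "real ^ 'n \<Rightarrow> real" and a b :: real
  assumes dens_meas[measurable]: "f \<in> borel_measurable borel" and dens_nonneg: "\<And>x. 0 \<le> f x"
    and dens_one: "(\<integral>\<^sup>+x. ennreal (f x) \<partial>std_gaussian) = 1"
    and ent: "integrable std_gaussian (\<lambda>x. f x * ln (f x))"
    and mom: "integrable std_gaussian (\<lambda>x. f x * (norm x)\<^sup>2)"
    and a: "0 < a" and b: "0 < b" and ab: "a\<^sup>2 + b\<^sup>2 = 1"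
begin

abbreviation "\<gamma> \<equiv> std_gaussian :: (real ^ 'n) measure"

definition W :: "(real ^ 'n) \<times> (real ^ 'n) \<Rightarrow> real ^ 'n" where
  "W p = a *\<^sub>R fst p + b *\<^sub>R snd p"

lemma sets_pair: "sets (\<gamma> \<Otimes>\<^sub>M \<gamma>) = sets (borel \<Otimes>\<^sub>M borel)"
  by (intro sets_pair_measure_cong) auto

lemma measurable_W_borel[measurable]: "W \<in> borel \<Otimes>\<^sub>M borel \<rightarrow>\<^sub>M borel"
  unfolding W_def by measurable

lemma measurable_W[measurable]: "W \<in> \<gamma> \<Otimes>\<^sub>M \<gamma> \<rightarrow>\<^sub>M \<gamma>"
  using measurable_W_borel by (simp cong: measurable_cong_sets add: sets_pair)

lemma measurable_W'[measurable]: "W \<in> \<gamma> \<Otimes>\<^sub>M \<gamma> \<rightarrow>\<^sub>M borel"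
  using measurable_W_borel by (simp cong: measurable_cong_sets add: sets_pair)

lemma distr_W: "distr (\<gamma> \<Otimes>\<^sub>M \<gamma>) \<gamma> W = \<gamma>"
proof -
  have "distr (\<gamma> \<Otimes>\<^sub>M \<gamma>) \<gamma> W = distr (distr (\<gamma> \<Otimes>\<^sub>M \<gamma>) (\<gamma> \<Otimes>\<^sub>M \<gamma>) (gauss_rotate a b)) \<gamma> fst"
    by (subst distr_distr) (auto simp: comp_def W_def[abs_def] gauss_rotate_def)
  also have "\<dots> = \<gamma>" unfolding distr_gauss_rotate[OF b ab] by (rule std_gaussian.distr_pair_fst)
  finally show ?thesis .
qed

lemma F_one: "(\<integral>\<^sup>+p. ennreal (f (W p)) \<partial>(\<gamma> \<Otimes>\<^sub>M \<gamma>)) = 1"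
  using dens_one by (subst (asm) distr_W[symmetric], subst (asm) nn_integral_distr) auto

sublocale pair_density \<gamma> \<gamma> "\<lambda>p. f (W p)"
  by unfold_locales (auto simp: F_one dens_nonneg)

lemma sets_M'_pair: "sets M'G = sets (borel \<Otimes>\<^sub>M borel)"
  by (intro sets_pair_measure_cong) auto

lemma k_meas_borel[measurable]: "k \<in> borel_measurable (borel \<Otimes>\<^sub>M borel)"
  using k_meas by (simp cong: measurable_cong_sets add: sets_pair)

lemma law_W: "distr P \<gamma> W = density \<gamma> f"
  using density_distr[of f \<gamma> W "MG"] by (simp add: distr_W)

lemma integrable_W_iff:
  fixes g :: "real ^ 'n \<Rightarrow> 'c :: {banach, second_countable_topology}"
  assumes [measurable]: "g \<in> borel_measurable borel"
  shows "integrable P (\<lambda>p. g (W p)) \<longleftrightarrow> integrable (density \<gamma> f) g"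
    and "(\<integral>p. g (W p) \<partial>P) = (\<integral>x. g x \<partial>density \<gamma> f)"
proof -
  have "W \<in> P \<rightarrow>\<^sub>M \<gamma>" by measurable
  from integrable_distr_eq[OF this, of g] integral_distr[OF this, of g]
  show "integrable P (\<lambda>p. g (W p)) \<longleftrightarrow> integrable (density \<gamma> f) g"
    and "(\<integral>p. g (W p) \<partial>P) = (\<integral>x. g x \<partial>density \<gamma> f)" by (simp_all add: law_W)
qed

lemma ent_F: "integrable MG (\<lambda>p. f (W p) * ln (f (W p)))"
  "(\<integral>p. f (W p) * ln (f (W p)) \<partial>MG) = (\<integral>x. f x * ln (f x) \<partial>\<gamma>)"
  using ent integrable_distr_eq[OF measurable_W, of "\<lambda>x. f x * ln (f x)"]
    integral_distr[OF measurable_W, of "\<lambda>x. f x * ln (f x)"] by (simp_all add: distr_W)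

lemmas chain = entropy_chain_rule[OF ent_F(1)]

lemma mom_W: "integrable P (\<lambda>p. (norm (W p))\<^sup>2)"
  using mom by (subst integrable_W_iff, simp, subst integrable_density) (auto simp: dens_nonneg)

text \<open>Only the second moment of \<open>W\<close> is given. The orthogonal combination
  \<open>?V\<close> is the second component of the rotation, which the weight \<open>f (W p)\<close>
  does not touch, so it keeps its Gaussian second moment. The squared norms of \<open>W\<close> and
  \<open>?V\<close> add up to those of the two coordinates.\<close>

lemma mom_P: "integrable P (\<lambda>p. (norm (fst p))\<^sup>2)" "integrable P (\<lambda>p. (norm (snd p))\<^sup>2)"
proof -
  let ?V = "\<lambda>p :: (real ^ 'n) \<times> (real ^ 'n). b *\<^sub>R fst p - a *\<^sub>R snd p"
  have V: "integrable P (\<lambda>p. (norm (?V p))\<^sup>2)"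
  proof (rule integrableI_nonneg)
    let ?h = "\<lambda>p :: (real ^ 'n) \<times> (real ^ 'n). ennreal (f (fst p)) * ennreal ((norm (snd p))\<^sup>2)"
    have "(\<integral>\<^sup>+p. ennreal ((norm (?V p))\<^sup>2) \<partial>P) = (\<integral>\<^sup>+p. ?h (gauss_rotate a b p) \<partial>MG)"
      by (subst nn_integral_density) (auto simp: gauss_rotate_def W_def)
    also have "\<dots> = (\<integral>\<^sup>+p. ?h p \<partial>MG)"
    proof -
      have "(\<integral>\<^sup>+p. ?h p \<partial>distr MG MG (gauss_rotate a b))
          = (\<integral>\<^sup>+p. ?h (gauss_rotate a b p) \<partial>MG)"
        by (rule nn_integral_distr) auto
      then show ?thesis by (simp add: distr_gauss_rotate[OF b ab])
    qed
    also have "\<dots> = (\<integral>\<^sup>+x. \<integral>\<^sup>+v. ennreal (f x) * ennreal ((norm v)\<^sup>2) \<partial>\<gamma> \<partial>\<gamma>)"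
      by (subst std_gaussian.nn_integral_fst[symmetric]) auto
    also have "\<dots> = (\<integral>\<^sup>+v. ennreal ((norm v)\<^sup>2) \<partial>\<gamma>)"
      by (simp add: nn_integral_cmult nn_integral_multc dens_one)
    also have "\<dots> < \<infinity>"
      using std_gaussian_moments(1)[where 'n = 'n] by (simp add: nn_integral_eq_integral)
    finally show "(\<integral>\<^sup>+p. ennreal ((norm (?V p))\<^sup>2) \<partial>P) < \<infinity>" .
  qed auto
  have sum: "integrable P (\<lambda>p. (norm (W p))\<^sup>2 + (norm (?V p))\<^sup>2)" using mom_W V by auto
  have eq: "(norm (W p))\<^sup>2 + (norm (?V p))\<^sup>2 = (norm (fst p))\<^sup>2 + (norm (snd p))\<^sup>2" for p
  proof -
    have "(norm (W p))\<^sup>2 + (norm (?V p))\<^sup>2 = (a\<^sup>2 + b\<^sup>2) * ((norm (fst p))\<^sup>2 + (norm (snd p))\<^sup>2)"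
      unfolding W_def power2_norm_eq_inner unfolding power2_eq_square
      by (simp add: inner_simps inner_commute algebra_simps)
    then show ?thesis using ab by simp
  qed
  show "integrable P (\<lambda>p. (norm (fst p))\<^sup>2)" "integrable P (\<lambda>p. (norm (snd p))\<^sup>2)"
    by (rule Bochner_Integration.integrable_bound[OF sum[unfolded eq]]; simp)+
qed

definition \<eta> :: "real ^ 'n \<Rightarrow> real ^ 'n" where
  "\<eta> x = (\<integral>y. k (x, y) *\<^sub>R y \<partial>\<gamma>)"

lemma measurable_eta[measurable]: "\<eta> \<in> borel_measurable borel"
proof -
  have s: "sets (borel \<Otimes>\<^sub>M \<gamma>) = sets (borel \<Otimes>\<^sub>M borel)" by (rule sets_pair_measure_cong) auto
  have "(\<lambda>p. k p *\<^sub>R snd p) \<in> borel_measurable (borel \<Otimes>\<^sub>M \<gamma>)"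
    unfolding measurable_cong_sets[OF s refl] by measurable
  then have "(\<lambda>x. \<integral>y. k (x, y) *\<^sub>R y \<partial>\<gamma>) \<in> borel_measurable borel"
    by (intro std_gaussian.borel_measurable_lebesgue_integral) (simp add: case_prod_beta')
  then show ?thesis unfolding \<eta>_def[abs_def] .
qed

text \<open>Conditional Jensen, obtained by expanding the nonnegative conditional variance of
  \<open>snd\<close>.\<close>

lemma sq_eta: "integrable M' (\<lambda>x. (norm (\<eta> x))\<^sup>2)"
proof (rule Bochner_Integration.integrable_bound)
  note i2 = integral_P_k[OF mom_P(2)]
  note i1 = integral_P_k[OF integrable_of_square[OF prob_P _ mom_P(2)]]
  show "integrable M' (\<lambda>x. \<integral>y. k (x, y) *\<^sub>R (norm (snd (x, y)))\<^sup>2 \<partial>\<gamma>)"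
    using M'G.integrable_fst'[OF i2(1)] by simp
  have "AE x in M'. integrable \<gamma> (\<lambda>y. k (x, y) *\<^sub>R snd (x, y))" by (rule i1(3)) simp
  then show "AE x in M'. norm ((norm (\<eta> x))\<^sup>2) \<le> norm (\<integral>y. k (x, y) *\<^sub>R (norm (snd (x, y)))\<^sup>2 \<partial>\<gamma>)"
    using i2(3) AE_k_one'
  proof eventually_elim
    case (elim x)
    have [measurable]: "(\<lambda>y. k (x, y)) \<in> borel_measurable \<gamma>"
      using measurable_compose[OF measurable_Pair1'[of x borel] k_meas_borel] by (simp cong: measurable_cong_sets)
    have ik: "integrable \<gamma> (\<lambda>y. k (x, y))" using elim(3) k_nonneg by (intro integrableI_nonneg) auto
    have k1: "(\<integral>y. k (x, y) \<partial>\<gamma>) = 1"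
      using elim(3) k_nonneg by (simp add: nn_integral_eq_integral[OF ik])
    have ie: "integrable \<gamma> (\<lambda>y. \<eta> x \<bullet> (k (x, y) *\<^sub>R y))" using elim(1) by (intro integrable_inner_right) simp
    have "0 \<le> (\<integral>y. k (x, y) * (norm (y - \<eta> x))\<^sup>2 \<partial>\<gamma>)" by (intro integral_nonneg_AE AE_I2) (simp add: k_nonneg)
    also have "\<dots> = (\<integral>y. k (x, y) * (norm y)\<^sup>2 - 2 * (\<eta> x \<bullet> (k (x, y) *\<^sub>R y)) + k (x, y) * (norm (\<eta> x))\<^sup>2 \<partial>\<gamma>)"
      unfolding power2_norm_eq_inner
      by (intro Bochner_Integration.integral_cong refl) (simp add: inner_simps inner_commute algebra_simps)
    also have "\<dots> = (\<integral>y. k (x, y) * (norm y)\<^sup>2 \<partial>\<gamma>) - 2 * (\<eta> x \<bullet> \<eta> x) + (norm (\<eta> x))\<^sup>2"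
    proof -
      have "(\<integral>y. \<eta> x \<bullet> (k (x, y) *\<^sub>R y) \<partial>\<gamma>) = \<eta> x \<bullet> (\<integral>y. k (x, y) *\<^sub>R y \<partial>\<gamma>)"
        using elim(1) by (intro integral_inner_right) simp
      then show ?thesis
        using elim(2) ik ie k1 by (simp add: \<eta>_def[of x, symmetric] del: inner_scaleR_right)
    qed
    finally have "(norm (\<eta> x))\<^sup>2 \<le> (\<integral>y. k (x, y) * (norm y)\<^sup>2 \<partial>\<gamma>)" by (simp add: power2_norm_eq_inner)
    then show ?case by simp
  qed
qed measurable

lemma tower:
  fixes h :: "real ^ 'n \<Rightarrow> real ^ 'n"
  assumes [measurable]: "h \<in> borel_measurable borel" and h2: "integrable M' (\<lambda>x. (norm (h x))\<^sup>2)"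
  shows "integrable P (\<lambda>p. h (fst p) \<bullet> snd p)"
    and "(\<integral>p. h (fst p) \<bullet> snd p \<partial>P) = (\<integral>x. h x \<bullet> \<eta> x \<partial>M')"
proof -
  show i: "integrable P (\<lambda>p. h (fst p) \<bullet> snd p)"
    using h2 mom_P(2) integrable_P_fst(1)[of "\<lambda>x. (norm (h x))\<^sup>2"] by (intro integrable_inner) auto
  have "AE x in M'. integrable \<gamma> (\<lambda>y. k (x, y) *\<^sub>R snd (x, y))"
    by (rule integral_P_k(3)[OF integrable_of_square[OF prob_P _ mom_P(2)]]) simp
  then have "AE x in M'. (\<integral>y. k (x, y) *\<^sub>R (h (fst (x, y)) \<bullet> snd (x, y)) \<partial>\<gamma>) = h x \<bullet> \<eta> x"
  proof eventually_elim
    case (elim x)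
    have "(\<integral>y. h x \<bullet> (k (x, y) *\<^sub>R y) \<partial>\<gamma>) = h x \<bullet> \<eta> x"
      unfolding \<eta>_def using elim by (intro integral_inner_right) auto
    then show ?case by simp
  qed
  moreover have "(\<lambda>x. \<integral>y. k (x, y) *\<^sub>R (h (fst (x, y)) \<bullet> snd (x, y)) \<partial>\<gamma>) \<in> borel_measurable M'"
    using M'G.integrable_fst'[OF integral_P_k(1)[OF i]] by (rule borel_measurable_integrable)
  ultimately show "(\<integral>p. h (fst p) \<bullet> snd p \<partial>P) = (\<integral>x. h x \<bullet> \<eta> x \<partial>M')"
    unfolding integral_P_k(2)[OF i] by (intro integral_cong_AE) auto
qed

text \<open>\<open>D1\<close> is the mean relative entropy of the law of \<open>snd\<close> given \<open>fst\<close>, and \<open>\<eta>\<close> its mean, so that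
  \<open>D1 - E2 / 2\<close> is the entropy of the centred conditional law.\<close>

definition "D1 = (\<integral>p. ln (k p) \<partial>P)"
definition "E2 = (\<integral>x. (norm (\<eta> x))\<^sup>2 \<partial>M')"
definition "Y2 = (\<integral>p. (norm (snd p))\<^sup>2 \<partial>P)"

text \<open>Pythagoras: \<open>tower\<close> applied to \<eta> makes the residual orthogonal to the
  conditional mean.\<close>

lemma centered:
  shows "integrable P (\<lambda>p. (norm (snd p - \<eta> (fst p)))\<^sup>2)"
    and "(\<integral>p. (norm (snd p - \<eta> (fst p)))\<^sup>2 \<partial>P) = Y2 - E2"
proof -
  have eq: "(norm (snd p - \<eta> (fst p)))\<^sup>2 = (norm (snd p))\<^sup>2 - 2 * (\<eta> (fst p) \<bullet> snd p) + (norm (\<eta> (fst p)))\<^sup>2" for p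
    unfolding power2_norm_eq_inner by (simp add: inner_simps inner_commute algebra_simps)
  have e: "integrable P (\<lambda>p. (norm (\<eta> (fst p)))\<^sup>2)" "(\<integral>p. (norm (\<eta> (fst p)))\<^sup>2 \<partial>P) = E2"
    using sq_eta by (auto simp: integrable_P_fst[of "\<lambda>x. (norm (\<eta> x))\<^sup>2"] E2_def)
  note t = tower[OF measurable_eta sq_eta]
  show "integrable P (\<lambda>p. (norm (snd p - \<eta> (fst p)))\<^sup>2)"
    unfolding eq using mom_P(2) t(1) e(1) by auto
  have "(\<integral>x. \<eta> x \<bullet> \<eta> x \<partial>M') = E2" by (simp add: E2_def power2_norm_eq_inner)
  then show "(\<integral>p. (norm (snd p - \<eta> (fst p)))\<^sup>2 \<partial>P) = Y2 - E2"
    unfolding eq using mom_P(2) t e by (simp add: Y2_def)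
qed
end

context gaussian_split
begin

lemma ln_f_eq: "(\<integral>x. f x * ln (f x) \<partial>\<gamma>) = (\<integral>x. m x * ln (m x) \<partial>\<gamma>) + D1"
  using chain(5) ent_F(2) by (simp add: D1_def)

text \<open>The images \<open>S1 (fst p)\<close> and \<open>S2 p\<close> are independent standard
  Gaussians, so combining them with weights a and b gives a Gaussian \<open>Z\<close>, and the pair
  of \<open>W\<close> and \<open>Z\<close> is a coupling. Its cost splits into \<open>a^2\<close>
  times the first cost, \<open>b^2\<close> times the second, and a cross term that sees only
  \<eta>.\<close>

lemma exists_coupling:
  obtains \<pi> c where "\<pi> \<in> couplings (density \<gamma> f) \<gamma>"
    "(\<integral>\<^sup>+(x, y). ennreal ((norm (x - y))\<^sup>2) \<partial>\<pi>) = ennreal c" "0 \<le> c"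
    "c \<le> 2 * (\<integral>x. m x * ln (m x) \<partial>\<gamma>) + 2 * b\<^sup>2 * D1 + a\<^sup>2 * E2"
proof -
  have mb: "m \<in> borel_measurable borel" using m_meas by (simp cong: measurable_cong_sets)
  have m1: "(\<integral>\<^sup>+x. ennreal (m x) \<partial>\<gamma>) = 1"
    using M'.emeasure_space_1 by (simp add: emeasure_density)
  have "integrable M' (\<lambda>x. (norm x)\<^sup>2)"
    using mom_P(1) integrable_P_fst(1)[of "\<lambda>x. (norm x)\<^sup>2"] by simp
  then have momm: "integrable \<gamma> (\<lambda>x. m x * (norm x)\<^sup>2)"
    by (subst (asm) integrable_density) (auto simp: m_nonneg)
  obtain S1 where S1[measurable]: "S1 \<in> borel_measurable borel"
    and law1: "distr M' \<gamma> S1 = \<gamma>"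
    and int1: "integrable M' (\<lambda>x. (norm (x - S1 x))\<^sup>2)"
    and le1: "(\<integral>x. (norm (x - S1 x))\<^sup>2 \<partial>M') \<le> 2 * (\<integral>x. m x * ln (m x) \<partial>\<gamma>)"
    using talagrand_transport_std_gaussian[OF mb m_nonneg m1 chain(1) momm] by blast
  have km: "k \<in> borel_measurable M'G"
    using k_meas_borel by (simp cong: measurable_cong_sets add: sets_M'_pair)
  have momk: "integrable M'G (\<lambda>p. k p * (norm (snd p))\<^sup>2)"
    using integral_P_k(1)[OF mom_P(2)] by simp
  obtain S2 where S2': "S2 \<in> M'G \<rightarrow>\<^sub>M \<gamma>"
    and law2: "distr P M'G (\<lambda>p. (fst p, S2 p)) = M'G"
    and int2: "integrable P (\<lambda>p. (norm (snd p - S2 p))\<^sup>2)"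
    and le2: "(\<integral>p. (norm (snd p - S2 p))\<^sup>2 \<partial>P) \<le> 2 * (\<integral>p. k p * ln (k p) \<partial>M'G)"
    using talagrand_familyE[OF talagrand_family_std_gaussian[OF prob_M'] km k_nonneg AE_k_one' chain(2) momk, unfolded P_eq]
    by blast
  have S2b[measurable]: "S2 \<in> borel_measurable MG"
    using S2' by (simp cong: measurable_cong_sets add: sets_M'_pair sets_pair)
  have S2g[measurable]: "S2 \<in> MG \<rightarrow>\<^sub>M \<gamma>"
    using S2b by (simp cong: measurable_cong_sets)
  have S1g[measurable]: "S1 \<in> M' \<rightarrow>\<^sub>M \<gamma>" "S1 \<in> \<gamma> \<rightarrow>\<^sub>M \<gamma>"
    using S1 by (simp_all cong: measurable_cong_sets)
  have T2[measurable]: "(\<lambda>p. (fst p, S2 p)) \<in> P \<rightarrow>\<^sub>M M'G"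
  proof (rule measurable_Pair)
    show "fst \<in> P \<rightarrow>\<^sub>M M'" by measurable
    show "S2 \<in> P \<rightarrow>\<^sub>M \<gamma>" by measurable
  qed
  have T1[measurable]: "(\<lambda>(x, y). (S1 x, y)) \<in> M'G \<rightarrow>\<^sub>M MG" by measurable
  \<comment> \<open>Apply \<open>S2\<close> first: the new second coordinate is independent of
    \<open>fst\<close>, so \<open>S1\<close> can act on the first factor alone.\<close>
  have law: "distr P MG (\<lambda>p. (S1 (fst p), S2 p)) = MG"
  proof -
    have "distr P MG (\<lambda>p. (S1 (fst p), S2 p)) =
        distr (distr P M'G (\<lambda>p. (fst p, S2 p))) MG (\<lambda>(x, y). (S1 x, y))"
      using distr_distr[OF T1 T2] by (simp add: comp_def)
    also have "\<dots> = distr M'G MG (\<lambda>(x, y). (S1 x, y))" by (simp only: law2)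
    also have "\<dots> = distr M' \<gamma> S1 \<Otimes>\<^sub>M distr \<gamma> \<gamma> (\<lambda>y. y)"
    proof (rule pair_measure_distr[OF S1g(1), symmetric])
      show "(\<lambda>y. y) \<in> \<gamma> \<rightarrow>\<^sub>M \<gamma>" by simp
      show "sigma_finite_measure (distr \<gamma> \<gamma> (\<lambda>y. y))"
        using std_gaussian.sigma_finite_measure_axioms by (simp only: distr_id)
    qed
    also have "\<dots> = MG" by (simp only: law1 distr_id)
    finally show ?thesis .
  qed
  have Tm: "(\<lambda>p. (S1 (fst p), S2 p)) \<in> P \<rightarrow>\<^sub>M MG" by measurable
  define A where "A x = x - S1 x" for x
  have Am[measurable]: "A \<in> borel_measurable borel" unfolding A_def by measurable
  have intA: "integrable M' (\<lambda>x. (norm (A x))\<^sup>2)" using int1 by (simp add: A_def)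
  let ?A2 = "\<integral>x. (norm (A x))\<^sup>2 \<partial>M'"
  have intAP: "integrable P (\<lambda>p. (norm (A (fst p)))\<^sup>2)" "(\<integral>p. (norm (A (fst p)))\<^sup>2 \<partial>P) = ?A2"
  proof -
    have "(\<lambda>x. (norm (A x))\<^sup>2) \<in> borel_measurable \<gamma>" by measurable
    from integrable_P_fst[OF this] intA
    show "integrable P (\<lambda>p. (norm (A (fst p)))\<^sup>2)" "(\<integral>p. (norm (A (fst p)))\<^sup>2 \<partial>P) = ?A2"
      by blast+
  qed
  define Z where "Z p = W (S1 (fst p), S2 p)" for p
  have Zm: "Z \<in> P \<rightarrow>\<^sub>M \<gamma>" unfolding Z_def using measurable_compose[OF Tm measurable_W] .
  have Zb[measurable]: "Z \<in> borel_measurable MG" using Zm by (simp cong: measurable_cong_sets)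
  have lawZ: "distr P \<gamma> Z = \<gamma>"
    using distr_distr[OF measurable_W Tm] by (simp add: law distr_W Z_def[abs_def] comp_def)
  define \<pi> where "\<pi> = distr P borel (\<lambda>p. (W p, Z p))"
  have WZ[measurable]: "(\<lambda>p. (W p, Z p)) \<in> P \<rightarrow>\<^sub>M borel"
    unfolding borel_prod[symmetric] by measurable
  have fs: "fst \<in> borel \<rightarrow>\<^sub>M (borel :: (real ^ 'n) measure)" "snd \<in> borel \<rightarrow>\<^sub>M (borel :: (real ^ 'n) measure)"
    by (intro borel_measurable_continuous_onI continuous_intros)+
  have \<pi>: "\<pi> \<in> couplings (density \<gamma> f) \<gamma>"
    unfolding couplings_def
  proof (intro CollectI conjI)
    show "prob_space \<pi>" unfolding \<pi>_def by (rule P.prob_space_distr) measurable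
    show "sets \<pi> = sets borel" by (simp add: \<pi>_def)
    have "distr \<pi> borel fst = distr P borel W"
      unfolding \<pi>_def using distr_distr[OF fs(1) WZ] by (simp add: comp_def)
    also have "\<dots> = density \<gamma> f" using law_W by (metis distr_cong sets_std_gaussian)
    finally show "distr \<pi> borel fst = density \<gamma> f" .
    have "distr \<pi> borel snd = distr P borel Z"
      unfolding \<pi>_def using distr_distr[OF fs(2) WZ] by (simp add: comp_def)
    also have "\<dots> = \<gamma>" using lawZ by (metis distr_cong sets_std_gaussian)
    finally show "distr \<pi> borel snd = \<gamma>" .
  qed
  define B where "B p = snd p - S2 p" for p
  have Bm[measurable]: "B \<in> borel_measurable MG" unfolding B_def by measurable
  have WmZ: "W p - Z p = a *\<^sub>R A (fst p) + b *\<^sub>R B p" for p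
    by (simp add: W_def Z_def A_def B_def algebra_simps)
  have intB: "integrable P (\<lambda>p. (norm (B p))\<^sup>2)" using int2 by (simp add: B_def)
  let ?B2 = "\<integral>p. (norm (B p))\<^sup>2 \<partial>P"
  have S2sq: "integrable P (\<lambda>p. (norm (S2 p))\<^sup>2)"
  proof -
    have "integrable M'G (\<lambda>q. (norm (snd q))\<^sup>2)"
    proof (rule integrableI_nonneg)
      have "(\<integral>\<^sup>+q. ennreal ((norm (snd q))\<^sup>2) \<partial>M'G) = (\<integral>\<^sup>+x. \<integral>\<^sup>+y. ennreal ((norm y)\<^sup>2) \<partial>\<gamma> \<partial>M')"
        by (subst std_gaussian.nn_integral_fst[symmetric]) auto
      also have "\<dots> = (\<integral>\<^sup>+y. ennreal ((norm y)\<^sup>2) \<partial>\<gamma>)"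
        using M'.emeasure_space_1 by simp
      also have "\<dots> < \<infinity>"
        using std_gaussian_moments(1)[where 'n = 'n] by (simp add: nn_integral_eq_integral)
      finally show "(\<integral>\<^sup>+q. ennreal ((norm (snd q))\<^sup>2) \<partial>M'G) < \<infinity>" .
    qed auto
    then show ?thesis using integrable_distr_eq[OF T2, of "\<lambda>q. (norm (snd q))\<^sup>2"] by (simp add: law2)
  qed
  have AS2: "integrable P (\<lambda>p. A (fst p) \<bullet> S2 p)"
    using intAP(1) S2sq by (intro integrable_inner) auto
  \<comment> \<open>Under \<open>M'G\<close> the second coordinate is centred and independent of the
    first. The transported part therefore drops out of the cross term, leaving
    \<open>A (fst p) \<bullet> snd p\<close>, whose mean is that of
    \<open>A x \<bullet> \<eta> x\<close>.\<close>
  have AS2_0: "(\<integral>p. A (fst p) \<bullet> S2 p \<partial>P) = 0"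
  proof -
    have mq: "(\<lambda>q. A (fst q) \<bullet> snd q) \<in> borel_measurable M'G" by measurable
    have i: "integrable M'G (\<lambda>q. A (fst q) \<bullet> snd q)"
      using AS2 integrable_distr_eq[OF T2 mq[folded law2[symmetric]]]
        integrable_distr_eq[OF T2 mq] by (simp add: law2)
    have "(\<integral>p. A (fst p) \<bullet> S2 p \<partial>P) = (\<integral>q. A (fst q) \<bullet> snd q \<partial>M'G)"
      using integral_distr[OF T2 mq] by (simp add: law2)
    also have "\<dots> = (\<integral>x. (\<integral>y. A x \<bullet> y \<partial>\<gamma>) \<partial>M')"
      using M'G.integral_fst'[OF i] by simp
    also have "\<dots> = (\<integral>x. A x \<bullet> (\<integral>y. y \<partial>\<gamma>) \<partial>M')"
      using std_gaussian_moments(2)[where 'n = 'n]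
      by (intro Bochner_Integration.integral_cong refl integral_inner_right) auto
    finally show ?thesis by (simp add: std_gaussian_moments(3))
  qed
  note tA = tower[OF Am intA]
  let ?A\<eta> = "\<integral>x. A x \<bullet> \<eta> x \<partial>M'"
  have AB: "integrable P (\<lambda>p. A (fst p) \<bullet> B p)" "(\<integral>p. A (fst p) \<bullet> B p \<partial>P) = ?A\<eta>"
    unfolding B_def inner_diff_right using tA AS2 AS2_0 by simp_all
  have expand: "(norm (W p - Z p))\<^sup>2 = a\<^sup>2 * (norm (A (fst p)))\<^sup>2 + b\<^sup>2 * (norm (B p))\<^sup>2 + 2 * a * b * (A (fst p) \<bullet> B p)" for p
    unfolding WmZ power2_norm_eq_inner unfolding power2_eq_square
    by (simp add: inner_simps inner_commute algebra_simps)
  define c where "c = (\<integral>p. (norm (W p - Z p))\<^sup>2 \<partial>P)"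
  have ic: "integrable P (\<lambda>p. (norm (W p - Z p))\<^sup>2)"
    unfolding expand using intAP intB AB by auto
  have c_eq: "c = a\<^sup>2 * ?A2 + b\<^sup>2 * ?B2 + 2 * a * b * ?A\<eta>"
    unfolding c_def expand using intAP intB AB by simp
  have iA\<eta>: "integrable M' (\<lambda>x. A x \<bullet> \<eta> x)" using intA sq_eta by (intro integrable_inner) auto
  \<comment> \<open>Young's inequality with weights chosen so that the first cost receives the total
    weight \<open>a^2 + b^2 = 1\<close>. What remains of the cross term is exactly
    \<open>a^2 * E2\<close>.\<close>
  have "0 \<le> (\<integral>x. (norm (b *\<^sub>R A x - a *\<^sub>R \<eta> x))\<^sup>2 \<partial>M')" by simp
  also have "\<dots> = (\<integral>x. b\<^sup>2 * (norm (A x))\<^sup>2 + a\<^sup>2 * (norm (\<eta> x))\<^sup>2 - 2 * a * b * (A x \<bullet> \<eta> x) \<partial>M')"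
    unfolding power2_norm_eq_inner unfolding power2_eq_square
    by (intro Bochner_Integration.integral_cong refl) (simp add: inner_simps inner_commute algebra_simps)
  also have "\<dots> = b\<^sup>2 * ?A2 + a\<^sup>2 * E2 - 2 * a * b * ?A\<eta>"
    using intA sq_eta iA\<eta> by (simp add: E2_def)
  finally have "c \<le> (a\<^sup>2 + b\<^sup>2) * ?A2 + b\<^sup>2 * ?B2 + a\<^sup>2 * E2"
    unfolding c_eq by (simp add: algebra_simps)
  moreover have "b\<^sup>2 * ?B2 \<le> b\<^sup>2 * (2 * D1)"
    using le2 chain(4) by (intro mult_left_mono) (auto simp: B_def D1_def)
  ultimately have "c \<le> 2 * (\<integral>x. m x * ln (m x) \<partial>\<gamma>) + 2 * b\<^sup>2 * D1 + a\<^sup>2 * E2"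
    using le1 ab by (simp add: A_def)
  moreover have "0 \<le> c" unfolding c_def by simp
  moreover have "(\<integral>\<^sup>+(x, y). ennreal ((norm (x - y))\<^sup>2) \<partial>\<pi>) = ennreal c"
  proof -
    have "(\<lambda>q :: (real ^ 'n) \<times> (real ^ 'n). ennreal ((norm (fst q - snd q))\<^sup>2)) \<in> borel_measurable borel"
      using fs by measurable
    then have "(\<integral>\<^sup>+(x, y). ennreal ((norm (x - y))\<^sup>2) \<partial>\<pi>) = (\<integral>\<^sup>+p. ennreal ((norm (W p - Z p))\<^sup>2) \<partial>P)"
      unfolding \<pi>_def using nn_integral_distr[OF WZ, of "\<lambda>q. ennreal ((norm (fst q - snd q))\<^sup>2)"]
      by (simp add: case_prod_beta')
    also have "\<dots> = ennreal c" unfolding c_def by (rule nn_integral_eq_integral[OF ic]) simp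
    finally show ?thesis .
  qed
  ultimately show ?thesis using that \<pi> by blast
qed

lemma ln_gauss_dens: "ln (gauss_dens (x :: real ^ 'n)) = real CARD('n) * ln (1 / sqrt (2 * pi)) - (norm x)\<^sup>2 / 2"
  unfolding gauss_dens_def by (subst ln_mult_pos) (auto simp: ln_realpow)

lemma measurable_M'_pair_iff: "g \<in> borel_measurable M'G \<longleftrightarrow> g \<in> borel_measurable (borel \<Otimes>\<^sub>M borel)"
  by (simp cong: measurable_cong_sets add: sets_M'_pair)

lemma nn_integral_M'_pair:
  assumes g[measurable]: "g \<in> borel_measurable (borel \<Otimes>\<^sub>M borel)"
  shows "(\<integral>\<^sup>+p. g p \<partial>M'G) = (\<integral>\<^sup>+x. \<integral>\<^sup>+y. ennreal (gauss_dens y) * g (x, y) \<partial>lborel \<partial>M')"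
proof -
  have "g \<in> borel_measurable M'G" using g by (simp cong: measurable_cong_sets add: sets_M'_pair)
  then have "(\<integral>\<^sup>+p. g p \<partial>M'G) = (\<integral>\<^sup>+x. \<integral>\<^sup>+y. g (x, y) \<partial>\<gamma> \<partial>M')"
    by (rule std_gaussian.nn_integral_fst[symmetric])
  also have "\<dots> = (\<integral>\<^sup>+x. \<integral>\<^sup>+y. ennreal (gauss_dens y) * g (x, y) \<partial>lborel \<partial>M')"
    by (intro nn_integral_cong nn_integral_std_gaussian) measurable
  finally show ?thesis .
qed

text \<open>Gibbs' inequality against the Gaussian of mean \<eta> and covariance
  \<open>\<beta>^2 I\<close>. The value \<open>\<beta> = 1\<close> gives nonnegativity of the
  centred entropy together with its equality case; the value \<open>\<beta> = b\<close> controls the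
  conditional variance \<open>Y2 - E2\<close> from below.\<close>

lemma D1_ge:
  assumes \<beta>: "0 < \<beta>"
  shows "Y2 / 2 - (Y2 - E2) / (2 * \<beta>\<^sup>2) - real CARD('n) * ln \<beta> \<le> D1"
    and "D1 \<le> Y2 / 2 - (Y2 - E2) / (2 * \<beta>\<^sup>2) - real CARD('n) * ln \<beta> \<Longrightarrow>
      AE p in P. gauss_dens ((1 / \<beta>) *\<^sub>R (snd p - \<eta> (fst p))) / (\<beta> ^ CARD('n) * gauss_dens (snd p)) = k p"
proof -
  let ?u = "\<lambda>p. (1 / \<beta>) *\<^sub>R (snd p - \<eta> (fst p))"
  define w where "w p = gauss_dens (?u p) / (\<beta> ^ CARD('n) * gauss_dens (snd p))" for p
  have wb[measurable]: "w \<in> borel_measurable (borel \<Otimes>\<^sub>M borel)" unfolding w_def by measurable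
  have w0: "0 < w p" for p using \<beta> by (simp add: w_def)
  have "(\<integral>\<^sup>+p. ennreal (w p) \<partial>M'G) = (\<integral>\<^sup>+x. \<integral>\<^sup>+y. ennreal (gauss_dens y) * ennreal (w (x, y)) \<partial>lborel \<partial>M')"
    by (rule nn_integral_M'_pair) measurable
  also have "\<dots> = (\<integral>\<^sup>+x. 1 \<partial>M')"
  proof (rule nn_integral_cong)
    fix x
    have "(\<integral>\<^sup>+y. ennreal (gauss_dens y) * ennreal (w (x, y)) \<partial>lborel)
        = (\<integral>\<^sup>+y. ennreal (gauss_dens ((1 / \<beta>) *\<^sub>R (y - \<eta> x)) / \<beta> ^ CARD('n)) \<partial>lborel)"
      using \<beta> by (intro nn_integral_cong, subst ennreal_mult[symmetric]) (auto simp: w_def less_imp_le)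
    also have "\<dots> = ennreal (\<beta> ^ CARD('n)) * (\<integral>\<^sup>+z. ennreal (gauss_dens z / \<beta> ^ CARD('n)) \<partial>(lborel :: (real ^ 'n) measure))"
      using \<beta> by (subst nn_integral_lborel_affine[of _ \<beta> "\<eta> x"]) auto
    also have "\<dots> = (\<integral>\<^sup>+z. ennreal (gauss_dens z) \<partial>(lborel :: (real ^ 'n) measure))"
      using \<beta> by (subst nn_integral_cmult[symmetric]) (auto simp: ennreal_mult[symmetric] less_imp_le)
    also have "\<dots> = emeasure \<gamma> (space \<gamma>)"
      unfolding std_gaussian_eq_density by (subst emeasure_density) (auto intro!: nn_integral_cong)
    also have "\<dots> = 1" by (rule std_gaussian.emeasure_space_1)
    finally show "(\<integral>\<^sup>+y. ennreal (gauss_dens y) * ennreal (w (x, y)) \<partial>lborel) = 1" .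
  qed
  also have "\<dots> = 1" using M'.emeasure_space_1 by simp
  finally have w1: "(\<integral>\<^sup>+p. ennreal (w p) \<partial>M'G) \<le> 1" by simp
  have lnw: "ln (w p) = (norm (snd p))\<^sup>2 / 2 - (norm (snd p - \<eta> (fst p)))\<^sup>2 / (2 * \<beta>\<^sup>2) - real CARD('n) * ln \<beta>" for p
  proof -
    have "ln (w p) = ln (gauss_dens (?u p)) - (ln (\<beta> ^ CARD('n)) + ln (gauss_dens (snd p)))"
      unfolding w_def using \<beta> by (subst ln_divide_pos) (auto simp: ln_mult_pos)
    then show ?thesis using \<beta> by (simp add: ln_gauss_dens ln_realpow power_divide)
  qed
  have int_lnw: "integrable P (\<lambda>p. ln (w p))" unfolding lnw using mom_P centered(1) by auto
  have E_lnw: "(\<integral>p. ln (w p) \<partial>P) = Y2 / 2 - (Y2 - E2) / (2 * \<beta>\<^sup>2) - real CARD('n) * ln \<beta>"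
    unfolding lnw using mom_P centered P.prob_space by (simp add: Y2_def)
  note gibbs = gibbs_inequality[of k "M'G" w, unfolded P_eq, OF _ _ prob_P k_nonneg _ w1 _ chain(3) int_lnw]
  show "Y2 / 2 - (Y2 - E2) / (2 * \<beta>\<^sup>2) - real CARD('n) * ln \<beta> \<le> D1"
    unfolding E_lnw[symmetric] D1_def
    by (rule gibbs(1)) (auto simp: measurable_M'_pair_iff w0 less_imp_le)
  assume "D1 \<le> Y2 / 2 - (Y2 - E2) / (2 * \<beta>\<^sup>2) - real CARD('n) * ln \<beta>"
  then have "AE p in P. w p = k p"
    unfolding E_lnw[symmetric] D1_def
    by (intro gibbs(2)) (auto simp: measurable_M'_pair_iff w0 less_imp_le)
  then show "AE p in P. gauss_dens (?u p) / (\<beta> ^ CARD('n) * gauss_dens (snd p)) = k p"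
    by (simp add: w_def)
qed

end

section \<open>Covariance matrices through their quadratic forms\<close>

lemma cov_matrix_quadratic:
  fixes \<mu> :: "(real ^ 'n) measure"
  assumes \<mu>: "prob_measure_finite_second_moment \<mu>" and bary: "barycenter \<mu> = 0"
  shows "v \<bullet> (cov_matrix \<mu> *v v) = (\<integral>x. (v \<bullet> x)\<^sup>2 \<partial>\<mu>)"
proof -
  have sets[measurable_cong]: "sets \<mu> = sets borel" and int: "integrable \<mu> (\<lambda>x. (norm x)\<^sup>2)"
    using \<mu> by (auto simp: prob_measure_finite_second_moment_def)
  have ij: "integrable \<mu> (\<lambda>x. x $ i * x $ j)" for i j
  proof (rule Bochner_Integration.integrable_bound[OF int])
    show "AE x in \<mu>. norm (x $ i * x $ j) \<le> norm ((norm x)\<^sup>2)"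
    proof (rule AE_I2)
      fix x
      have "\<bar>x $ i\<bar> * \<bar>x $ j\<bar> \<le> norm x * norm x"
        by (intro mult_mono component_le_norm_cart) auto
      then show "norm (x $ i * x $ j) \<le> norm ((norm x)\<^sup>2)" by (simp add: abs_mult power2_eq_square)
    qed
  qed measurable
  have "v \<bullet> (cov_matrix \<mu> *v v) = (\<Sum>i\<in>UNIV. \<Sum>j\<in>UNIV. (v $ i * v $ j) * (\<integral>x. x $ i * x $ j \<partial>\<mu>))"
    by (simp add: inner_vec_def matrix_vector_mult_def cov_matrix_def bary sum_distrib_left mult_ac)
  also have "\<dots> = (\<integral>x. (\<Sum>i\<in>UNIV. \<Sum>j\<in>UNIV. (v $ i * v $ j) * (x $ i * x $ j)) \<partial>\<mu>)"
    using ij by (simp add: Bochner_Integration.integral_sum)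
  also have "(\<lambda>x. \<Sum>i\<in>UNIV. \<Sum>j\<in>UNIV. (v $ i * v $ j) * (x $ i * x $ j)) = (\<lambda>x. (v \<bullet> x)\<^sup>2)"
    by (auto simp: fun_eq_iff inner_vec_def power2_eq_square sum_product mult_ac)
  finally show ?thesis .
qed

lemma sq_inner_le: "(x \<bullet> y)\<^sup>2 \<le> (norm x)\<^sup>2 * (norm y)\<^sup>2"
  by (simp add: Cauchy_Schwarz_ineq power2_norm_eq_inner)

lemma integrable_sq_inner:
  fixes g :: "'a \<Rightarrow> real ^ 'n"
  assumes [measurable]: "g \<in> borel_measurable M" and int: "integrable M (\<lambda>x. (norm (g x))\<^sup>2)"
  shows "integrable M (\<lambda>x. (v \<bullet> g x)\<^sup>2)"
proof (rule Bochner_Integration.integrable_bound)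
  show "integrable M (\<lambda>x. (norm v)\<^sup>2 * (norm (g x))\<^sup>2)" using int by auto
  show "AE x in M. norm ((v \<bullet> g x)\<^sup>2) \<le> norm ((norm v)\<^sup>2 * (norm (g x))\<^sup>2)"
    by (intro AE_I2) (simp add: sq_inner_le)
qed measurable

lemma cov_matrix_le_iff:
  fixes \<mu> \<nu> :: "(real ^ 'n) measure"
  assumes "prob_measure_finite_second_moment \<mu>" "barycenter \<mu> = 0"
    and "prob_measure_finite_second_moment \<nu>" "barycenter \<nu> = 0"
    and "\<And>v. (\<integral>x. (v \<bullet> x)\<^sup>2 \<partial>\<nu>) \<le> (\<integral>x. (v \<bullet> x)\<^sup>2 \<partial>\<mu>)"
  shows "cov_matrix \<nu> \<preceq> cov_matrix \<mu>"
  unfolding psd_le_def psd_matrix_def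
proof (intro conjI allI)
  show "transpose (cov_matrix \<mu> - cov_matrix \<nu>) = cov_matrix \<mu> - cov_matrix \<nu>"
    by (simp add: transpose_def cov_matrix_def vec_eq_iff mult.commute)
  show "0 \<le> v \<bullet> ((cov_matrix \<mu> - cov_matrix \<nu>) *v v)" for v
    using assms by (simp add: matrix_vector_mult_diff_rdistrib inner_diff_right cov_matrix_quadratic)
qed

lemma relative_entropy_nonneg_density:
  fixes h :: "'a \<Rightarrow> real"
  assumes "prob_space R" "prob_space (density R h)" and [measurable]: "h \<in> borel_measurable R"
    and "\<And>x. 0 \<le> h x" and int: "integrable (density R h) (\<lambda>x. ln (h x))"
  shows "0 \<le> (\<integral>x. ln (h x) \<partial>density R h)"
proof -
  interpret R: prob_space R by fact
  have "(\<integral>x. ln 1 \<partial>density R h) \<le> (\<integral>x. ln (h x) \<partial>density R h)"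
    using assms by (intro gibbs_inequality(1)[of h R "\<lambda>_. 1"]) (auto simp: R.emeasure_space_1)
  then show ?thesis by simp
qed

section \<open>The measure \<nu>, its covariance, and the entropy relative to its
  convolution\<close>

context gaussian_split
begin

lemma integrable_P_fstI:
  fixes g :: "real ^ 'n \<Rightarrow> 'c :: {banach, second_countable_topology}"
  assumes "g \<in> borel_measurable borel" "integrable M' g"
  shows "integrable P (\<lambda>p. g (fst p))" "(\<integral>p. g (fst p) \<partial>P) = (\<integral>x. g x \<partial>M')"
proof -
  have "g \<in> borel_measurable \<gamma>" using assms(1) by (simp cong: measurable_cong_sets)
  from integrable_P_fst[OF this] assms(2)
  show "integrable P (\<lambda>p. g (fst p))" "(\<integral>p. g (fst p) \<partial>P) = (\<integral>x. g x \<partial>M')" by blast+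
qed

definition cmean :: "real ^ 'n \<Rightarrow> real ^ 'n" where
  "cmean x = a *\<^sub>R x + b *\<^sub>R \<eta> x"

definition \<nu> :: "(real ^ 'n) measure" where
  "\<nu> = distr M' borel cmean"

text \<open>The density of \<open>\<nu> \<star> \<gamma>\<close> relative to \<gamma>, by
  \<open>std_gaussian_convolution\<close>.\<close>

definition \<kappa> :: "real ^ 'n \<Rightarrow> real" where
  "\<kappa> z = (\<integral>n. exp (n \<bullet> z - (norm n)\<^sup>2 / 2) \<partial>\<nu>)"

lemma measurable_cmean[measurable]: "cmean \<in> borel_measurable borel"
  unfolding cmean_def by measurable

lemma measurable_cmean'[measurable]: "cmean \<in> M' \<rightarrow>\<^sub>M borel"
  using measurable_cmean by (simp cong: measurable_cong_sets)

lemma prob_\<nu>: "prob_space \<nu>"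
  unfolding \<nu>_def by (rule M'.prob_space_distr) measurable

lemma sets_\<nu>[simp]: "sets \<nu> = sets borel"
  by (simp add: \<nu>_def)

lemma W_cmean: "W p = cmean (fst p) + b *\<^sub>R (snd p - \<eta> (fst p))"
  by (simp add: W_def cmean_def algebra_simps)

lemma sq_fst: "integrable M' (\<lambda>x. (norm x)\<^sup>2)"
  using mom_P(1) integrable_P_fst(1)[of "\<lambda>x. (norm x)\<^sup>2"] by simp

lemma sq_cmean: "integrable M' (\<lambda>x. (norm (cmean x))\<^sup>2)"
proof -
  have "integrable M' (\<lambda>x. x \<bullet> \<eta> x)" using sq_fst sq_eta by (intro integrable_inner) auto
  then have "integrable M' (\<lambda>x. a\<^sup>2 * (norm x)\<^sup>2 + b\<^sup>2 * (norm (\<eta> x))\<^sup>2 + 2 * a * b * (x \<bullet> \<eta> x))"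
    using sq_fst sq_eta by auto
  moreover have "a\<^sup>2 * (norm x)\<^sup>2 + b\<^sup>2 * (norm (\<eta> x))\<^sup>2 + 2 * a * b * (x \<bullet> \<eta> x) = (norm (cmean x))\<^sup>2" for x
    unfolding cmean_def power2_norm_eq_inner unfolding power2_eq_square
    by (simp add: inner_simps inner_commute algebra_simps)
  ultimately show ?thesis by simp
qed

lemma sq_\<nu>: "integrable \<nu> (\<lambda>x. (norm x)\<^sup>2)"
  unfolding \<nu>_def using sq_cmean by (subst integrable_distr_eq) auto

lemma finite_second_moment_\<nu>: "prob_measure_finite_second_moment \<nu>"
  by (simp add: prob_measure_finite_second_moment_def prob_\<nu> sq_\<nu>)

text \<open>Conditional expectation does not increase variance in any direction v: in
  \<open>W_cmean\<close> the residual is orthogonal to every function of \<open>fst\<close>.\<close>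

lemma cov_\<nu>:
  assumes bary: "barycenter (density \<gamma> f) = 0"
  shows "cov_matrix \<nu> \<preceq> cov_matrix (density \<gamma> f)"
proof (rule cov_matrix_le_iff[OF _ bary finite_second_moment_\<nu>])
  have "emeasure (density \<gamma> f) (space (density \<gamma> f)) = 1"
    using dens_one by (simp add: emeasure_density)
  then have "prob_space (density \<gamma> f)" by (rule prob_spaceI)
  moreover have "integrable (density \<gamma> f) (\<lambda>x. (norm x)\<^sup>2)"
    using mom_W integrable_W_iff(1)[of "\<lambda>x. (norm x)\<^sup>2"] by simp
  ultimately show "prob_measure_finite_second_moment (density \<gamma> f)"
    by (simp add: prob_measure_finite_second_moment_def)
  have isnd: "integrable P (\<lambda>p. snd p)" by (rule integrable_of_square[OF prob_P _ mom_P(2)]) simp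
  have Es: "(\<integral>p. snd p \<partial>P) = (\<integral>x. \<eta> x \<partial>M')"
    unfolding integral_P_k(2)[OF isnd] \<eta>_def by simp
  have if': "integrable M' (\<lambda>x. x)" by (rule integrable_of_square[OF prob_M' _ sq_fst]) simp
  have ie: "integrable M' \<eta>" by (rule integrable_of_square[OF prob_M' _ sq_eta]) simp
  have iP: "integrable P (\<lambda>p. fst p)" "(\<integral>p. fst p \<partial>P) = (\<integral>x. x \<partial>M')"
    using integrable_P_fstI[OF _ if'] by simp_all
  have "(\<integral>x. x \<partial>\<nu>) = (\<integral>x. cmean x \<partial>M')" unfolding \<nu>_def by (subst integral_distr) auto
  also have "\<dots> = a *\<^sub>R (\<integral>x. x \<partial>M') + b *\<^sub>R (\<integral>x. \<eta> x \<partial>M')"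
    unfolding cmean_def using if' ie by simp
  also have "\<dots> = (\<integral>p. W p \<partial>P)"
  proof -
    have "(\<integral>p. a *\<^sub>R fst p + b *\<^sub>R snd p \<partial>P) = a *\<^sub>R (\<integral>x. x \<partial>M') + b *\<^sub>R (\<integral>x. \<eta> x \<partial>M')"
      using isnd iP Es by simp
    then show ?thesis by (simp only: W_def)
  qed
  also have "\<dots> = 0" using bary integrable_W_iff(2)[of "\<lambda>x. x"] by (simp add: barycenter_def)
  finally show "barycenter \<nu> = 0" by (simp add: barycenter_def)
  fix v :: "real ^ 'n"
  let ?h = "\<lambda>x. (v \<bullet> cmean x) *\<^sub>R v"
  have vm: "integrable M' (\<lambda>x. (v \<bullet> cmean x)\<^sup>2)"
    by (rule integrable_sq_inner[OF _ sq_cmean]) measurable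
  then have h2: "integrable M' (\<lambda>x. (norm (?h x))\<^sup>2)" by (simp add: power_mult_distrib)
  have hm: "?h \<in> borel_measurable borel" by measurable
  note t = tower[OF hm h2]
  have hc: "integrable M' (\<lambda>x. ?h x \<bullet> \<eta> x)" using h2 sq_eta by (intro integrable_inner) auto
  have vmP: "integrable P (\<lambda>p. (v \<bullet> cmean (fst p))\<^sup>2)" "(\<integral>p. (v \<bullet> cmean (fst p))\<^sup>2 \<partial>P) = (\<integral>x. (v \<bullet> cmean x)\<^sup>2 \<partial>M')"
    by (rule integrable_P_fstI[OF _ vm], measurable)+
  have hP: "integrable P (\<lambda>p. ?h (fst p) \<bullet> \<eta> (fst p))" "(\<integral>p. ?h (fst p) \<bullet> \<eta> (fst p) \<partial>P) = (\<integral>x. ?h x \<bullet> \<eta> x \<partial>M')"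
    by (rule integrable_P_fstI[OF _ hc], measurable)+
  \<comment> \<open>The square of \<open>v \<bullet> W p\<close> without the squared residual. Its
    cross term has mean 0 by \<open>tower\<close>, so its integral is the second moment of \<nu> in
    direction v.\<close>
  let ?low = "\<lambda>p. (v \<bullet> cmean (fst p))\<^sup>2 + 2 * b * (?h (fst p) \<bullet> snd p - ?h (fst p) \<bullet> \<eta> (fst p))"
  have vW: "integrable P (\<lambda>p. (v \<bullet> W p)\<^sup>2)" by (rule integrable_sq_inner[OF _ mom_W]) measurable
  have "(\<integral>x. (v \<bullet> x)\<^sup>2 \<partial>\<nu>) = (\<integral>x. (v \<bullet> cmean x)\<^sup>2 \<partial>M')"
    unfolding \<nu>_def by (subst integral_distr) auto
  also have "\<dots> = (\<integral>p. ?low p \<partial>P)"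
    using vmP t hP by simp
  also have "\<dots> \<le> (\<integral>p. (v \<bullet> W p)\<^sup>2 \<partial>P)"
  proof (rule integral_mono)
    show "integrable P ?low" using vmP t hP by auto
    fix p
    have "v \<bullet> W p = v \<bullet> cmean (fst p) + b * (v \<bullet> (snd p - \<eta> (fst p)))"
      unfolding W_cmean by (simp add: inner_simps)
    then have "(v \<bullet> W p)\<^sup>2 = (v \<bullet> cmean (fst p))\<^sup>2 + 2 * b * ((v \<bullet> cmean (fst p)) * (v \<bullet> (snd p - \<eta> (fst p))))
        + (b * (v \<bullet> (snd p - \<eta> (fst p))))\<^sup>2"
      by (simp add: power2_sum)
    moreover have "(v \<bullet> cmean (fst p)) * (v \<bullet> (snd p - \<eta> (fst p))) = ?h (fst p) \<bullet> snd p - ?h (fst p) \<bullet> \<eta> (fst p)"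
      by (simp add: inner_diff_right right_diff_distrib)
    ultimately show "?low p \<le> (v \<bullet> W p)\<^sup>2" by simp
  qed (rule vW)
  also have "\<dots> = (\<integral>x. (v \<bullet> x)\<^sup>2 \<partial>density \<gamma> f)"
    using integrable_W_iff(2)[of "\<lambda>x. (v \<bullet> x)\<^sup>2"] by simp
  finally show "(\<integral>x. (v \<bullet> x)\<^sup>2 \<partial>\<nu>) \<le> (\<integral>x. (v \<bullet> x)\<^sup>2 \<partial>density \<gamma> f)" .
qed

lemmas conv_\<nu> = std_gaussian_convolution[OF prob_\<nu> sets_\<nu>, folded \<kappa>_def]

lemma measurable_\<kappa>[measurable]: "\<kappa> \<in> borel_measurable borel"
  using conv_\<nu>(2) unfolding \<kappa>_def[abs_def] .

text \<open>The function lies between two polynomials of degree at most 2, which the second moment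
  of \<open>f\<close> integrates. The upper one is the bound on \<kappa>; the lower one is Jensen's
  inequality for the exponential, proved with the tangent at the mean exponent
  \<open>c \<bullet> z - V / 2\<close>.\<close>

lemma ln_\<kappa>_integrable: "integrable (density \<gamma> f) (\<lambda>z. ln (\<kappa> z))"
proof -
  interpret \<nu>: prob_space \<nu> by (rule prob_\<nu>)
  have [measurable_cong]: "sets \<nu> = sets borel" by simp
  define c where "c = (\<integral>n. n \<partial>\<nu>)"
  define V where "V = (\<integral>n. (norm n)\<^sup>2 \<partial>\<nu>)"
  have in\<nu>: "integrable \<nu> (\<lambda>n. n)" by (rule integrable_of_square[OF prob_\<nu> _ sq_\<nu>]) simp
  have V0: "0 \<le> V" unfolding V_def by simp
  have lower: "c \<bullet> z - V / 2 \<le> ln (\<kappa> z)" for z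
  proof -
    let ?t = "c \<bullet> z - V / 2"
  let ?l = "\<lambda>n. 1 + ((n \<bullet> z - (norm n)\<^sup>2 / 2) - ?t)"
    have int: "integrable \<nu> (\<lambda>n. exp ?t * ?l n)"
      using in\<nu> sq_\<nu> by auto
    have "(\<integral>n. exp ?t * ?l n \<partial>\<nu>) \<le> \<kappa> z"
      unfolding \<kappa>_def
    proof (rule integral_mono[OF int conv_\<nu>(3)])
      fix n
      have "?l n \<le> exp ((n \<bullet> z - (norm n)\<^sup>2 / 2) - ?t)" by (rule exp_ge_add_one_self)
      then have "exp ?t * ?l n \<le> exp ?t * exp ((n \<bullet> z - (norm n)\<^sup>2 / 2) - ?t)"
        by (rule mult_left_mono) simp
      then show "exp ?t * ?l n \<le> exp (n \<bullet> z - (norm n)\<^sup>2 / 2)"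
        by (simp add: exp_add[symmetric])
    qed
    also have "(\<integral>n. exp ?t * ?l n \<partial>\<nu>) = exp ?t"
      using in\<nu> sq_\<nu> \<nu>.prob_space by (simp add: c_def V_def)
    finally show ?thesis using conv_\<nu>(4)[of z] by (simp add: ln_ge_iff)
  qed
  have sqf: "integrable (density \<gamma> f) (\<lambda>z. (norm z)\<^sup>2)"
    using mom_W integrable_W_iff(1)[of "\<lambda>x. (norm x)\<^sup>2"] by simp
  have "prob_space (density \<gamma> f)"
    unfolding law_W[symmetric] by (rule P.prob_space_distr) measurable
  then interpret \<mu>: prob_space "density \<gamma> f" .
  have bd: "\<bar>ln (\<kappa> z)\<bar> \<le> (1 + norm c) * (norm z)\<^sup>2 + norm c + V" for z
  proof -
    have "ln (\<kappa> z) \<le> ln (exp ((norm z)\<^sup>2 / 2))"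
      using conv_\<nu>(4,5)[of z] by (subst ln_le_cancel_iff) auto
    then have up: "ln (\<kappa> z) \<le> (norm z)\<^sup>2 / 2" by simp
    have "0 \<le> (norm z - 1)\<^sup>2" by simp
    then have "2 * norm z \<le> 1 + (norm z)\<^sup>2" by (simp add: power2_eq_square algebra_simps)
    then have "norm z \<le> 1 + (norm z)\<^sup>2" using norm_ge_zero[of z] by linarith
    then have "norm c * norm z \<le> norm c * (1 + (norm z)\<^sup>2)" by (rule mult_left_mono) simp
    moreover have "\<bar>c \<bullet> z\<bar> \<le> norm c * norm z" by (rule Cauchy_Schwarz_ineq2)
    moreover have "0 \<le> norm c * (norm z)\<^sup>2" "0 \<le> norm c" "0 \<le> (norm z)\<^sup>2" by simp_all
    ultimately show ?thesis using up lower[of z] V0 unfolding distrib_left distrib_right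
      by linarith
  qed
  show ?thesis
  proof (rule Bochner_Integration.integrable_bound)
    show "integrable (density \<gamma> f) (\<lambda>z. (1 + norm c) * (norm z)\<^sup>2 + norm c + V)"
      by (intro Bochner_Integration.integrable_add integrable_mult_right sqf) auto
    show "(\<lambda>z. ln (\<kappa> z)) \<in> borel_measurable (density \<gamma> f)" by measurable
    show "AE z in density \<gamma> f. norm (ln (\<kappa> z)) \<le> norm ((1 + norm c) * (norm z)\<^sup>2 + norm c + V)"
    proof (rule AE_I2)
      fix z show "norm (ln (\<kappa> z)) \<le> norm ((1 + norm c) * (norm z)\<^sup>2 + norm c + V)"
        using bd[of z] by (simp only: real_norm_def)
    qed
  qed
qed

text \<open>Gibbs' inequality on the product space plays the role of the joint convexity of relative entropy:
  the law of \<open>W\<close> given \<open>fst\<close> is compared with the unit Gaussian centred at its mean.\<close>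

lemma relative_entropy_bound:
  obtains R where "relative_entropy (density \<gamma> f) (\<nu> \<star> \<gamma>) = ereal R" "0 \<le> R"
    "R \<le> D1 - Y2 / 2 + b\<^sup>2 * (Y2 - E2) / 2 - real CARD('n) * ln b"
proof -
  define R where "R = (\<integral>z. ln (f z / \<kappa> z) \<partial>density \<gamma> f)"
  have \<kappa>0[simp]: "0 < \<kappa> z" "0 \<le> \<kappa> z" "\<kappa> z \<noteq> 0" for z using conv_\<nu>(4)[of z] by simp_all
  have conv: "\<nu> \<star> \<gamma> = density \<gamma> \<kappa>" by (rule conv_\<nu>(1))
  have prob_conv: "prob_space (density \<gamma> \<kappa>)"
  proof -
    interpret \<nu>: prob_space \<nu> by (rule prob_\<nu>)
    interpret N: pair_prob_space \<nu> \<gamma> ..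
    have "sets (\<nu> \<Otimes>\<^sub>M \<gamma>) = sets (borel \<Otimes>\<^sub>M borel)" by (intro sets_pair_measure_cong) auto
    then have "(\<lambda>(x, y). x + y) \<in> \<nu> \<Otimes>\<^sub>M \<gamma> \<rightarrow>\<^sub>M borel" by (subst measurable_cong_sets) auto
    then show ?thesis unfolding conv[symmetric] convolution_def by (rule N.prob_space_distr)
  qed
  have \<mu>_eq: "density (density \<gamma> \<kappa>) (\<lambda>z. f z / \<kappa> z) = density \<gamma> f"
    by (subst density_density_eq) (auto simp: ennreal_mult[symmetric] dens_nonneg)
  have prob_\<mu>: "prob_space (density \<gamma> f)"
    unfolding law_W[symmetric] by (rule P.prob_space_distr) measurable
  have int_lnf: "integrable (density \<gamma> f) (\<lambda>z. ln (f z))"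
    using ent by (subst integrable_density) (auto simp: dens_nonneg)
  have fpos: "AE z in density \<gamma> f. 0 < f z" by (rule AE_density_pos) simp
  have AE_ln: "AE z in density \<gamma> f. ln (f z) - ln (\<kappa> z) = ln (f z / \<kappa> z)"
    using fpos by eventually_elim (simp add: ln_divide_pos)
  have int: "integrable (density \<gamma> f) (\<lambda>z. ln (f z / \<kappa> z))"
    by (rule integrable_cong_AE_imp[OF Bochner_Integration.integrable_diff[OF int_lnf ln_\<kappa>_integrable]])
      (use AE_ln in \<open>auto elim!: eventually_mono\<close>)
  have 1: "relative_entropy (density \<gamma> f) (\<nu> \<star> \<gamma>) = ereal R"
    using relative_entropy_density[OF prob_conv, of "\<lambda>z. f z / \<kappa> z"] int
    by (simp add: \<mu>_eq conv R_def dens_nonneg)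
  have 2: "0 \<le> R"
    using relative_entropy_nonneg_density[OF prob_conv, of "\<lambda>z. f z / \<kappa> z"] int prob_\<mu>
    by (simp add: \<mu>_eq R_def dens_nonneg)
  \<comment> \<open>Since \<open>W - cmean = b (h - \<eta>)\<close>, the Gaussian factors describe h
    when \<open>W\<close> given \<open>fst\<close> is a unit Gaussian centred at
    \<open>cmean\<close>. The factor \<open>f / \<kappa>\<close> then changes the law of
    \<open>W\<close> from \<open>\<nu> \<star> \<gamma>\<close> to \<mu>. Total mass 1 appears only
    after integrating over \<open>fst\<close>, which recombines the translated Gaussians into
    \<kappa>; this is why Gibbs' inequality is applied on the product and not slice by
    slice.\<close>
  define w where "w p = f (W p) / \<kappa> (W p) * gauss_dens (b *\<^sub>R (snd p - \<eta> (fst p))) * b ^ CARD('n) / gauss_dens (snd p)" for p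
  have wb[measurable]: "w \<in> borel_measurable (borel \<Otimes>\<^sub>M borel)" unfolding w_def by measurable
  have w0: "0 \<le> w p" for p using b by (simp add: w_def dens_nonneg)
  let ?h = "\<lambda>x z. ennreal (f z / \<kappa> z) * ennreal (gauss_dens (z - cmean x))"
  have "(\<integral>\<^sup>+p. ennreal (w p) \<partial>M'G) = (\<integral>\<^sup>+x. \<integral>\<^sup>+y. ennreal (gauss_dens y) * ennreal (w (x, y)) \<partial>lborel \<partial>M')"
    by (rule nn_integral_M'_pair) measurable
  also have "\<dots> = (\<integral>\<^sup>+x. \<integral>\<^sup>+z. ?h x z \<partial>lborel \<partial>M')"
  proof (rule nn_integral_cong)
    fix x
    have "b *\<^sub>R (y - \<eta> x) = a *\<^sub>R x + b *\<^sub>R y - cmean x" for y by (simp add: cmean_def algebra_simps)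
    then have "(\<integral>\<^sup>+y. ennreal (gauss_dens y) * ennreal (w (x, y)) \<partial>lborel)
        = (\<integral>\<^sup>+y. ennreal (b ^ CARD('n)) * ?h x (a *\<^sub>R x + b *\<^sub>R y) \<partial>lborel)"
      using b w0 by (intro nn_integral_cong) (simp add: ennreal_mult[symmetric] w_def W_def dens_nonneg)
    also have "\<dots> = ennreal (b ^ CARD('n)) * (\<integral>\<^sup>+y. ?h x (a *\<^sub>R x + b *\<^sub>R y) \<partial>lborel)"
      by (rule nn_integral_cmult) measurable
    also have "\<dots> = (\<integral>\<^sup>+z. ?h x z \<partial>lborel)"
      using nn_integral_lborel_affine[of "?h x" b "a *\<^sub>R x"] b by simp
    finally show "(\<integral>\<^sup>+y. ennreal (gauss_dens y) * ennreal (w (x, y)) \<partial>lborel) = (\<integral>\<^sup>+z. ?h x z \<partial>lborel)" .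
  qed
  also have "\<dots> = (\<integral>\<^sup>+z. \<integral>\<^sup>+x. ?h x z \<partial>M' \<partial>lborel)"
  proof -
    interpret MLb: pair_sigma_finite M' "lborel :: (real ^ 'n) measure" ..
    have s: "sets (M' \<Otimes>\<^sub>M (lborel :: (real ^ 'n) measure)) = sets (borel \<Otimes>\<^sub>M borel)" by (intro sets_pair_measure_cong) auto
    show ?thesis
      by (rule MLb.Fubini'[symmetric]) (unfold measurable_cong_sets[OF s refl], measurable)
  qed
  also have "\<dots> = (\<integral>\<^sup>+z. ennreal (gauss_dens z) * ennreal (f z) \<partial>lborel)"
  proof (rule nn_integral_cong)
    fix z
    have "(\<integral>\<^sup>+x. ennreal (gauss_dens (z - cmean x)) \<partial>M') = (\<integral>\<^sup>+n. ennreal (gauss_dens (z - n)) \<partial>\<nu>)"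
      unfolding \<nu>_def by (subst nn_integral_distr) auto
    also have "\<dots> = ennreal (gauss_dens z * \<kappa> z)" by (rule conv_\<nu>(6))
    finally show "(\<integral>\<^sup>+x. ?h x z \<partial>M') = ennreal (gauss_dens z) * ennreal (f z)"
      by (subst nn_integral_cmult) (auto simp: ennreal_mult[symmetric] dens_nonneg)
  qed
  also have "\<dots> = 1" using dens_one nn_integral_std_gaussian[of "\<lambda>z. ennreal (f z)"] by simp
  finally have w1: "(\<integral>\<^sup>+p. ennreal (w p) \<partial>M'G) \<le> 1" by simp
  let ?g = "\<lambda>p. ln (f (W p) / \<kappa> (W p)) + ((norm (snd p))\<^sup>2 / 2 - b\<^sup>2 * (norm (snd p - \<eta> (fst p)))\<^sup>2 / 2 + real CARD('n) * ln b)"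
  have Wpos: "AE p in P. 0 < f (W p)" using AE_P_pos by eventually_elim simp
  have lnw: "AE p in P. ?g p = ln (w p)"
    using Wpos
  proof eventually_elim
    case (elim p)
    have "ln (w p) = ln (f (W p) / \<kappa> (W p)) + ln (gauss_dens (b *\<^sub>R (snd p - \<eta> (fst p)))) + ln (b ^ CARD('n)) - ln (gauss_dens (snd p))"
      unfolding w_def using elim b
      by (subst ln_divide_pos, simp, simp, subst ln_mult_pos, simp, simp, subst ln_mult_pos) auto
    then show ?case using b by (simp add: ln_gauss_dens ln_realpow power_mult_distrib)
  qed
  have iW: "integrable P (\<lambda>p. ln (f (W p) / \<kappa> (W p)))" "(\<integral>p. ln (f (W p) / \<kappa> (W p)) \<partial>P) = R"
    using int integrable_W_iff[of "\<lambda>z. ln (f z / \<kappa> z)"] by (simp_all add: R_def)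
  have ig: "integrable P ?g" using iW mom_P centered(1) by auto
  have wm: "w \<in> borel_measurable P" using wb by (simp cong: measurable_cong_sets add: sets_pair)
  have il: "integrable P (\<lambda>p. ln (w p))"
    by (rule integrable_cong_AE_imp[OF ig]) (use wm lnw in \<open>auto elim!: eventually_mono\<close>)
  have "(\<integral>p. ln (w p) \<partial>P) = (\<integral>p. ?g p \<partial>P)"
    by (rule integral_cong_AE) (use il ig lnw in \<open>auto elim!: eventually_mono\<close>)
  also have "\<dots> = R + (Y2 / 2 - b\<^sup>2 * (Y2 - E2) / 2 + real CARD('n) * ln b)"
    using iW mom_P centered P.prob_space by (simp add: Y2_def)
  finally have E: "(\<integral>p. ln (w p) \<partial>P) = R + (Y2 / 2 - b\<^sup>2 * (Y2 - E2) / 2 + real CARD('n) * ln b)" .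
  have "AE p in P. 0 < w p"
    using Wpos by eventually_elim (use b in \<open>simp add: w_def\<close>)
  then have "(\<integral>p. ln (w p) \<partial>P) \<le> D1"
    unfolding D1_def
    by (intro gibbs_inequality(1)[of k "M'G" w, unfolded P_eq, OF _ _ prob_P k_nonneg w0 w1 _ chain(3) il])
      (auto simp: measurable_M'_pair_iff)
  then have "R \<le> D1 - Y2 / 2 + b\<^sup>2 * (Y2 - E2) / 2 - real CARD('n) * ln b" unfolding E by simp
  with 1 2 show ?thesis by (rule that)
qed

end

section \<open>Stability\<close>

lemma AE_lborel_affineD:
  fixes t :: "'a :: euclidean_space"
  assumes c: "0 < c" and [measurable]: "Measurable.pred borel Q" and ae: "AE y in lborel. Q (t + c *\<^sub>R y)"
  shows "AE z in lborel. Q z"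
proof -
  have "AE z in distr lborel borel (\<lambda>x. t + c *\<^sub>R x). Q z"
    using ae by (subst AE_distr_iff) auto
  then have "AE z in density (distr lborel borel (\<lambda>x. t + c *\<^sub>R x)) (\<lambda>_. \<bar>c\<bar> ^ DIM('a)). Q z"
    by (subst AE_density) (auto elim!: eventually_mono)
  moreover have "density (distr lborel borel (\<lambda>x. t + c *\<^sub>R x)) (\<lambda>_. \<bar>c\<bar> ^ DIM('a)) = lborel"
    using c by (intro lborel_affine[symmetric]) simp
  ultimately show ?thesis by (simp only:)
qed

lemma AE_std_gaussian_iff:
  assumes [measurable]: "Measurable.pred borel Q"
  shows "(AE y in (std_gaussian :: (real ^ 'n) measure). Q y) \<longleftrightarrow> (AE y in lborel. Q y)"
  unfolding std_gaussian_eq_density by (subst AE_density) auto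

context gaussian_split
begin

lemma relative_entropy_f: "relative_entropy (density \<gamma> f) \<gamma> = ereal (\<integral>x. f x * ln (f x) \<partial>\<gamma>)"
proof -
  have "integrable (density \<gamma> f) (\<lambda>z. ln (f z))"
    using ent by (subst integrable_density) (auto simp: dens_nonneg)
  then have "relative_entropy (density \<gamma> f) \<gamma> = ereal (\<integral>x. ln (f x) \<partial>density \<gamma> f)"
    using dens_nonneg by (intro relative_entropy_density std_gaussian.prob_space_axioms) auto
  also have "(\<integral>x. ln (f x) \<partial>density \<gamma> f) = (\<integral>x. f x * ln (f x) \<partial>\<gamma>)"
    by (subst integral_density) (auto simp: dens_nonneg)
  finally show ?thesis .
qed

text \<open>Talagrand's inequality is lossy only in the second factor: its weight in the cost is \<open>b\<^sup>2\<close>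
  instead of \<open>1\<close>, which leaves \<open>a\<^sup>2\<close> of its entropy in the deficit.\<close>

lemma deficit_ge:
  obtains \<delta> where "talagrand_deficit (density \<gamma> f) = ereal \<delta>" "a\<^sup>2 * (2 * D1 - E2) \<le> \<delta>"
proof -
  obtain \<pi> c where \<pi>: "\<pi> \<in> couplings (density \<gamma> f) \<gamma>"
    and cost: "(\<integral>\<^sup>+(x, y). ennreal ((norm (x - y))\<^sup>2) \<partial>\<pi>) = ennreal c" and c: "0 \<le> c"
    and le: "c \<le> 2 * (\<integral>x. m x * ln (m x) \<partial>\<gamma>) + 2 * b\<^sup>2 * D1 + a\<^sup>2 * E2"
    by (rule exists_coupling)
  obtain r where r: "(wasserstein2 (density \<gamma> f) \<gamma>)\<^sup>2 = ereal r" "r \<le> c"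
    using wasserstein2_le[OF \<pi> c] cost by (metis order_refl)
  let ?H = "\<integral>x. f x * ln (f x) \<partial>\<gamma>"
  have "talagrand_deficit (density \<gamma> f) = ereal (2 * ?H - r)"
  proof -
    have "2 * ereal ?H - ereal r = ereal (2 * ?H - r)"
      by (simp only: numeral_eq_ereal times_ereal.simps ereal_minus)
    then show ?thesis by (simp add: talagrand_deficit_def relative_entropy_f r(1))
  qed
  moreover have "a\<^sup>2 * (2 * D1 - E2) \<le> 2 * ?H - r"
  proof -
    have "a\<^sup>2 * (2 * D1 - E2) = 2 * D1 - (2 * b\<^sup>2 * D1 + a\<^sup>2 * E2)"
    proof -
      have "b\<^sup>2 = 1 - a\<^sup>2" using ab by simp
      then show ?thesis by (simp only:) (simp add: algebra_simps)
    qed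
    then show ?thesis using le r(2) ln_f_eq by linarith
  qed
  ultimately show ?thesis by (rule that)
qed

text \<open>The centred conditional entropy \<open>D1 - E2 / 2\<close> is nonnegative: comparison
  with the unit Gaussian around \<eta>.\<close>

lemma E2_le_D1: "E2 / 2 \<le> D1"
  using D1_ge(1)[of 1] by (simp add: field_simps)

text \<open>With \<open>u = Y2 - E2\<close> and \<open>L = - d ln b\<close>, the preceding bound
  reads \<open>R \<le> D - a^2 u / 2 + L\<close>. The case \<open>\<beta> = b\<close> of
  \<open>D1_ge\<close> bounds u from below by \<open>a^2 u / 2 \<ge> b^2 (L - D)\<close>.
  Eliminating u turns \<open>L\<close> into \<open>a^2 L\<close>, at the price of an additional
  \<open>b^2 D\<close>.\<close>

lemma relative_entropy_le:
  assumes a2: "a\<^sup>2 \<le> 1 / 2"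
  obtains R where "relative_entropy (density \<gamma> f) (\<nu> \<star> \<gamma>) = ereal R" "0 \<le> R"
    "R \<le> (2 * D1 - E2) + real CARD('n) * (a\<^sup>2)\<^sup>2"
proof -
  obtain R where R: "relative_entropy (density \<gamma> f) (\<nu> \<star> \<gamma>) = ereal R" "0 \<le> R"
    and R_le: "R \<le> D1 - Y2 / 2 + b\<^sup>2 * (Y2 - E2) / 2 - real CARD('n) * ln b"
    by (rule relative_entropy_bound)
  define u where "u = Y2 - E2"
  define D where "D = D1 - E2 / 2"
  define L where "L = - real CARD('n) * ln b"
  have b2: "b\<^sup>2 = 1 - a\<^sup>2" using ab by simp
  have bpos: "0 < b\<^sup>2" using b by simp
  have D0: "0 \<le> D" using E2_le_D1 by (simp add: D_def)
  have "u / 2 - u / (2 * b\<^sup>2) + L \<le> D"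
  proof -
    have "Y2 / 2 - u / (2 * b\<^sup>2) + L \<le> D1" using D1_ge(1)[OF b] by (simp add: u_def L_def)
    then show ?thesis using u_def D_def by linarith
  qed
  then have "b\<^sup>2 * (u / 2 - u / (2 * b\<^sup>2) + L) \<le> b\<^sup>2 * D"
    using bpos by (intro mult_left_mono) auto
  moreover have "b\<^sup>2 * (u / 2 - u / (2 * b\<^sup>2) + L) = b\<^sup>2 * u / 2 - u / 2 + b\<^sup>2 * L"
    using b by (simp add: algebra_simps)
  ultimately have key: "b\<^sup>2 * u / 2 - u / 2 \<le> b\<^sup>2 * D - b\<^sup>2 * L" by linarith
  have "R \<le> D + (b\<^sup>2 * u / 2 - u / 2) + L"
    using R_le unfolding u_def D_def L_def by (simp add: field_simps)
  also have "\<dots> \<le> D + b\<^sup>2 * D + a\<^sup>2 * L" using key unfolding b2 by (simp add: algebra_simps)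
  also have "b\<^sup>2 * D \<le> D" using D0 unfolding b2 by (simp add: algebra_simps)
  also have "a\<^sup>2 * L \<le> a\<^sup>2 * (real CARD('n) * a\<^sup>2)"
  proof (rule mult_left_mono)
    \<comment> \<open>As \<open>a^2 \<le> 1/2\<close> gives \<open>b^2 \<ge> 1/2\<close>, the
      quotient \<open>a^2 / b^2\<close> is at most \<open>2 a^2\<close>, hence
      \<open>- ln b \<le> a^2\<close>.\<close>
    have "ln (1 / b\<^sup>2) \<le> 1 / b\<^sup>2 - 1" using bpos by (intro ln_le_minus_one) simp
    moreover have "ln (1 / b\<^sup>2) = - 2 * ln b" using b by (simp add: ln_div ln_realpow)
    moreover have "1 / b\<^sup>2 - 1 \<le> 2 * a\<^sup>2"
    proof -
      have "1 - b\<^sup>2 \<le> 2 * a\<^sup>2 * b\<^sup>2"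
        using mult_left_mono[of "1/2" "b\<^sup>2" "2 * a\<^sup>2"] a2 unfolding b2 by simp
      then show ?thesis using bpos by (simp add: field_simps)
    qed
    ultimately have "- ln b \<le> a\<^sup>2" by simp
    then have "real CARD('n) * - ln b \<le> real CARD('n) * a\<^sup>2" by (intro mult_left_mono) auto
    then show "L \<le> real CARD('n) * a\<^sup>2" unfolding L_def by simp
  qed simp
  finally have "R \<le> (2 * D1 - E2) + real CARD('n) * (a\<^sup>2)\<^sup>2"
    unfolding D_def by (simp add: power2_eq_square mult_ac)
  with R show ?thesis by (rule that)
qed

text \<open>Equality in Gibbs' inequality forces the law of \<open>snd\<close> given \<open>fst\<close> to be a translate of
  \<open>\<gamma>\<close>; one slice then shows that \<open>f\<close> is log-affine.\<close>

lemma log_affine_of_equality: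
  assumes eq: "2 * D1 \<le> E2"
  obtains \<theta> where "AE z in \<gamma>. f z = exp (\<theta> \<bullet> z - (norm \<theta>)\<^sup>2 / 2)"
proof -
  define w where "w p = exp (\<eta> (fst p) \<bullet> snd p - (norm (\<eta> (fst p)))\<^sup>2 / 2)" for p :: "(real ^ 'n) \<times> (real ^ 'n)"
  let ?Q = "\<lambda>x. (AE y in \<gamma>. 0 < k (x, y) \<longrightarrow> w (x, y) = k (x, y)) \<and> 0 < m x \<and> (\<integral>\<^sup>+y. ennreal (k (x, y)) \<partial>\<gamma>) = 1"
  have "AE p in P. gauss_dens ((1 / 1) *\<^sub>R (snd p - \<eta> (fst p))) / (1 ^ CARD('n) * gauss_dens (snd p)) = k p"
    using eq by (intro D1_ge(2)) (simp_all add: field_simps)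
  then have "AE p in P. w p = k p"
    by eventually_elim (simp add: w_def gauss_dens_shift)
  \<comment> \<open>Equality is known only almost everywhere under \<open>P\<close>, that is, where
    \<open>k\<close> is positive.\<close>
  then have "AE p in M'G. 0 < k p \<longrightarrow> w p = k p"
    unfolding P_eq[symmetric] by (subst (asm) AE_density) (auto simp: measurable_M'_pair_iff)
  from M'G.AE_pair[OF this]
  have "AE x in M'. AE y in \<gamma>. 0 < k (x, y) \<longrightarrow> w (x, y) = k (x, y)" .
  moreover have "AE x in M'. 0 < m x" by (rule AE_density_pos) simp
  ultimately have "AE x in M'. ?Q x"
    using AE_k_one' by eventually_elim simp
  then have "\<exists>x. ?Q x"
    by (intro eventually_happens'[OF M'.ae_filter_bot])
  then obtain x where x: "AE y in \<gamma>. 0 < k (x, y) \<longrightarrow> w (x, y) = k (x, y)" "0 < m x"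
      "(\<integral>\<^sup>+y. ennreal (k (x, y)) \<partial>\<gamma>) = 1" by blast
  have km[measurable]: "(\<lambda>y. k (x, y)) \<in> borel_measurable borel"
    using measurable_compose[OF measurable_Pair1'[of x borel] k_meas_borel] by simp
  have wm[measurable]: "(\<lambda>y. w (x, y)) \<in> borel_measurable borel"
    unfolding w_def fst_conv snd_conv by measurable
  have w1: "(\<integral>\<^sup>+y. ennreal (w (x, y)) \<partial>\<gamma>) = 1" unfolding w_def fst_conv snd_conv by (rule nn_integral_gauss_tilt)
  \<comment> \<open>On the chosen slice \<open>k\<close> is 0 or equal to \<open>w\<close> almost
    everywhere. As both have mass 1, the dominated function must coincide with the larger
    one.\<close>
  have kw: "AE y in \<gamma>. k (x, y) \<le> w (x, y)"
    using x(1) by eventually_elim (use k_nonneg w_def in \<open>metis exp_ge_zero linorder_not_less order_le_less order_refl\<close>)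
  have "(\<integral>\<^sup>+y. ennreal (w (x, y)) - ennreal (k (x, y)) \<partial>\<gamma>) = (\<integral>\<^sup>+y. ennreal (w (x, y)) \<partial>\<gamma>) - (\<integral>\<^sup>+y. ennreal (k (x, y)) \<partial>\<gamma>)"
    using x(3) kw by (intro nn_integral_diff) (auto elim!: eventually_mono intro!: ennreal_leI)
  then have "(\<integral>\<^sup>+y. ennreal (w (x, y)) - ennreal (k (x, y)) \<partial>\<gamma>) = 0" using x(3) w1 by simp
  then have "AE y in \<gamma>. ennreal (w (x, y)) - ennreal (k (x, y)) = 0"
    by (subst (asm) nn_integral_0_iff_AE) auto
  then have "AE y in \<gamma>. f (a *\<^sub>R x + b *\<^sub>R y) = m x * w (x, y)"
    using kw
  proof eventually_elim
    case (elim y)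
    then have "ennreal (w (x, y)) \<le> ennreal (k (x, y))" by (simp add: diff_eq_0_iff_ennreal)
    then have "k (x, y) = w (x, y)" using elim(2) k_nonneg[of "(x, y)"] by (simp add: ennreal_le_iff)
    moreover have "k (x, y) = f (a *\<^sub>R x + b *\<^sub>R y) / m x" using x(2) by (simp add: cond_density_def W_def)
    ultimately show ?case using x(2) by (simp add: field_simps)
  qed
  \<comment> \<open>On the slice the exponent is linear in y with slope \<open>\<eta> x\<close>. In
    the variable \<open>z = a x + b y\<close> the slope becomes \<open>\<eta> x / b\<close>, and
    everything independent of y is collected in \<open>C\<close>, which normalization forces to be
    1.\<close>
  moreover define \<theta> where "\<theta> = (1 / b) *\<^sub>R \<eta> x"
  let ?e = "\<lambda>z. exp (\<theta> \<bullet> z - (norm \<theta>)\<^sup>2 / 2)"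
  define C where "C = m x * exp (- (\<theta> \<bullet> (a *\<^sub>R x)) - (norm (\<eta> x))\<^sup>2 / 2 + (norm \<theta>)\<^sup>2 / 2)"
  have C: "m x * w (x, y) = C * ?e (a *\<^sub>R x + b *\<^sub>R y)" for y
    using b by (simp add: C_def w_def \<theta>_def mult.assoc exp_add[symmetric] inner_simps)
  ultimately have "AE y in \<gamma>. f (a *\<^sub>R x + b *\<^sub>R y) = C * ?e (a *\<^sub>R x + b *\<^sub>R y)"
    by simp
  then have "AE y in lborel. f (a *\<^sub>R x + b *\<^sub>R y) = C * ?e (a *\<^sub>R x + b *\<^sub>R y)"
    by (subst (asm) AE_std_gaussian_iff) measurable
  then have "AE z in lborel. f z = C * ?e z"
    by (rule AE_lborel_affineD[OF b, rotated]) measurable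
  then have fC: "AE z in \<gamma>. f z = C * ?e z"
    by (subst AE_std_gaussian_iff) measurable
  have C0: "0 \<le> C" using x(2) by (simp add: C_def)
  have "1 = (\<integral>\<^sup>+z. ennreal (f z) \<partial>\<gamma>)" using dens_one by simp
  also have "\<dots> = (\<integral>\<^sup>+z. ennreal C * ennreal (?e z) \<partial>\<gamma>)"
    using fC by (intro nn_integral_cong_AE) (auto elim!: eventually_mono simp: ennreal_mult C0)
  also have "\<dots> = ennreal C * 1" by (subst nn_integral_cmult) (simp_all add: nn_integral_gauss_tilt)
  finally have "C = 1" using C0 by (simp add: ennreal_eq_1)
  then show ?thesis using fC that[of \<theta>] by simp
qed

end

section \<open>Point masses and the choice of the splitting parameter\<close>

lemma return_moments:
  fixes \<theta> :: "real ^ 'n"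
  shows "prob_measure_finite_second_moment (return borel \<theta>)"
    and "cov_matrix (return borel \<theta>) = 0"
proof -
  have "prob_space (return borel \<theta>)" by (rule prob_space_return) simp
  moreover have "integrable (return borel \<theta>) (\<lambda>x. (norm x)\<^sup>2)"
    by (rule integrableI_nonneg) (auto simp: nn_integral_return)
  ultimately show "prob_measure_finite_second_moment (return borel \<theta>)"
    by (simp add: prob_measure_finite_second_moment_def)
  have "barycenter (return borel \<theta>) = \<theta>" by (simp add: barycenter_def integral_return)
  then show "cov_matrix (return borel \<theta>) = 0"
    by (simp add: cov_matrix_def integral_return vec_eq_iff)
qed

lemma zero_psd_le_cov_matrix:
  fixes \<mu> :: "(real ^ 'n) measure"
  assumes "prob_measure_finite_second_moment \<mu>" "barycenter \<mu> = 0"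
  shows "0 \<preceq> cov_matrix \<mu>"
  unfolding psd_le_def psd_matrix_def
  using cov_matrix_quadratic[OF assms]
  by (simp add: transpose_def cov_matrix_def vec_eq_iff mult.commute)

theorem theorem5:
  fixes \<mu> :: "(real ^ 'n) measure"
  assumes "prob_measure_finite_second_moment \<mu>"
    and "barycenter \<mu> = 0"
  shows "\<exists>\<nu> :: (real ^ 'n) measure.
    prob_measure_finite_second_moment \<nu> \<and>
    cov_matrix \<nu> \<preceq> cov_matrix \<mu> \<and>
    (talagrand_deficit \<mu> \<ge> ereal (real CARD('n)) \<longrightarrow>
       talagrand_deficit \<mu> \<ge> relative_entropy \<mu> (\<nu> \<star> std_gaussian) / 6) \<and>
    (talagrand_deficit \<mu> < ereal (real CARD('n)) \<longrightarrow>
       talagrand_deficit \<mu> \<ge>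
         ereal (1 / (3 * sqrt 3)) *
         (relative_entropy \<mu> (\<nu> \<star> std_gaussian) epowr (3 / 2) / ereal (sqrt (real CARD('n)))))"
proof (cases "relative_entropy \<mu> std_gaussian = \<infinity>")
  case True
  \<comment> \<open>Both inequalities are trivial here, so only the covariance bound matters, and a
    point mass satisfies it.\<close>
  then have "talagrand_deficit \<mu> = \<infinity>" by (simp add: talagrand_deficit_def)
  then show ?thesis
    using return_moments[of "0 :: real ^ 'n"] zero_psd_le_cov_matrix[OF assms]
    by (intro exI[of _ "return borel 0"]) simp
next
  case False
  let ?d = "real CARD('n)"
  have d: "0 < ?d" by simp
  have \<mu>: "prob_space \<mu>" "sets \<mu> = sets std_gaussian" and sq: "integrable \<mu> (\<lambda>x. (norm x)\<^sup>2)"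
    using assms(1) by (auto simp: prob_measure_finite_second_moment_def)
  obtain f where f[measurable]: "f \<in> borel_measurable std_gaussian" and f0: "\<And>x. 0 \<le> f x"
    and \<mu>_eq: "\<mu> = density std_gaussian f" and lnf: "integrable \<mu> (\<lambda>x. ln (f x))"
    using relative_entropy_finiteE[OF prob_space_std_gaussian \<mu> False] by metis
  have split: "gaussian_split f a b" if "0 < a" "0 < b" "a\<^sup>2 + b\<^sup>2 = 1" for a b
  proof (unfold_locales)
    show "f \<in> borel_measurable borel" using f by (simp cong: measurable_cong_sets)
    show "(\<integral>\<^sup>+x. ennreal (f x) \<partial>std_gaussian) = 1"
      using prob_space.emeasure_space_1[OF \<mu>(1)] unfolding \<mu>_eq by (simp add: emeasure_density)
    show "integrable std_gaussian (\<lambda>x. f x * ln (f x))" "integrable std_gaussian (\<lambda>x. f x * (norm x)\<^sup>2)"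
      using lnf sq f0 unfolding \<mu>_eq by (subst (asm) (1 2) integrable_density; simp)+
  qed (use f0 that in auto)
  have h: "sqrt (1 / 2) > (0 :: real)" "(sqrt (1 / 2))\<^sup>2 = (1 / 2 :: real)" by simp_all
  \<comment> \<open>The balanced split serves all finite cases: it shows that the deficit is a
    nonnegative real, and it settles the two extreme cases.\<close>
  interpret half: gaussian_split f "sqrt (1 / 2)" "sqrt (1 / 2)" by (rule split) (use h in auto)
  obtain \<delta> where \<delta>: "talagrand_deficit \<mu> = ereal \<delta>" and half_le: "1 / 2 * (2 * half.D1 - half.E2) \<le> \<delta>"
    using half.deficit_ge unfolding \<mu>_eq h(2) by metis
  have \<delta>0: "0 \<le> \<delta>" using half_le half.E2_le_D1 by simp
  consider "?d \<le> \<delta>" | "\<delta> = 0" | "0 < \<delta>" "\<delta> < ?d" using \<delta>0 by linarith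
  then show ?thesis
  proof cases
    case 1
    obtain R where R: "relative_entropy \<mu> (half.\<nu> \<star> std_gaussian) = ereal R"
      and "R \<le> (2 * half.D1 - half.E2) + ?d * ((sqrt (1 / 2))\<^sup>2)\<^sup>2"
      using half.relative_entropy_le unfolding \<mu>_eq h(2) by (metis order_refl)
    then have "R \<le> 2 * \<delta> + ?d / 4" using half_le unfolding h(2) by (simp add: power2_eq_square)
    \<comment> \<open>As \<open>d \<le> \<delta>\<close>, even \<open>R \<le> 9/4 \<delta>\<close>
      holds.\<close>
    then have "R / 6 \<le> \<delta>" using 1 \<delta>0 by linarith
    moreover have "ereal R / 6 = ereal (R / 6)" by (simp only: numeral_eq_ereal ereal_divide) simp
    ultimately have "relative_entropy \<mu> (half.\<nu> \<star> std_gaussian) / 6 \<le> talagrand_deficit \<mu>"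
      unfolding R \<delta> by simp
    then show ?thesis
      using half.finite_second_moment_\<nu> half.cov_\<nu> assms(2) 1 \<delta> \<mu>_eq
      by (intro exI[of _ half.\<nu>]) auto
  next
    case 2
    then have "2 * half.D1 \<le> half.E2" using half_le by simp
    then obtain \<theta> where \<theta>: "AE z in std_gaussian. f z = exp (\<theta> \<bullet> z - (norm \<theta>)\<^sup>2 / 2)"
      by (rule half.log_affine_of_equality)
    have p\<theta>: "prob_space (return borel \<theta>)" by (rule prob_space_return) simp
    have "return borel \<theta> \<star> std_gaussian = density std_gaussian (\<lambda>z. exp (\<theta> \<bullet> z - (norm \<theta>)\<^sup>2 / 2))"
      using std_gaussian_convolution(1)[OF p\<theta>] by (simp add: integral_return)
    also have "\<dots> = \<mu>" unfolding \<mu>_eq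
      using \<theta> by (intro density_cong) (auto elim!: eventually_mono)
    finally have "relative_entropy \<mu> (return borel \<theta> \<star> std_gaussian) = relative_entropy (density \<mu> (\<lambda>_. 1)) \<mu>"
      by (simp add: density_1)
    also have "\<dots> = 0"
      using relative_entropy_density[OF \<mu>(1), of "\<lambda>_. 1"] by (simp add: density_1)
    finally have "relative_entropy \<mu> (return borel \<theta> \<star> std_gaussian) = 0" .
    then show ?thesis
      using return_moments[of \<theta>] zero_psd_le_cov_matrix[OF assms] \<delta> 2 d
      by (intro exI[of _ "return borel \<theta>"]) (simp add: epowr_def)
  next
    case 3
    define r where "r = (\<delta> / ?d) powr (1 / 3)"
    have r0: "0 < r" using 3 by (simp add: r_def)
    have "(\<delta> / ?d) powr (1 / 3) < 1 powr (1 / 3)" using 3 by (intro powr_less_mono2) auto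
    then have r1: "r < 1" by (simp add: r_def)
    have "r ^ 3 = \<delta> / ?d"
      using 3 r0 by (simp add: r_def powr_powr powr_realpow[symmetric])
    then have r3: "\<delta> = ?d * r ^ 3" using d by (simp add: field_simps)
    define a where "a = sqrt (r / 2)"
    define b where "b = sqrt (1 - r / 2)"
    have a2: "a\<^sup>2 = r / 2" "0 < a" using r0 by (simp_all add: a_def)
    have b2: "b\<^sup>2 = 1 - r / 2" "0 < b" using r0 r1 by (simp_all add: b_def)
    interpret gs: gaussian_split f a b by (rule split) (use a2 b2 in auto)
    obtain \<delta>' where "talagrand_deficit \<mu> = ereal \<delta>'" "a\<^sup>2 * (2 * gs.D1 - gs.E2) \<le> \<delta>'"
      using gs.deficit_ge unfolding \<mu>_eq by metis
    then have le: "r / 2 * (2 * gs.D1 - gs.E2) \<le> ?d * r ^ 3" using \<delta> r3 a2 by simp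
    then have "r * (2 * gs.D1 - gs.E2) \<le> r * (2 * ?d * r\<^sup>2)"
      by (simp add: power3_eq_cube power2_eq_square mult_ac)
    then have D: "2 * gs.D1 - gs.E2 \<le> 2 * ?d * r\<^sup>2" using r0 by (rule mult_left_le_imp_le)
    have "a\<^sup>2 \<le> 1 / 2" using a2 r1 by simp
    then obtain R where R: "relative_entropy \<mu> (gs.\<nu> \<star> std_gaussian) = ereal R" "0 \<le> R"
      and "R \<le> (2 * gs.D1 - gs.E2) + ?d * (a\<^sup>2)\<^sup>2"
      using gs.relative_entropy_le unfolding \<mu>_eq by metis
    moreover have "?d * (a\<^sup>2)\<^sup>2 = ?d * r\<^sup>2 / 4" unfolding a2 by (simp add: power_divide)
    ultimately have "R \<le> 2 * ?d * r\<^sup>2 + ?d * r\<^sup>2 / 4" using D by linarith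
    moreover have "0 \<le> ?d * r\<^sup>2" by simp
    \<comment> \<open>The sum of the two terms is \<open>9/4 d r^2\<close>. It is rounded up to
      \<open>3 d r^2\<close> because the power 3/2 of 3 is the constant \<open>3 * sqrt 3\<close>;
      the same power of \<open>d r^2\<close> is \<open>sqrt d\<close> times
      \<open>d r^3 = \<delta>\<close>.\<close>
    ultimately have "R \<le> 3 * (?d * r\<^sup>2)" by linarith
    then have "R powr (3 / 2) \<le> (3 * (?d * r\<^sup>2)) powr (3 / 2)" using R(2) by (intro powr_mono2) auto
    also have "\<dots> = (sqrt (3 * (?d * r\<^sup>2))) ^ 3"
    proof -
      have "Z powr (3 / 2) = sqrt Z ^ 3" if "0 < Z" for Z :: real
      proof -
        have "sqrt Z ^ 3 = (Z powr (1 / 2)) powr 3"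
          using that by (subst powr_numeral) (auto simp: powr_half_sqrt)
        then show ?thesis by (simp add: powr_powr)
      qed
      then show ?thesis using d r0 by simp
    qed
    also have "sqrt (3 * (?d * r\<^sup>2)) = sqrt 3 * (sqrt ?d * r)"
      using r0 by (simp add: real_sqrt_mult)
    also have "(sqrt 3 * (sqrt ?d * r)) ^ 3 = 3 * sqrt 3 * sqrt ?d * (?d * r ^ 3)"
    proof -
      have cube: "sqrt x ^ 3 = x * sqrt x" if "0 \<le> x" for x :: real
        using that by (simp add: power3_eq_cube)
      show ?thesis unfolding power_mult_distrib cube[OF zero_le_numeral] cube[OF of_nat_0_le_iff]
        by (simp only: mult_ac)
    qed
    finally have "R powr (3 / 2) \<le> 3 * sqrt 3 * sqrt ?d * \<delta>" using r3 by simp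
    then have "1 / (3 * sqrt 3) * (R powr (3 / 2) / sqrt ?d) \<le> \<delta>"
      using d by (simp add: field_simps)
    then have "ereal (1 / (3 * sqrt 3)) * (relative_entropy \<mu> (gs.\<nu> \<star> std_gaussian) epowr (3 / 2) / ereal (sqrt ?d)) \<le> talagrand_deficit \<mu>"
      unfolding R(1) \<delta> epowr_def using d by simp
    then show ?thesis
      using gs.finite_second_moment_\<nu> gs.cov_\<nu> assms(2) 3 \<delta> \<mu>_eq
      by (intro exI[of _ gs.\<nu>]) auto
  qed
qed

end
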